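(* Let $n\ge1$, $c>0$, $a\in\mathbb{R}^n$ with $a_i>0$ for all $i$, and $\nu\in\mathbb{R}^n\setminus\partial E_a$. Then $-\nu\notin\overline{\Omega(a,c,\nu)}$ and, for $s>0$, the function $$w_s(x):=\frac{1}{|x+\nu|^{n-2s}}\bigg(1-\sum_{i=1}^n a_i\Big(c\,\frac{x_i+\nu_i}{|x+\nu|^2}-\nu_i\Big)^2\bigg)_+^s,\qquad x\in\mathbb{R}^n\setminus\{-\nu\},\qquad w_s(-\nu):=0,$$ is a pointwise solution of $$(-\Delta)^sw_s(x)=\frac{k}{|x+\nu|^{n+2s}}\quad\text{in }\Omega(a,c,\nu),\qquad w_s=0\quad\text{in }\mathbb{R}^n\setminus\Omega(a,c,\nu),$$ for some constant $k=k(n,s,c,a)>0$.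
   Context: For $a\in\mathbb{R}^n$ with $a_i>0$, $E_a:=\{x\in\mathbb{R}^n:\sum_{i=1}^na_ix_i^2<1\}$ and $$\Omega(a,c,\nu):=\Big\{x\in\mathbb{R}^n\setminus\{-\nu\}:\ \sum_{i=1}^na_i\Big(c\,\frac{x_i+\nu_i}{|x+\nu|^2}-\nu_i\Big)^2<1\Big\}.$$ $f_+$ denotes the positive part. $\mathbb{N}=\{1,2,\dots\}$. Pointwise fractional Laplacian: for $s>0$, $$(-\Delta)^s u(x)=\frac{c_{n,m,s}}{2}\int_{\mathbb{R}^n}\frac{\delta_m u(x,y)}{|y|^{n+2s}}\,dy,\qquad \delta_m u(x,y):=\sum_{k=-m}^m(-1)^k\binom{2m}{m-k}u(x+ky),$$ where $m\in\mathbb{N}$ is any integer with $m>s$ (the value does not depend on this choice), and $c_{n,m,s}$ is the positive constant $$c_{n,m,s}=\begin{cases}\dfrac{4^{s}\Gamma(\frac n2+s)}{\pi^{n/2}\Gamma(-s)}\Big(\sum_{k=1}^{m}(-1)^{k}\binom{2m}{m-k}k^{2s}\Big)^{-1}, & s\in(0,m)\setminus\mathbb{N},\\[2mm] \dfrac{4^{s}\Gamma(\frac n2+s)\,s!}{2\pi^{n/2}}\Big(\sum_{k=2}^m(-1)^{k-s+1}\binom{2m}{m-k}k^{2s}\ln k\Big)^{-1}, & s\in\{1,\dots,m-1\}.\end{cases}$$ *)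

theory Defs
  imports "HOL-Analysis.Analysis"
begin

definition ellipsoid :: "real ^ 'n \<Rightarrow> (real ^ 'n) set" where
  "ellipsoid a = {x. (\<Sum>i\<in>UNIV. a $ i * (x $ i)\<^sup>2) < 1}"

definition kelvin_form :: "real ^ 'n \<Rightarrow> real \<Rightarrow> real ^ 'n \<Rightarrow> real ^ 'n \<Rightarrow> real" where
  "kelvin_form a c \<nu> x =
     (\<Sum>i\<in>UNIV. a $ i * (c * ((x $ i + \<nu> $ i) / (norm (x + \<nu>))\<^sup>2) - \<nu> $ i)\<^sup>2)"

definition Omega :: "real ^ 'n \<Rightarrow> real \<Rightarrow> real ^ 'n \<Rightarrow> (real ^ 'n) set" where
  "Omega a c \<nu> = {x \<in> UNIV - {- \<nu>}. kelvin_form a c \<nu> x < 1}"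

definition w_fun :: "real ^ 'n \<Rightarrow> real \<Rightarrow> real ^ 'n \<Rightarrow> real \<Rightarrow> real ^ 'n \<Rightarrow> real" where
  "w_fun a c \<nu> s x =
     (if x = - \<nu> then 0
      else 1 / norm (x + \<nu>) powr (real CARD('n) - 2 * s)
             * max 0 (1 - kelvin_form a c \<nu> x) powr s)"

definition delta_op :: "nat \<Rightarrow> ('a::real_vector \<Rightarrow> real) \<Rightarrow> 'a \<Rightarrow> 'a \<Rightarrow> real" where
  "delta_op m u x y =
     (\<Sum>k\<in>{- int m..int m}.
        (- 1) powi k * real ((2 * m) choose nat (int m - k)) * u (x + real_of_int k *\<^sub>R y))"

text \<open>Meaningful for \<open>0 < s < m\<close>, with \<open>n\<close> the dimension. In the branch \<open>s \<in> \<nat>\<close>, the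
  integer \<open>s\<close> itself appears as \<open>\<lfloor>s\<rfloor>\<close>.\<close>

definition frac_const :: "nat \<Rightarrow> nat \<Rightarrow> real \<Rightarrow> real" where
  "frac_const n m s =
     (if s \<notin> \<nat> then
        4 powr s * Gamma (real n / 2 + s) / (pi powr (real n / 2) * Gamma (- s))
          * inverse (\<Sum>k=1..m. (- 1) ^ k * real ((2 * m) choose (m - k)) * real k powr (2 * s))
      else
        4 powr s * Gamma (real n / 2 + s) * fact (nat \<lfloor>s\<rfloor>) / (2 * pi powr (real n / 2))
          * inverse (\<Sum>k=2..m. (- 1) powi (int k - \<lfloor>s\<rfloor> + 1)
                       * real ((2 * m) choose (m - k)) * real k powr (2 * s) * ln (real k)))"

definition frac_integrand :: "nat \<Rightarrow> real \<Rightarrow> (real ^ 'n \<Rightarrow> real) \<Rightarrow> real ^ 'n \<Rightarrow> real ^ 'n \<Rightarrow> real" where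
  "frac_integrand m s u x y = delta_op m u x y / norm y powr (real CARD('n) + 2 * s)"

definition frac_laplacian :: "nat \<Rightarrow> real \<Rightarrow> (real ^ 'n \<Rightarrow> real) \<Rightarrow> real ^ 'n \<Rightarrow> real" where
  "frac_laplacian m s u x =
     frac_const CARD('n) m s / 2 * integral\<^sup>L lebesgue (frac_integrand m s u x)"

text \<open>The order \<open>m\<close> of the finite difference is an arbitrary integer exceeding \<open>s\<close>; the value
  of \<open>(-\<Delta>)\<^sup>s u(x)\<close> must not depend on it, so all admissible \<open>m\<close> are required to give \<open>v\<close>.
  Integrability is explicit because the library integral of a non-integrable function is \<open>0\<close>.\<close>

definition has_frac_laplacian ::
  "(real ^ 'n \<Rightarrow> real) \<Rightarrow> real \<Rightarrow> real \<Rightarrow> real ^ 'n \<Rightarrow> bool" where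
  "has_frac_laplacian u v s x \<longleftrightarrow>
     (\<forall>m::nat. s < real m \<longrightarrow>
        integrable lebesgue (frac_integrand m s u x) \<and> frac_laplacian m s u x = v)"

definition pointwise_solution ::
  "real \<Rightarrow> (real ^ 'n) set \<Rightarrow> (real ^ 'n \<Rightarrow> real) \<Rightarrow> (real ^ 'n \<Rightarrow> real) \<Rightarrow> bool" where
  "pointwise_solution s U f u \<longleftrightarrow>
     (\<forall>x\<in>U. has_frac_laplacian u (f x) s x) \<and> (\<forall>x\<in>- U. u x = 0)"

end

theory Submission
  imports Defs "HOL-Complex_Analysis.Complex_Analysis"
begin

text \<open>
  The integral that defines the fractional Laplacian converges for every order, but the differences
  \<open>u (x + k y) - u x\<close> that it is made of are integrable one by one only for \<open>s < 1/2\<close>. The idea is to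
  compute everything in that range, where no regularisation is needed, and to reach the other orders by
  analytic continuation in \<open>s\<close>.

  Put \<open>X = x + \<nu>\<close>. Then \<open>w\<^sub>s(x) = |X|\<^sup>-\<^sup>n P(X)\<^sup>s\<close> where \<open>P > 0\<close>, and \<open>0\<close> elsewhere, with \<open>P\<close> the function
  \<open>kelvin_base\<close> that does not involve \<open>s\<close>; so the order may be complex. At a point with \<open>P > 0\<close> this
  function is analytic in the space variable, hence its central difference of order \<open>2m\<close> is
  \<open>O(|y|^(2m))\<close> locally uniformly in \<open>s\<close>; it vanishes near \<open>X = 0\<close> and grows at most like
  \<open>|X|^(2 Re s - n)\<close>. Therefore \<open>F(s) = \<integral> \<delta>\<^sub>m w\<^sub>s(x, y) |y|^(-n-2s) dy\<close> is holomorphic in the strip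
  \<open>0 < Re s < m\<close> (\<open>holomorphic_diff_integral\<close>, \<open>central_diff_kelvin_profile_bound\<close>).

  For \<open>0 < s < 1/2\<close> scaling gives \<open>F(s) = 2 \<sigma>(s) \<integral> (w\<^sub>s(z) - w\<^sub>s(x)) |z - x|^(-n-2s) dz\<close>, where
  \<open>\<sigma>\<close> is the sum of \<open>(-1)^k (2m choose m-k) k^(2s)\<close> over \<open>1 \<le> k \<le> m\<close> (\<open>integral_diff_split\<close>). The kernel is
  conformally covariant, so inversion carries this integral to the one for the profile
  \<open>(1 - \<Sum> a\<^sub>i y\<^sub>i\<^sup>2)\<^sup>s\<close> at the image \<open>\<xi>\<close> of \<open>x\<close> inside the ellipsoid. The weight \<open>|z|^(2s-n)\<close> adds a
  correction term, which is zero because inversion in the sphere through \<open>X\<close> changes its sign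
  (\<open>integral_fundamental_difference\<close>). In polar coordinates about \<open>\<xi>\<close> the profile is a truncated
  quadratic \<open>\<alpha> + \<beta> t - \<gamma> t\<^sup>2\<close> on each line. Decomposing its power into layers leaves, at level \<open>l\<close>, the
  logarithm of the product of the moduli of the two roots of \<open>(\<gamma> + l) t\<^sup>2 = \<alpha> + \<beta> t\<close>. By Vieta this
  product does not contain \<open>\<beta>\<close>, and comparison with the layers of the subtracted constant removes \<open>\<alpha>\<close>
  as well: the line contributes \<open>- \<Gamma>(s) \<Gamma>(1-s) \<gamma>\<^sup>s\<close>, wherever \<open>\<xi>\<close> lies (\<open>integral_line_difference\<close>).

  Altogether \<open>sin(\<pi> s) F(s) = - 2 \<pi> \<sigma>(s) E(s)\<close> with an explicit entire function \<open>E\<close>, first for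
  \<open>0 < s < 1/2\<close> and then in the whole strip (\<open>order_continuation\<close>). For a noninteger order one divides by
  the sine, at an integer order one compares derivatives. The normalising constant is made to cancel
  \<open>\<sigma>(s)\<close>, respectively \<open>\<sigma>'(s)\<close>, and this works because these numbers are nonzero: \<open>\<sigma>\<close> is a sum of \<open>m\<close>
  exponentials, so Rolle's theorem allows it at most \<open>m - 1\<close> real zeros with multiplicity, and
  \<open>1, \<dots>, m - 1\<close> are zeros already (\<open>kernel_sum_nonzero\<close>, \<open>kernel_sum_simple_zero\<close>).
\<close>

section \<open>Central difference weights and the exponential sum they generate\<close>

text \<open>
  One factor \<open>x + i\<close> of the power is split off. The part with \<open>x\<close> is the same sum for a lower power; in
  the part with \<open>i\<close>, absorption \<open>i (N choose i) = N (N-1 choose i-1)\<close> lowers \<open>N\<close> and moves \<open>x\<close> to \<open>x + 1\<close>,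
  which is why the base point is kept general.
\<close>
lemma alternating_binomial_power_sum_zero:
  fixes x :: "'a::comm_ring_1"
  assumes "j < N"
  shows "(\<Sum>i\<le>N. (-1) ^ i * of_nat (N choose i) * (x + of_nat i) ^ j) = 0"
  using assms
proof (induction j arbitrary: N x)
  case 0
  then show ?case using choose_alternating_sum[of N, where ?'a='a] by simp
next
  case (Suc j)
  then obtain M where M: "N = Suc M" "j < M" by (cases N) auto
  have *: "(\<Sum>i\<le>N. (-1) ^ i * of_nat (N choose i) * (of_nat i * (x + of_nat i) ^ j))
      = - of_nat N * (\<Sum>i\<le>M. (-1) ^ i * of_nat (M choose i) * ((x + 1) + of_nat i) ^ j)"
  proof -
    have "(\<Sum>i\<le>N. (-1) ^ i * of_nat (N choose i) * (of_nat i * (x + of_nat i) ^ j))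
       = (\<Sum>i\<le>M. (-1) ^ Suc i * of_nat (N choose Suc i) * (of_nat (Suc i) * (x + of_nat (Suc i)) ^ j))"
      unfolding M by (subst sum.atMost_Suc_shift) simp
    also have "\<dots> = (\<Sum>i\<le>M. - of_nat N * ((-1) ^ i * of_nat (M choose i) * ((x + 1) + of_nat i) ^ j))"
    proof (rule sum.cong[OF refl])
      fix i
      have "of_nat (N choose Suc i) * of_nat (Suc i) = (of_nat N * of_nat (M choose i) :: 'a)"
        using Suc_times_binomial_eq[of M i] unfolding M of_nat_mult[symmetric] by (simp only: mult.commute)
      then show "(-1) ^ Suc i * of_nat (N choose Suc i) * (of_nat (Suc i) * (x + of_nat (Suc i)) ^ j)
          = - of_nat N * ((-1) ^ i * of_nat (M choose i) * ((x + 1) + of_nat i) ^ j)"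
      proof -
        assume *: "of_nat (N choose Suc i) * of_nat (Suc i) = (of_nat N * of_nat (M choose i) :: 'a)"
        have "(-1) ^ Suc i * of_nat (N choose Suc i) * (of_nat (Suc i) * (x + of_nat (Suc i)) ^ j)
           = (-1) ^ Suc i * (of_nat (N choose Suc i) * of_nat (Suc i)) * (x + of_nat (Suc i)) ^ j"
          by (simp only: mult.assoc)
        then show ?thesis unfolding * by (simp add: add_ac mult_ac)
      qed
    qed
    finally show ?thesis by (simp only: sum_distrib_left)
  qed
  have "(\<Sum>i\<le>N. (-1) ^ i * of_nat (N choose i) * (x + of_nat i) ^ Suc j)
      = x * (\<Sum>i\<le>N. (-1) ^ i * of_nat (N choose i) * (x + of_nat i) ^ j)
      + (\<Sum>i\<le>N. (-1) ^ i * of_nat (N choose i) * (of_nat i * (x + of_nat i) ^ j))"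
    by (simp add: sum_distrib_left sum.distrib[symmetric] algebra_simps)
  then show ?case unfolding * using Suc.IH[of N x] Suc.IH[of M "x+1"] M by simp
qed

text \<open>Up to the sign \<open>(-1)^m\<close>, the weights of the central difference of order \<open>2m\<close>.\<close>
definition diff_coeff :: "nat \<Rightarrow> int \<Rightarrow> real" where
  "diff_coeff m k = (-1) powi k * real ((2 * m) choose nat (int m - k))"

lemma diff_coeff_minus: "\<bar>k\<bar> \<le> int m \<Longrightarrow> diff_coeff m (- k) = diff_coeff m k"
proof -
  assume k: "\<bar>k\<bar> \<le> int m"
  have "(2 * m) choose nat (int m - k) = (2 * m) choose (2 * m - nat (int m - k))"
    by (rule binomial_symmetric) (use k in auto)
  moreover have "2 * m - nat (int m - k) = nat (int m + k)" using k by auto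
  moreover have "(- 1 :: real) powi (- k) = (-1) powi k" 
    by (simp add: power_int_minus) (metis inverse_minus_eq inverse_1 power_int_inverse)
  ultimately show ?thesis by (simp add: diff_coeff_def)
qed

lemma diff_coeff_of_nat: "k \<le> m \<Longrightarrow> diff_coeff m (int k) = (-1) ^ k * real ((2 * m) choose (m - k))"
  by (simp add: diff_coeff_def nat_diff_distrib' power_int_of_nat)

lemma sum_abs_diff_coeff: "(\<Sum>k\<in>{- int m..int m}. \<bar>diff_coeff m k\<bar>) = 4 ^ m"
proof -
  have "(\<Sum>k\<in>{- int m..int m}. \<bar>diff_coeff m k\<bar>) = (\<Sum>i\<le>2*m. real ((2*m) choose i))"
    by (rule sum.reindex_bij_witness[of _ "\<lambda>i. int m - int i" "\<lambda>k. nat (int m - k)"])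
       (auto simp: diff_coeff_def abs_mult power_int_abs)
  also have "\<dots> = 2 ^ (2*m)" by (simp flip: of_nat_sum add: choose_row_sum)
  finally show ?thesis by (simp add: power_mult)
qed

text \<open>
  A difference of order \<open>2m\<close> annihilates polynomials of lower degree. These relations make the
  singularity of the kernel at \<open>y = 0\<close> integrable for all orders below \<open>m\<close>, and they are also the source of
  the zeros of the exponential sum below.
\<close>
lemma diff_coeff_moments:
  assumes "j < 2 * m"
  shows "(\<Sum>k\<in>{- int m..int m}. diff_coeff m k * real_of_int k ^ j) = 0"
proof -
  have "(\<Sum>k\<in>{- int m..int m}. diff_coeff m k * real_of_int k ^ j)
     = (\<Sum>i\<le>2*m. (-1) ^ (m + j) * ((-1) ^ i * of_nat ((2*m) choose i) * ((- real m) + of_nat i) ^ j))"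
  proof (rule sum.reindex_bij_witness[of _ "\<lambda>i. int m - int i" "\<lambda>k. nat (int m - k)"])
    fix k assume "k \<in> {- int m..int m}"
    then obtain i where i: "i \<le> 2*m" "k = int m - int i" 
      by (intro that[of "nat (int m - k)"]) auto
    have "(- 1 :: real) powi k = (-1) ^ m * (-1) ^ i"
      unfolding i by (simp add: power_int_diff divide_inverse flip: power_inverse)
    moreover have "real_of_int k ^ j = (-1)^j * (- real m + real i) ^ j"
      unfolding i power_mult_distrib[symmetric] by simp
    ultimately show "(-1) ^ (m + j) * ((-1) ^ nat (int m - k) * of_nat ((2*m) choose nat (int m - k)) * ((- real m) + of_nat (nat (int m - k))) ^ j)
       = diff_coeff m k * real_of_int k ^ j"
      using i by (simp add: diff_coeff_def power_add)
  qed auto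
  also have "\<dots> = 0"
    using alternating_binomial_power_sum_zero[OF assms, of "- real m"] by (simp add: sum_distrib_left[symmetric])
  finally show ?thesis .
qed

lemma sum_symmetric_int_interval:
  fixes f :: "int \<Rightarrow> 'a::ab_group_add"
  shows "(\<Sum>k\<in>{- int m..int m}. f k) = f 0 + (\<Sum>k=1..m. f (int k) + f (- int k))"
proof -
  have "{- int m..int m} = insert 0 (int ` {1..m} \<union> (\<lambda>k. - int k) ` {1..m})" (is "?L = ?R")
  proof
    show "?L \<subseteq> ?R"
    proof
      fix k assume k: "k \<in> ?L"
      have "k = 0 \<or> k = int (nat k) \<and> nat k \<in> {1..m} \<or> k = - int (nat (-k)) \<and> nat (-k) \<in> {1..m}"
        using k by auto
      then show "k \<in> ?R" by blast
    qed
  qed auto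
  then have "(\<Sum>k\<in>{- int m..int m}. f k) = f 0 + sum f (int ` {1..m} \<union> (\<lambda>k. - int k) ` {1..m})"
    by (simp only:) (subst sum.insert, auto)
  also have "sum f (int ` {1..m} \<union> (\<lambda>k. - int k) ` {1..m}) = sum f (int ` {1..m}) + sum f ((\<lambda>k. - int k) ` {1..m})"
    by (rule sum.union_disjoint) auto
  also have "\<dots> = (\<Sum>k=1..m. f (int k) + f (- int k))"
    by (simp add: sum.reindex inj_on_def sum.distrib)
  finally show ?thesis .
qed

text \<open>
  Replacing \<open>y\<close> by \<open>k y\<close> in a first difference multiplies its integral by \<open>k^(2q)\<close>, so this is half the
  factor between the integrals of the central difference and of the first difference. The order is complex because
  the factor takes part in the analytic continuation.
\<close>
definition kernel_sum :: "nat \<Rightarrow> complex \<Rightarrow> complex" where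
  "kernel_sum m q = (\<Sum>k=1..m. of_real (diff_coeff m (int k)) * exp (2 * q * of_real (ln (real k))))"

abbreviation kernel_factor :: "nat \<Rightarrow> real \<Rightarrow> real" where
  "kernel_factor m q \<equiv> \<Sum>k=1..m. (-1) ^ k * real ((2*m) choose (m - k)) * real k powr (2 * q)"

text \<open>Half the derivative of \<open>kernel_factor m\<close> at \<open>j\<close>.\<close>
abbreviation kernel_slope :: "nat \<Rightarrow> nat \<Rightarrow> real" where
  "kernel_slope m j \<equiv> \<Sum>k=1..m. diff_coeff m (int k) * ln (real k) * real k powr (2 * real j)"

lemma kernel_sum_of_real:
  "kernel_sum m (of_real q) = of_real (kernel_factor m q)"
  unfolding kernel_sum_def of_real_sum
proof (rule sum.cong[OF refl])
  fix k assume k: "k \<in> {1..m}"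
  then have "exp (2 * complex_of_real q * of_real (ln (real k))) = of_real (real k powr (2 * q))"
    by (simp add: powr_def exp_of_real[symmetric])
  then show "of_real (diff_coeff m (int k)) * exp (2 * complex_of_real q * of_real (ln (real k))) =
     complex_of_real ((-1) ^ k * real ((2*m) choose (m - k)) * real k powr (2 * q))"
    using k by (simp add: diff_coeff_of_nat)
qed

text \<open>The exponent \<open>2j\<close> is a natural number below \<open>2m\<close>, so this is half of a vanishing moment.\<close>
lemma kernel_sum_of_nat_zero:
  assumes "1 \<le> j" "j < m"
  shows "kernel_factor m (real j) = 0"
proof -
  have "0 = (\<Sum>k\<in>{- int m..int m}. diff_coeff m k * real_of_int k ^ (2 * j))"
    using assms by (subst diff_coeff_moments) auto
  also have "\<dots> = (\<Sum>k=1..m. 2 * (diff_coeff m (int k) * real k ^ (2 * j)))"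
    using assms by (subst sum_symmetric_int_interval) (auto intro!: sum.cong simp: diff_coeff_minus power_mult)
  also have "\<dots> = 2 * kernel_factor m (real j)"
    unfolding sum_distrib_left
    by (intro sum.cong refl) (auto simp: diff_coeff_of_nat powr_realpow[symmetric])
  finally show ?thesis by simp
qed

text \<open>
  The new zeros lie strictly between consecutive old ones. That they avoid the old zeros allows a double
  zero to be counted in addition; that each has an old zero above it carries the induction over the
  largest element.
\<close>
lemma rolle_finite_set:
  fixes g g' :: "real \<Rightarrow> real"
  assumes "finite Z" "\<And>z. z \<in> Z \<Longrightarrow> g z = 0" "\<And>x. (g has_real_derivative g' x) (at x)"
  shows "\<exists>Z'. finite Z' \<and> card Z = card Z' + (if Z = {} then 0 else 1) \<and> Z' \<inter> Z = {} \<and>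
           (\<forall>z\<in>Z'. g' z = 0 \<and> (\<exists>a\<in>Z. z < a))"
  using assms(1,2)
proof (induction Z rule: finite_linorder_max_induct)
  case empty
  then show ?case by (intro exI[of _ "{}"]) auto
next
  case (insert b A)
  then obtain Z' where Z': "finite Z'" "card A = card Z' + (if A = {} then 0 else 1)" "Z' \<inter> A = {}"
    "\<And>z. z \<in> Z' \<Longrightarrow> g' z = 0 \<and> (\<exists>a\<in>A. z < a)" by auto
  show ?case
  proof (cases "A = {}")
    case True
    then show ?thesis by (intro exI[of _ "{}"]) auto
  next
    case False
    define M where "M = Max A"
    have M: "M \<in> A" "\<And>a. a \<in> A \<Longrightarrow> a \<le> M" "M < b" using insert False by (auto simp: M_def)
    have "\<exists>z. M < z \<and> z < b \<and> (g has_real_derivative 0) (at z)"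
    proof (rule Rolle)
      show "continuous_on {M..b} g" 
        by (meson assms(3) DERIV_isCont continuous_at_imp_continuous_on)
      show "g M = g b" using insert.prems M by auto
      show "g differentiable (at x)" for x using assms(3)[of x] real_differentiable_def by blast
    qed (use M in auto)
    then obtain z where z: "M < z" "z < b" "g' z = 0" using assms(3) DERIV_unique by blast
    have "z \<notin> Z'" using Z'(4)[of z] M(2) z(1) by force
    moreover have "z \<notin> A" using M(2) z by force
    moreover have "b \<notin> Z'" using Z'(4)[of b] insert.hyps by force
    moreover have "b \<notin> A" using insert.hyps by force
    ultimately show ?thesis using Z' z False insert.hyps
      by (intro exI[of _ "insert z Z'"]) auto
  qed
qed

lemma exponential_sum_derivative:
  assumes "finite I"
  shows "((\<lambda>q. \<Sum>i\<in>I. c i * exp (l i * q)) has_real_derivative (\<Sum>i\<in>I. c i * l i * exp (l i * q))) (at q)"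
  by (auto intro!: derivative_eq_intros sum.cong)

text \<open>
  After division by one of the exponentials that term is constant, so differentiation removes it, while
  Rolle's theorem gives up only one zero.
\<close>
lemma exponential_sum_zeros:
  fixes c l :: "'b \<Rightarrow> real"
  assumes "finite I" "inj_on l I" "finite Z" "card I \<le> card Z"
    and "\<And>z. z \<in> Z \<Longrightarrow> (\<Sum>i\<in>I. c i * exp (l i * z)) = 0" and "i \<in> I"
  shows "c i = 0"
  using assms
proof (induction I arbitrary: c l Z i rule: finite_induct)
  case (insert j I)
  define g where "g q = c j + (\<Sum>i\<in>I. c i * exp ((l i - l j) * q))" for q
  have g: "g q = exp (- l j * q) * (\<Sum>i\<in>insert j I. c i * exp (l i * q))" for q
    using insert.hyps by (simp add: g_def sum_distrib_left distrib_left mult.left_commute flip: exp_add)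
       (simp add: algebra_simps)
  have g0: "g z = 0" if "z \<in> Z" for z using insert.prems(4)[OF that] by (simp only: g mult_zero_right)
  have g': "(g has_real_derivative (\<Sum>i\<in>I. (c i * (l i - l j)) * exp ((l i - l j) * q))) (at q)" for q
    unfolding g_def using exponential_sum_derivative[OF insert.hyps(1), of c "\<lambda>i. l i - l j"] DERIV_add[OF DERIV_const[of "c j"]] by simp
  have "Z \<noteq> {}" using insert by auto
  obtain Z' where Z': "finite Z'" "card Z = card Z' + 1"
      "\<And>z. z \<in> Z' \<Longrightarrow> (\<Sum>i\<in>I. (c i * (l i - l j)) * exp ((l i - l j) * z)) = 0"
    using rolle_finite_set[OF insert.prems(2) g0 g'] \<open>Z \<noteq> {}\<close> by auto
  have cI: "c i = 0" if "i \<in> I" for i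
  proof -
    have "c i * (l i - l j) = 0"
      by (rule insert.IH[OF _ Z'(1) _ Z'(3) that]) 
        (use insert.prems insert.hyps Z' in \<open>auto simp: inj_on_def\<close>)
    moreover have "l i \<noteq> l j" using insert.prems(1) insert.hyps(2) that by (auto simp: inj_on_def)
    ultimately show ?thesis by simp
  qed
  obtain z where "z \<in> Z" using \<open>Z \<noteq> {}\<close> by auto
  then have "c j = 0" using g0[of z] cI by (simp add: g_def)
  then show ?case using cI insert.prems(5) by auto
qed auto

text \<open>
  One step of the preceding argument; the double zero survives the differentiation and is not among the
  points that Rolle's theorem provides, so no zero is lost in this step.
\<close>
lemma exponential_sum_double_zero:
  fixes c l :: "'b \<Rightarrow> real"
  assumes "finite I" "inj_on l I" "finite Z" "card I \<le> Suc (card Z)"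
    and zero: "\<And>z. z \<in> Z \<Longrightarrow> (\<Sum>i\<in>I. c i * exp (l i * z)) = 0" and "i \<in> I"
    and "s \<in> Z" and double: "(\<Sum>i\<in>I. c i * l i * exp (l i * s)) = 0"
  shows "c i = 0"
proof -
  define g where "g q = exp (- l i * q) * (\<Sum>j\<in>I. c j * exp (l j * q))" for q
  have g: "g q = (\<Sum>j\<in>I. c j * exp ((l j - l i) * q))" for q
    by (simp add: g_def sum_distrib_left mult.left_commute flip: exp_add) (simp add: algebra_simps)
  have g': "(g has_real_derivative (\<Sum>j\<in>I. (c j * (l j - l i)) * exp ((l j - l i) * q))) (at q)" for q
    unfolding g using exponential_sum_derivative[OF assms(1), of c "\<lambda>j. l j - l i"] by simp
  have g0: "g z = 0" if "z \<in> Z" for z using zero[OF that] by (simp add: g_def)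
  obtain Z' where Z': "finite Z'" "card Z = card Z' + 1" "Z' \<inter> Z = {}"
      "\<And>z. z \<in> Z' \<Longrightarrow> (\<Sum>j\<in>I. (c j * (l j - l i)) * exp ((l j - l i) * z)) = 0"
    using rolle_finite_set[OF assms(3) g0 g'] \<open>s \<in> Z\<close> by (auto split: if_splits)
  have s: "(\<Sum>j\<in>I. (c j * (l j - l i)) * exp ((l j - l i) * s)) = 0"
  proof -
    have "(\<Sum>j\<in>I. (c j * (l j - l i)) * exp ((l j - l i) * s))
        = exp (- l i * s) * ((\<Sum>j\<in>I. c j * l j * exp (l j * s)) - l i * (\<Sum>j\<in>I. c j * exp (l j * s)))"
      by (simp add: sum_distrib_left sum_subtractf[symmetric] ring_distribs exp_diff exp_minus divide_inverse mult_ac)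
    then show ?thesis using double zero[OF \<open>s \<in> Z\<close>] by simp
  qed
  have other: "c j = 0" if "j \<in> I - {i}" for j
  proof -
    have "c j * (l j - l i) = 0"
    proof (rule exponential_sum_zeros[of "I - {i}" "\<lambda>j. l j - l i" "insert s Z'" "\<lambda>j. c j * (l j - l i)"])
      show "inj_on (\<lambda>j. l j - l i) (I - {i})" using assms(2) by (auto simp: inj_on_def)
      have "s \<notin> Z'" using Z' \<open>s \<in> Z\<close> by auto
      then show "card (I - {i}) \<le> card (insert s Z')" using assms Z' by (simp add: card_Diff_singleton)
      fix z assume "z \<in> insert s Z'"
      then have "(\<Sum>j\<in>I. (c j * (l j - l i)) * exp ((l j - l i) * z)) = 0" using s Z' by auto
      then show "(\<Sum>j\<in>I - {i}. c j * (l j - l i) * exp ((l j - l i) * z)) = 0"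
        using assms by (simp add: sum.remove[of I i])
    qed (use assms Z' that in auto)
    moreover have "l j \<noteq> l i" using assms(2,6) that by (auto simp: inj_on_def)
    ultimately show ?thesis by simp
  qed
  have "0 = (\<Sum>j\<in>I. c j * exp (l j * s))" using zero[OF \<open>s \<in> Z\<close>] by simp
  also have "\<dots> = c i * exp (l i * s)" using assms other by (subst sum.remove[of I i]) auto
  finally show ?thesis by simp
qed

lemma kernel_sum_exponential_form:
  "kernel_factor m q
    = (\<Sum>k=1..m. diff_coeff m (int k) * exp (2 * ln (real k) * q))"
  by (intro sum.cong refl) (auto simp: diff_coeff_of_nat powr_def mult_ac)

text \<open>
  The rates \<open>2 ln k\<close> of the \<open>m\<close> exponentials are distinct, and \<open>1, \<dots>, m - 1\<close> are zeros already, so another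
  zero would force the weight of \<open>k = 1\<close> to vanish.
\<close>
lemma kernel_sum_nonzero:
  assumes "0 < s" "s < real m" "s \<notin> \<nat>"
  shows "kernel_factor m s \<noteq> 0"
proof
  assume 0: "kernel_factor m s = 0"
  have "m \<ge> 1" using assms by (cases m) auto
  have "diff_coeff m (int 1) = 0"
  proof (rule exponential_sum_zeros[of "{1..m}" "\<lambda>k. 2 * ln (real k)" "insert s (real ` {1..<m})" "\<lambda>k. diff_coeff m (int k)"])
    have "s \<notin> real ` {1..<m}" using assms by auto
    then show "card {1..m} \<le> card (insert s (real ` {1..<m}))"
      by (simp add: card_image)
    fix z assume "z \<in> insert s (real ` {1..<m})"
    then show "(\<Sum>k=1..m. diff_coeff m (int k) * exp (2 * ln (real k) * z)) = 0"
      unfolding kernel_sum_exponential_form[symmetric] using 0 kernel_sum_of_nat_zero by auto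
  qed (use \<open>m \<ge> 1\<close> in \<open>auto simp: inj_on_def\<close>)
  then show False using \<open>m \<ge> 1\<close> by (simp add: diff_coeff_def)
qed

lemma kernel_sum_simple_zero:
  assumes "1 \<le> j" "j < m"
  shows "kernel_slope m j \<noteq> 0"
proof
  assume 0: "kernel_slope m j = 0"
  have "diff_coeff m (int 1) = 0"
  proof (rule exponential_sum_double_zero[of "{1..m}" "\<lambda>k. 2 * ln (real k)" "real ` {1..<m}" "\<lambda>k. diff_coeff m (int k)" _ "real j"])
    show "card {1..m} \<le> Suc (card (real ` {1..<m}))"
      by (simp add: card_image)
    have "(\<Sum>k=1..m. diff_coeff m (int k) * (2 * ln (real k)) * exp (2 * ln (real k) * real j))
       = 2 * kernel_slope m j"
      unfolding sum_distrib_left by (intro sum.cong refl) (auto simp: powr_def mult_ac)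
    with 0 show "(\<Sum>k=1..m. diff_coeff m (int k) * (2 * ln (real k)) * exp (2 * ln (real k) * real j)) = 0" by simp
    fix z assume "z \<in> real ` {1..<m}"
    then show "(\<Sum>k=1..m. diff_coeff m (int k) * exp (2 * ln (real k) * z)) = 0"
      unfolding kernel_sum_exponential_form[symmetric] using kernel_sum_of_nat_zero by auto
  qed (use assms in \<open>auto simp: inj_on_def\<close>)
  then show False using assms by (simp add: diff_coeff_def)
qed

section \<open>Polar coordinates along rays, and inversion of the space\<close>

lemma nn_integral_lborel_scaleR:
  fixes f :: "'a::euclidean_space \<Rightarrow> ennreal"
  assumes [measurable]: "f \<in> borel_measurable borel" and "c \<noteq> 0"
  shows "(\<integral>\<^sup>+x. f x \<partial>lborel) = ennreal (\<bar>c\<bar> ^ DIM('a)) * (\<integral>\<^sup>+x. f (c *\<^sub>R x) \<partial>lborel)"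
  by (subst lborel_affine[OF \<open>c \<noteq> 0\<close>, of 0])
     (simp add: nn_integral_density nn_integral_distr nn_integral_cmult)

lemma has_integral_iff_nn_integral_borel:
  fixes f :: "'a::euclidean_space \<Rightarrow> real"
  assumes "f \<in> borel_measurable borel" "\<And>x. 0 \<le> f x"
  shows "(f has_integral r) UNIV \<longleftrightarrow> (\<integral>\<^sup>+x. f x \<partial>lborel) = ennreal r \<and> 0 \<le> r"
proof -
  have "f \<in> lebesgue \<rightarrow>\<^sub>M borel" using assms(1) by (intro measurable_completion) simp
  then show ?thesis
    using has_integral_iff_nn_integral_lebesgue[of f r] assms(2) by (simp add: nn_integral_completion)
qed

text \<open>
  The change of variables theorem is an equivalence between integrability on both sides, so it compares the
  two measures on every Borel set, including those where both are infinite. The equality of measures then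
  gives the formula for all nonnegative \<open>g\<close>.
\<close>
lemma nn_integral_inverse_halfline:
  fixes g :: "real \<Rightarrow> ennreal"
  assumes b: "b > 0" and g[measurable]: "g \<in> borel_measurable borel"
  shows "(\<integral>\<^sup>+t. indicator {0<..} t * g t \<partial>lborel)
       = (\<integral>\<^sup>+t. indicator {0<..} t * ennreal (b / t\<^sup>2) * g (b / t) \<partial>lborel)"
proof -
  let ?w = "\<lambda>t. indicator {0<..} t * ennreal (b / t\<^sup>2)"
  have "density lborel (indicator {0<..}) = distr (density lborel ?w) borel (\<lambda>t. b / t)"
  proof (rule measure_eqI)
    fix A assume "A \<in> sets (density lborel (indicator {0<..} :: real \<Rightarrow> ennreal))"
    then have A[measurable]: "A \<in> sets borel" by simp
    define f where "f = (\<lambda>t. indicator {0<..} t * indicator A t :: real)"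
    define h where "h = (\<lambda>t. indicator {0<..} t * (b / t\<^sup>2) * indicator A (b / t) :: real)"
    have m[measurable]: "f \<in> borel_measurable borel" "h \<in> borel_measurable borel"
      unfolding f_def h_def by measurable
    have nn: "f t \<ge> 0" "h t \<ge> 0" for t using b by (auto simp: f_def h_def)
    have img: "(\<lambda>t. b / t) ` {0<..} = {0<..}"
    proof (intro equalityI subsetI)
      fix y :: real assume "y \<in> {0<..}"
      then show "y \<in> (\<lambda>t. b / t) ` {0<..}" using b by (intro image_eqI[of _ _ "b / y"]) auto
    qed (use b in auto)
    have *: "(\<lambda>t. \<bar>- b / t\<^sup>2\<bar> * f (b / t)) absolutely_integrable_on {0<..} \<and>
           integral {0<..} (\<lambda>t. \<bar>- b / t\<^sup>2\<bar> * f (b / t)) = r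
     \<longleftrightarrow> f absolutely_integrable_on ((\<lambda>t. b / t) ` {0<..}) \<and> integral ((\<lambda>t. b / t) ` {0<..}) f = r" for r
      by (rule has_absolute_integral_change_of_variables_1')
        (use b in \<open>auto intro!: derivative_eq_intros simp: inj_on_def power2_eq_square\<close>)
    have e1: "f absolutely_integrable_on {0<..} \<and> integral {0<..} f = r \<longleftrightarrow> (f has_integral r) UNIV" for r
    proof -
      have "(f has_integral r) UNIV \<longleftrightarrow> (f has_integral r) {0<..}"
        by (subst has_integral_restrict_UNIV[of "{0<..}", symmetric]) (auto simp: f_def indicator_def intro!: arg_cong[where f="\<lambda>f. (f has_integral r) UNIV"])
      then show ?thesis using absolutely_integrable_on_iff_nonneg[of "{0<..}" f] nn
        by (auto simp: has_integral_iff)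
    qed
    have e2: "(\<lambda>t. \<bar>- b / t\<^sup>2\<bar> * f (b / t)) absolutely_integrable_on {0<..} \<and>
           integral {0<..} (\<lambda>t. \<bar>- b / t\<^sup>2\<bar> * f (b / t)) = r \<longleftrightarrow> (h has_integral r) UNIV" for r
    proof -
      have "(h has_integral r) UNIV \<longleftrightarrow> ((\<lambda>t. \<bar>- b / t\<^sup>2\<bar> * f (b / t)) has_integral r) {0<..}"
        by (subst has_integral_restrict_UNIV[of "{0<..}", symmetric])
           (use b in \<open>auto simp: f_def h_def indicator_def intro!: arg_cong[where f="\<lambda>f. (f has_integral r) UNIV"]\<close>)
      then show ?thesis using absolutely_integrable_on_iff_nonneg[of "{0<..}" "\<lambda>t. \<bar>- b / t\<^sup>2\<bar> * f (b / t)"] nn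
        by (auto simp: has_integral_iff)
    qed
    have "(\<integral>\<^sup>+x. f x \<partial>lborel) = ennreal r \<and> 0 \<le> r \<longleftrightarrow> (\<integral>\<^sup>+x. h x \<partial>lborel) = ennreal r \<and> 0 \<le> r" for r
      using *[of r] unfolding img e1 e2 has_integral_iff_nn_integral_borel[OF m(1) nn(1)] has_integral_iff_nn_integral_borel[OF m(2) nn(2)]
      by blast
    then have "(\<integral>\<^sup>+x. f x \<partial>lborel) = (\<integral>\<^sup>+x. h x \<partial>lborel)"
      by (metis ennreal_cases)
    moreover have "emeasure (density lborel (indicator {0<..})) A = (\<integral>\<^sup>+x. f x \<partial>lborel)"
      by (subst emeasure_density) (auto simp: f_def ennreal_mult ennreal_indicator)
    moreover have "emeasure (distr (density lborel ?w) borel (\<lambda>t. b / t)) A = (\<integral>\<^sup>+x. h x \<partial>lborel)"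
      by (subst nn_integral_indicator[symmetric], simp, subst nn_integral_distr, simp, simp, subst nn_integral_density)
         (use b in \<open>auto intro!: nn_integral_cong simp: h_def ennreal_mult ennreal_indicator indicator_def\<close>)
    ultimately show "emeasure (density lborel (indicator {0<..})) A = emeasure (distr (density lborel ?w) borel (\<lambda>t. b / t)) A"
      by simp
  qed simp
  then have "(\<integral>\<^sup>+t. g t \<partial>density lborel (indicator {0<..})) = (\<integral>\<^sup>+t. g t \<partial>distr (density lborel ?w) borel (\<lambda>t. b / t))"
    by simp
  then show ?thesis
    by (simp add: nn_integral_density nn_integral_distr)
qed

text \<open>
  Directions are sampled in this shell rather than on the unit sphere, so that Lebesgue measure suffices. A
  ray from the origin meets the shell in a segment of length \<open>ln 2\<close> with respect to \<open>dr / r\<close>.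
\<close>
definition annulus :: "'a::euclidean_space set" where
  "annulus = {v. 1 < norm v \<and> norm v < 2}"

lemma annulus_measurable [measurable]: "annulus \<in> sets borel"
  unfolding annulus_def by measurable

lemma nn_integral_lborel_swap:
  fixes f :: "'a::euclidean_space \<Rightarrow> 'b::euclidean_space \<Rightarrow> ennreal"
  assumes "(\<lambda>(x, y). f x y) \<in> borel_measurable (lborel \<Otimes>\<^sub>M lborel)"
  shows "(\<integral>\<^sup>+x. (\<integral>\<^sup>+y. f x y \<partial>lborel) \<partial>lborel) = (\<integral>\<^sup>+y. (\<integral>\<^sup>+x. f x y \<partial>lborel) \<partial>lborel)"
  using lborel_pair.Fubini'[OF assms] by simp

text \<open>
  Interchanging the integrals and substituting \<open>y = t v\<close>, the point \<open>y\<close> is counted by all \<open>t\<close> for which \<open>y / t\<close>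
  is in the shell, that is \<open>|y| / 2 < t < |y|\<close>, with total weight \<open>\<integral> dt / t = ln 2\<close>.
\<close>
lemma nn_integral_rays:
  fixes f :: "'a::euclidean_space \<Rightarrow> ennreal"
  assumes f[measurable]: "f \<in> borel_measurable borel"
  shows "(\<integral>\<^sup>+v. (\<integral>\<^sup>+t. indicator annulus v * (indicator {0<..} t * ennreal (t ^ (DIM('a) - 1))) * f (t *\<^sub>R v) \<partial>lborel) \<partial>lborel)
       = ennreal (ln 2) * (\<integral>\<^sup>+y. f y \<partial>lborel)"
proof -
  let ?n = "DIM('a)"
  have "(\<integral>\<^sup>+v. (\<integral>\<^sup>+t. indicator annulus v * (indicator {0<..} t * ennreal (t ^ (?n - 1))) * f (t *\<^sub>R v) \<partial>lborel) \<partial>lborel)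
     = (\<integral>\<^sup>+t. (\<integral>\<^sup>+v. indicator annulus (v::'a) * (indicator {0<..} t * ennreal (t ^ (?n - 1))) * f (t *\<^sub>R v) \<partial>lborel) \<partial>lborel)"
    by (rule nn_integral_lborel_swap) measurable
  also have "\<dots> = (\<integral>\<^sup>+t. (\<integral>\<^sup>+y. indicator {0<..} t * ennreal (1 / t) * indicator annulus (y /\<^sub>R t) * f y \<partial>(lborel::'a measure)) \<partial>(lborel::real measure))"
  proof (rule nn_integral_cong)
    fix t :: real
    show "(\<integral>\<^sup>+v. indicator annulus (v::'a) * (indicator {0<..} t * ennreal (t ^ (?n - 1))) * f (t *\<^sub>R v) \<partial>lborel)
       = (\<integral>\<^sup>+y. indicator {0<..} t * ennreal (1 / t) * indicator annulus (y /\<^sub>R t) * f y \<partial>(lborel::'a measure))"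
    proof (cases "t > 0")
      case True
      have pow: "ennreal (t ^ ?n) * ennreal (1 / t) = ennreal (t ^ (?n - 1))"
      proof -
        obtain k where k: "?n = Suc k" using DIM_positive gr0_implies_Suc by blast
        show ?thesis unfolding k using True by (simp flip: ennreal_mult)
      qed
      have "(\<integral>\<^sup>+y. indicator {0<..} t * ennreal (1 / t) * indicator annulus (y /\<^sub>R t) * f y \<partial>(lborel::'a measure))
         = ennreal (t ^ ?n) * (\<integral>\<^sup>+v. indicator {0<..} t * ennreal (1 / t) * indicator annulus (v::'a) * f (t *\<^sub>R v) \<partial>lborel)"
        using True by (subst nn_integral_lborel_scaleR[of _ t]) auto
      also have "\<dots> = (\<integral>\<^sup>+v. ennreal (t ^ ?n) * (indicator {0<..} t * ennreal (1 / t) * indicator annulus (v::'a) * f (t *\<^sub>R v)) \<partial>lborel)"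
        by (rule nn_integral_cmult[symmetric]) measurable
      also have "\<dots> = (\<integral>\<^sup>+v. indicator annulus (v::'a) * (indicator {0<..} t * ennreal (t ^ (?n - 1))) * f (t *\<^sub>R v) \<partial>lborel)"
        by (intro nn_integral_cong) (simp only: pow[symmetric] mult_ac)
      finally show ?thesis by simp
    qed simp
  qed
  also have "\<dots> = (\<integral>\<^sup>+y. (\<integral>\<^sup>+t. indicator {0<..} t * ennreal (1 / t) * indicator annulus (y /\<^sub>R t) * f y \<partial>(lborel::real measure)) \<partial>(lborel::'a measure))"
    by (rule nn_integral_lborel_swap) measurable
  also have "\<dots> = (\<integral>\<^sup>+y. ennreal (ln 2) * f y \<partial>(lborel::'a measure))"
  proof (rule nn_integral_cong_AE)
    have "AE y::'a in lborel. y \<noteq> 0" by (rule AE_lborel_singleton)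
    then show "AE y::'a in lborel. (\<integral>\<^sup>+t. indicator {0<..} t * ennreal (1 / t) * indicator annulus (y /\<^sub>R t) * f y \<partial>(lborel::real measure)) = ennreal (ln 2) * f y"
    proof eventually_elim
      fix y :: 'a assume "y \<noteq> 0"
      then have ny: "norm y > 0" by simp
      have "(\<integral>\<^sup>+t. indicator {0<..} t * ennreal (1 / t) * indicator annulus (y /\<^sub>R t) * f y \<partial>(lborel::real measure))
         = (\<integral>\<^sup>+t. indicator {0<..} t * ennreal (1 / t) * indicator annulus (y /\<^sub>R t) \<partial>(lborel::real measure)) * f y"
        by (rule nn_integral_multc) measurable
      also have "(\<integral>\<^sup>+t. indicator {0<..} t * ennreal (1 / t) * indicator annulus (y /\<^sub>R t) \<partial>(lborel::real measure))
         = (\<integral>\<^sup>+t. ennreal (1 / t) * indicator {norm y / 2 .. norm y} t \<partial>(lborel::real measure))"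
      proof (rule nn_integral_cong_AE)
        have "AE t in lborel. t \<noteq> norm y" "AE t in lborel. t \<noteq> norm y / 2" by (rule AE_lborel_singleton)+
        then show "AE t in lborel. indicator {0<..} t * ennreal (1 / t) * indicator annulus (y /\<^sub>R t) = ennreal (1 / t) * indicator {norm y / 2 .. norm y} t"
        proof eventually_elim
          fix t assume t: "t \<noteq> norm y" "t \<noteq> norm y / 2"
          show "indicator {0<..} t * ennreal (1 / t) * indicator annulus (y /\<^sub>R t) = ennreal (1 / t) * indicator {norm y / 2 .. norm y} t"
          proof (cases "t > 0")
            case True
            have "1 < norm y / t \<and> norm y / t < 2 \<longleftrightarrow> t \<in> {norm y / 2 .. norm y}"
              using t True by (auto simp: field_simps)
            moreover have "norm (y /\<^sub>R t) = norm y / t" using True by (simp add: divide_inverse mult.commute)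
            ultimately have "y /\<^sub>R t \<in> annulus \<longleftrightarrow> t \<in> {norm y / 2 .. norm y}" by (simp only: annulus_def mem_Collect_eq)
            then show ?thesis using True by (simp only: indicator_def) simp
          next
            case False
            then have "t < norm y / 2" using ny by linarith
            then have "t \<notin> {norm y / 2 .. norm y}" by simp
            then show ?thesis using False by (simp add: indicator_def)
          qed
        qed
      qed
      also have "\<dots> = ennreal (ln (norm y) - ln (norm y / 2))"
      proof (rule nn_integral_FTC_Icc)
        fix t assume "t \<in> {norm y / 2..norm y}"
        then have "t > 0" using ny by (simp only: atLeastAtMost_iff) linarith
        then show "(ln has_real_derivative 1 / t) (at t)" "0 \<le> 1 / t"
          by (auto intro!: derivative_eq_intros)
      qed auto
      also have "ln (norm y) - ln (norm y / 2) = ln 2" using ny by (simp add: ln_div)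
      finally show "(\<integral>\<^sup>+t. indicator {0<..} t * ennreal (1 / t) * indicator annulus (y /\<^sub>R t) * f y \<partial>(lborel::real measure)) = ennreal (ln 2) * f y" .
    qed
  qed
  also have "\<dots> = ennreal (ln 2) * (\<integral>\<^sup>+y. f y \<partial>lborel)"
    by (rule nn_integral_cmult) measurable
  finally show ?thesis .
qed

text \<open>As an equality of measures the formula also applies to integrands of either sign.\<close>
lemma ray_coordinates:
  "distr (density (lborel \<Otimes>\<^sub>M lborel) (\<lambda>x. ennreal (indicator annulus (fst x) * indicator {0<..} (snd x) * snd x ^ (DIM('a) - 1)))) borel (\<lambda>x. snd x *\<^sub>R fst x)
    = density (lborel :: 'a::euclidean_space measure) (\<lambda>_. ennreal (ln 2))" (is "distr (density ?L ?w) borel ?s = _")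
proof (rule measure_eqI)
  fix A :: "'a set" 
  assume "A \<in> sets (distr (density ?L ?w) borel ?s)"
  then have A[measurable]: "A \<in> sets borel" by simp
  have wm[measurable]: "?w \<in> borel_measurable ?L" by measurable
  have sm[measurable]: "?s \<in> ?L \<rightarrow>\<^sub>M borel" by measurable
  have sm': "?s \<in> density ?L ?w \<rightarrow>\<^sub>M borel" by simp
  have "emeasure (distr (density ?L ?w) borel ?s) A = (\<integral>\<^sup>+x. indicator A x \<partial>distr (density ?L ?w) borel ?s)"
    by simp
  also have "\<dots> = (\<integral>\<^sup>+x. indicator A (?s x) \<partial>density ?L ?w)"
    by (rule nn_integral_distr[OF sm']) simp
  also have "\<dots> = (\<integral>\<^sup>+x. ?w x * indicator A (?s x) \<partial>?L)"
    by (rule nn_integral_density[OF wm]) simp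
  also have "\<dots> = (\<integral>\<^sup>+v. (\<integral>\<^sup>+t. ?w (v, t) * indicator A (?s (v, t)) \<partial>lborel) \<partial>lborel)"
    by (rule lborel.nn_integral_fst[symmetric]) measurable
  also have "\<dots> = (\<integral>\<^sup>+v. (\<integral>\<^sup>+t. indicator annulus v * (indicator {0<..} t * ennreal (t ^ (DIM('a) - 1))) * indicator A (t *\<^sub>R v) \<partial>lborel) \<partial>lborel)"
    by (intro nn_integral_cong) (auto simp: indicator_def)
  also have "\<dots> = ennreal (ln 2) * (\<integral>\<^sup>+x. indicator A x \<partial>lborel)"
    by (rule nn_integral_rays) simp
  also have "\<dots> = emeasure (density lborel (\<lambda>_. ennreal (ln 2))) A"
    by (subst emeasure_density) (auto simp: nn_integral_cmult)
  finally show "emeasure (distr (density ?L ?w) borel ?s) A = emeasure (density lborel (\<lambda>_. ennreal (ln 2))) A" .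
qed simp

lemma
  fixes f :: "'a::euclidean_space \<Rightarrow> real"
  assumes f: "integrable lborel f"
  shows integrable_rays: "integrable (lborel \<Otimes>\<^sub>M lborel) (\<lambda>x. indicator annulus (fst x) * (indicator {0<..} (snd x) * snd x ^ (DIM('a) - 1) * f (snd x *\<^sub>R fst x)))"
    and integral_rays: "(\<integral>v. indicator annulus v * (\<integral>t. indicator {0<..} t * t ^ (DIM('a) - 1) * f (t *\<^sub>R v) \<partial>lborel) \<partial>lborel)
       = ln 2 * (\<integral>y. f y \<partial>lborel)"
proof -
  let ?L = "lborel \<Otimes>\<^sub>M lborel :: ('a \<times> real) measure"
  let ?w = "\<lambda>x. indicator annulus (fst x) * indicator {0<..} (snd x) * snd x ^ (DIM('a) - 1) :: real"
  let ?s = "\<lambda>x. snd x *\<^sub>R fst x"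
  have fm[measurable]: "f \<in> borel_measurable borel" using f by auto
  have wm[measurable]: "?w \<in> borel_measurable ?L" by measurable
  have w0: "AE x in ?L. 0 \<le> ?w x" by (auto simp: indicator_def)
  have sm[measurable]: "?s \<in> ?L \<rightarrow>\<^sub>M borel" by measurable
  have sm': "?s \<in> density ?L ?w \<rightarrow>\<^sub>M borel" by simp
  have fs: "(\<lambda>x. f (?s x)) \<in> borel_measurable ?L" by measurable
  have "integrable (density (lborel :: 'a measure) (\<lambda>_. ennreal (ln 2))) f"
    using f by (subst integrable_density) auto
  then have "integrable (distr (density ?L ?w) borel ?s) f"
    by (simp only: ray_coordinates)
  then have "integrable (density ?L ?w) (\<lambda>x. f (?s x))"
    by (rule integrable_distr[OF sm'])
  then have I': "integrable ?L (\<lambda>x. ?w x *\<^sub>R f (?s x))"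
    by (rule integrable_density[OF fs wm w0, THEN iffD1])
  then show I: "integrable ?L (\<lambda>x. indicator annulus (fst x) * (indicator {0<..} (snd x) * snd x ^ (DIM('a) - 1) * f (snd x *\<^sub>R fst x)))"
    by (simp only: real_scaleR_def mult.assoc)
  have "(\<integral>v. indicator annulus v * (\<integral>t. indicator {0<..} t * t ^ (DIM('a) - 1) * f (t *\<^sub>R v) \<partial>lborel) \<partial>lborel)
     = (\<integral>v. (\<integral>t. ?w (v, t) *\<^sub>R f (?s (v, t)) \<partial>lborel) \<partial>lborel)"
    by (simp add: mult.assoc)
  also have "\<dots> = (\<integral>x. ?w x *\<^sub>R f (?s x) \<partial>?L)"
    by (rule lborel_pair.integral_fst'[OF I'])
  also have "\<dots> = (\<integral>x. f (?s x) \<partial>density ?L ?w)"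
    by (rule integral_density[OF fs wm w0, symmetric])
  also have "\<dots> = (\<integral>x. f x \<partial>distr (density ?L ?w) borel ?s)"
    by (rule integral_distr[OF sm' fm, symmetric])
  also have "\<dots> = ln 2 * (\<integral>y. f y \<partial>lborel)"
    unfolding ray_coordinates by (subst integral_density) auto
  finally show "(\<integral>v. indicator annulus v * (\<integral>t. indicator {0<..} t * t ^ (DIM('a) - 1) * f (t *\<^sub>R v) \<partial>lborel) \<partial>lborel)
       = ln 2 * (\<integral>y. f y \<partial>lborel)" .
qed

text \<open>
  On the ray of \<open>v\<close> the inversion is the substitution \<open>t \<mapsto> c / (|v|\<^sup>2 t)\<close>, so the Jacobian is found in one
  dimension.
\<close>
lemma nn_integral_inversion:
  fixes f :: "'a::euclidean_space \<Rightarrow> ennreal"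
  assumes f[measurable]: "f \<in> borel_measurable borel" and c: "c > 0"
  shows "(\<integral>\<^sup>+y. f y \<partial>lborel)
    = (\<integral>\<^sup>+x. ennreal ((c / (norm x)\<^sup>2) ^ DIM('a)) * f ((c / (norm x)\<^sup>2) *\<^sub>R x) \<partial>lborel)"
proof -
  let ?n = "DIM('a)"
  let ?h = "\<lambda>x::'a. ennreal ((c / (norm x)\<^sup>2) ^ ?n) * f ((c / (norm x)\<^sup>2) *\<^sub>R x)"
  have n0: "?n > 0" by simp
  have "ennreal (ln 2) * (\<integral>\<^sup>+y. f y \<partial>lborel)
     = (\<integral>\<^sup>+v. (\<integral>\<^sup>+t. indicator annulus v * (indicator {0<..} t * ennreal (t ^ (?n - 1))) * f (t *\<^sub>R v) \<partial>lborel) \<partial>lborel)"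
    by (rule nn_integral_rays[symmetric]) measurable
  also have "\<dots> = (\<integral>\<^sup>+v. (\<integral>\<^sup>+t. indicator annulus v * (indicator {0<..} t * ennreal (t ^ (?n - 1))) * ?h (t *\<^sub>R v) \<partial>lborel) \<partial>lborel)"
  proof (rule nn_integral_cong)
    fix v :: 'a
    show "(\<integral>\<^sup>+t. indicator annulus v * (indicator {0<..} t * ennreal (t ^ (?n - 1))) * f (t *\<^sub>R v) \<partial>lborel)
       = (\<integral>\<^sup>+t. indicator annulus v * (indicator {0<..} t * ennreal (t ^ (?n - 1))) * ?h (t *\<^sub>R v) \<partial>lborel)"
    proof (cases "v \<in> annulus")
      case True
      define b where "b = c / (norm v)\<^sup>2"
      have nv: "norm v > 0" using True by (auto simp: annulus_def)
      have b: "b > 0" using c nv by (simp add: b_def)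
      have eq: "indicator {0<..} t * ennreal (b / t\<^sup>2) * (ennreal ((b / t) ^ (?n - 1)) * f ((b / t) *\<^sub>R v))
         = indicator {0<..} t * (ennreal (t ^ (?n - 1)) * ?h (t *\<^sub>R v))" for t
      proof (cases "t > 0")
        case True
        have "c / (norm (t *\<^sub>R v))\<^sup>2 * t = b / t"
          using True nv by (simp add: b_def power_mult_distrib power2_eq_square field_simps)
        then have v: "(c / (norm (t *\<^sub>R v))\<^sup>2) *\<^sub>R t *\<^sub>R v = (b / t) *\<^sub>R v" by simp
        have "c / (norm (t *\<^sub>R v))\<^sup>2 = b / t\<^sup>2"
          using True nv by (simp add: b_def power_mult_distrib field_simps)
        then have w: "t ^ (?n - 1) * (c / (norm (t *\<^sub>R v))\<^sup>2) ^ ?n = b / t\<^sup>2 * (b / t) ^ (?n - 1)"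
        proof -
          obtain k where k: "?n = Suc k" using n0 gr0_implies_Suc by blast
          have "(b / t) ^ k = t ^ k * (b / t\<^sup>2) ^ k"
            using True by (simp add: power_mult_distrib[symmetric] power2_eq_square)
          then show ?thesis unfolding \<open>c / (norm (t *\<^sub>R v))\<^sup>2 = b / t\<^sup>2\<close> k by simp
        qed
        have AB: "ennreal (b / t\<^sup>2) * ennreal ((b / t) ^ (?n - 1)) = ennreal (t ^ (?n - 1)) * ennreal ((c / (norm (t *\<^sub>R v))\<^sup>2) ^ ?n)"
          using True b c w by (simp flip: ennreal_mult)
        have "indicator {0<..} t * ennreal (b / t\<^sup>2) * (ennreal ((b / t) ^ (?n - 1)) * f ((b / t) *\<^sub>R v))
           = indicator {0<..} t * ((ennreal (b / t\<^sup>2) * ennreal ((b / t) ^ (?n - 1))) * f ((b / t) *\<^sub>R v))"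
          by (simp only: mult.assoc)
        also have "\<dots> = indicator {0<..} t * (ennreal (t ^ (?n - 1)) * ?h (t *\<^sub>R v))"
          by (simp only: AB v mult.assoc)
        finally show ?thesis .
      qed simp
      have "(\<integral>\<^sup>+t. indicator {0<..} t * (ennreal (t ^ (?n - 1)) * f (t *\<^sub>R v)) \<partial>lborel)
         = (\<integral>\<^sup>+t. indicator {0<..} t * ennreal (b / t\<^sup>2) * (ennreal ((b / t) ^ (?n - 1)) * f ((b / t) *\<^sub>R v)) \<partial>lborel)"
        by (rule nn_integral_inverse_halfline[OF b]) measurable
      also have "\<dots> = (\<integral>\<^sup>+t. indicator {0<..} t * (ennreal (t ^ (?n - 1)) * ?h (t *\<^sub>R v)) \<partial>lborel)"
        by (simp only: eq)
      finally show ?thesis using True by (simp add: mult.assoc)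
    qed simp
  qed
  also have "\<dots> = ennreal (ln 2) * (\<integral>\<^sup>+x. ?h x \<partial>lborel)"
    by (rule nn_integral_rays) measurable
  finally show ?thesis
    by (simp add: ennreal_mult_cancel_left)
qed

lemma inversion_measure:
  assumes "c > 0"
  shows "distr (density lborel (\<lambda>x. ennreal ((c / (norm x)\<^sup>2) ^ DIM('a)))) borel (\<lambda>x. (c / (norm x)\<^sup>2) *\<^sub>R x) = (lborel :: 'a::euclidean_space measure)"
proof (rule measure_eqI)
  fix A :: "'a set" assume "A \<in> sets (distr (density lborel (\<lambda>x. ennreal ((c / (norm x)\<^sup>2) ^ DIM('a)))) borel (\<lambda>x. (c / (norm x)\<^sup>2) *\<^sub>R x))"
  then have A[measurable]: "A \<in> sets borel" by simp
  have "emeasure (distr (density lborel (\<lambda>x. ennreal ((c / (norm x)\<^sup>2) ^ DIM('a)))) borel (\<lambda>x. (c / (norm x)\<^sup>2) *\<^sub>R x)) A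
     = (\<integral>\<^sup>+x. indicator A x \<partial>distr (density lborel (\<lambda>x. ennreal ((c / (norm x)\<^sup>2) ^ DIM('a)))) borel (\<lambda>x. (c / (norm x)\<^sup>2) *\<^sub>R x))"
    by simp
  also have "\<dots> = (\<integral>\<^sup>+x. indicator A ((c / (norm x)\<^sup>2) *\<^sub>R x) \<partial>density lborel (\<lambda>x. ennreal ((c / (norm x)\<^sup>2) ^ DIM('a))))"
    by (rule nn_integral_distr) simp_all
  also have "\<dots> = (\<integral>\<^sup>+x. ennreal ((c / (norm x)\<^sup>2) ^ DIM('a)) * indicator A ((c / (norm x)\<^sup>2) *\<^sub>R x) \<partial>lborel)"
    by (rule nn_integral_density) simp_all
  also have "\<dots> = (\<integral>\<^sup>+x. indicator A x \<partial>lborel)"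
    by (rule nn_integral_inversion[OF _ assms, symmetric]) simp
  finally show "emeasure (distr (density lborel (\<lambda>x. ennreal ((c / (norm x)\<^sup>2) ^ DIM('a)))) borel (\<lambda>x. (c / (norm x)\<^sup>2) *\<^sub>R x)) A = emeasure lborel A" by simp
qed simp

lemma
  fixes f :: "'a::euclidean_space \<Rightarrow> real"
  assumes c: "c > 0" and f[measurable]: "f \<in> borel_measurable borel"
  shows integrable_inversion: "integrable lborel (\<lambda>x. (c / (norm x)\<^sup>2) ^ DIM('a) * f ((c / (norm x)\<^sup>2) *\<^sub>R x)) \<longleftrightarrow> integrable lborel f"
    and integral_inversion: "(\<integral>x. (c / (norm x)\<^sup>2) ^ DIM('a) * f ((c / (norm x)\<^sup>2) *\<^sub>R x) \<partial>lborel) = (\<integral>y. f y \<partial>lborel)"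
proof -
  have m: "(\<lambda>x. (c / (norm x)\<^sup>2) *\<^sub>R x) \<in> density lborel (\<lambda>x::'a. ennreal ((c / (norm x)\<^sup>2) ^ DIM('a))) \<rightarrow>\<^sub>M borel" by simp
  show "integrable lborel (\<lambda>x. (c / (norm x)\<^sup>2) ^ DIM('a) * f ((c / (norm x)\<^sup>2) *\<^sub>R x)) \<longleftrightarrow> integrable lborel f"
    by (subst (2) inversion_measure[OF c, symmetric], subst integrable_distr_eq[OF m f], subst integrable_density) (use c in auto)
  show "(\<integral>x. (c / (norm x)\<^sup>2) ^ DIM('a) * f ((c / (norm x)\<^sup>2) *\<^sub>R x) \<partial>lborel) = (\<integral>y. f y \<partial>lborel)"
    by (subst (2) inversion_measure[OF c, symmetric], subst integral_distr[OF m f], subst integral_density) (use c in auto)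
qed

lemma integrable_dominated:
  fixes f g :: "'a::euclidean_space \<Rightarrow> real"
  assumes "integrable lborel g" "\<And>x. norm (f x) \<le> g x" "f \<in> borel_measurable borel"
  shows "integrable lborel f"
proof (rule Bochner_Integration.integrable_bound[OF assms(1)])
  show "AE x in lborel. norm (f x) \<le> norm (g x)"
    by (rule AE_I2, rule order_trans[OF assms(2)]) simp
qed (use assms(3) in simp)

lemma norm_powr_indicator_measurable:
  fixes A :: "'a::euclidean_space set"
  assumes [measurable]: "A \<in> sets borel"
  shows "(\<lambda>y::'a. indicator A y * norm y powr p :: real) \<in> borel_measurable borel"
  by measurable

lemma integrable_norm_powr_ball:
  assumes p: "p > - real DIM('a)"
  shows "integrable lborel (\<lambda>y::'a::euclidean_space. indicator (ball 0 \<rho>) y * norm y powr p)"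
proof (rule integrableI_bounded)
  let ?n = "DIM('a)"
  have m[measurable]: "(\<lambda>y::'a. indicator (ball 0 \<rho>) y * norm y powr p :: real) \<in> borel_measurable borel"
    by (rule norm_powr_indicator_measurable) simp
  have n0: "?n > 0" by simp
  have "ennreal (ln 2) * (\<integral>\<^sup>+y. ennreal (norm (indicator (ball 0 \<rho>) (y::'a) * norm y powr p)) \<partial>lborel)
    = (\<integral>\<^sup>+v. (\<integral>\<^sup>+t. indicator annulus (v::'a) * (indicator {0<..} t * ennreal (t ^ (?n - 1))) * ennreal (norm (indicator (ball 0 \<rho>) (t *\<^sub>R v) * norm (t *\<^sub>R v) powr p)) \<partial>lborel) \<partial>lborel)"
    by (rule nn_integral_rays[symmetric]) (use m in measurable)
  also have "\<dots> \<le> (\<integral>\<^sup>+v. (\<integral>\<^sup>+t. ennreal (indicator {0..\<rho>} t * t powr (p + ?n - 1)) * (ennreal (2 powr \<bar>p\<bar>) * indicator annulus (v::'a)) \<partial>lborel) \<partial>lborel)"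
  proof (intro nn_integral_mono)
    fix v :: 'a and t :: real
    show "indicator annulus (v::'a) * (indicator {0<..} t * ennreal (t ^ (?n - 1))) * ennreal (norm (indicator (ball 0 \<rho>) (t *\<^sub>R v) * norm (t *\<^sub>R v) powr p))
       \<le> ennreal (indicator {0..\<rho>} t * t powr (p + ?n - 1)) * (ennreal (2 powr \<bar>p\<bar>) * indicator annulus (v::'a))"
    proof (cases "v \<in> annulus \<and> 0 < t \<and> t *\<^sub>R v \<in> ball 0 \<rho>")
      case True
      then have v: "1 < norm v" "norm v < 2" and t: "t > 0" "t * norm v < \<rho>" by (auto simp: annulus_def)
      have "t \<le> t * norm v" using v t by auto
      then have "t \<le> \<rho>" using t by linarith
      have "norm v powr p \<le> norm v powr \<bar>p\<bar>" using v by (intro powr_mono) auto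
      also have "\<dots> \<le> 2 powr \<bar>p\<bar>" using v by (intro powr_mono2) auto
      finally have *: "norm v powr p \<le> 2 powr \<bar>p\<bar>" .
      have tp: "t ^ (?n - 1) * t powr p = t powr (p + ?n - 1)"
        using t n0 by (simp add: powr_realpow[symmetric] powr_add[symmetric] of_nat_diff algebra_simps)
      have "t ^ (?n - 1) * norm (t *\<^sub>R v) powr p = t powr (p + ?n - 1) * norm v powr p"
        using t v by (simp add: powr_mult tp[symmetric])
      also have "\<dots> \<le> t powr (p + ?n - 1) * 2 powr \<bar>p\<bar>" using * by (intro mult_left_mono) auto
      finally show ?thesis using True t \<open>t \<le> \<rho>\<close>
        by (simp add: ennreal_mult[symmetric] ennreal_leI)
    qed (auto simp: indicator_def)
  qed
  also have "\<dots> = (\<integral>\<^sup>+v. (\<integral>\<^sup>+t. ennreal (indicator {0..\<rho>} t * t powr (p + ?n - 1)) \<partial>lborel) * (ennreal (2 powr \<bar>p\<bar>) * indicator annulus (v::'a)) \<partial>lborel)"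
    by (intro nn_integral_cong nn_integral_multc) measurable
  also have "\<dots> = (\<integral>\<^sup>+t. ennreal (indicator {0..\<rho>} t * t powr (p + ?n - 1)) \<partial>lborel) * (ennreal (2 powr \<bar>p\<bar>) * emeasure lborel (annulus :: 'a set))"
    by (simp add: nn_integral_cmult)
  also have "\<dots> < \<infinity>"
  proof -
    have "(annulus :: 'a set) \<subseteq> cball 0 2" by (auto simp: annulus_def)
    then have "emeasure lborel (annulus :: 'a set) \<le> emeasure lborel (cball (0::'a) 2)" by (intro emeasure_mono) auto
    also have "\<dots> < \<infinity>" using emeasure_lborel_cbox_finite emeasure_bounded_finite[OF bounded_cball] by blast
    finally have 1: "emeasure lborel (annulus :: 'a set) < \<infinity>" .
    have 2: "(\<integral>\<^sup>+t. ennreal (indicator {0..\<rho>} t * t powr (p + ?n - 1)) \<partial>lborel) < \<infinity>"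
    proof (cases "\<rho> \<ge> 0")
      case True
      have "((\<lambda>t. t powr (p + ?n - 1)) has_integral (\<rho> powr ((p + ?n - 1)+1) / ((p + ?n - 1)+1))) {0..\<rho>}"
        by (rule has_integral_powr_from_0) (use p True in auto)
      from nn_integral_has_integral_lebesgue[OF _ this] show ?thesis by simp
    qed simp
    from 1 2 show ?thesis by (simp add: ennreal_mult_less_top)
  qed
  finally show "(\<integral>\<^sup>+y. ennreal (norm (indicator (ball 0 \<rho>) (y::'a) * norm y powr p)) \<partial>lborel) < \<infinity>"
    by (auto simp: ennreal_mult_less_top)
  show "(\<lambda>y::'a. indicator (ball 0 \<rho>) y * norm y powr p :: real) \<in> borel_measurable lborel" using m by simp
qed

text \<open>Inversion exchanges ball and exterior and turns the exponent \<open>p\<close> into \<open>- p - 2n\<close>.\<close>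
lemma integrable_norm_powr_outside:
  assumes p: "p < - real DIM('a)" and \<rho>: "\<rho> > 0"
  shows "integrable lborel (\<lambda>y::'a::euclidean_space. indicator (- ball 0 \<rho>) y * norm y powr p)"
proof -
  let ?n = "DIM('a)"
  let ?f = "\<lambda>y::'a. indicator (ball 0 (2 / \<rho>)) y * norm y powr (- p - 2 * ?n)"
  have "integrable lborel ?f" by (rule integrable_norm_powr_ball) (use p in auto)
  then have "integrable lborel (\<lambda>x::'a. (1 / (norm x)\<^sup>2) ^ ?n * ?f ((1 / (norm x)\<^sup>2) *\<^sub>R x))"
    by (subst integrable_inversion) auto
  then show ?thesis
  proof (rule Bochner_Integration.integrable_bound)
    show "AE x::'a in lborel. norm (indicator (- ball 0 \<rho>) x * norm x powr p) \<le> norm ((1 / (norm x)\<^sup>2) ^ ?n * ?f ((1 / (norm x)\<^sup>2) *\<^sub>R x))"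
    proof (rule AE_I2)
      fix x :: 'a
      show "norm (indicator (- ball 0 \<rho>) x * norm x powr p) \<le> norm ((1 / (norm x)\<^sup>2) ^ ?n * ?f ((1 / (norm x)\<^sup>2) *\<^sub>R x))"
      proof (cases "x \<in> ball 0 \<rho>")
        case False
        then have x: "norm x \<ge> \<rho>" "norm x > 0" using \<rho> by auto
        have nx: "norm ((1 / (norm x)\<^sup>2) *\<^sub>R x) = 1 / norm x" using x by (simp add: power2_eq_square)
        have "1 / norm x < 2 / \<rho>" using x \<rho> by (simp add: field_simps)
        then have inb: "(1 / (norm x)\<^sup>2) *\<^sub>R x \<in> ball 0 (2 / \<rho>)" using nx by simp
        have "(1 / (norm x)\<^sup>2) ^ ?n * (1 / norm x) powr (- p - 2 * ?n) = norm x powr (- 2 * ?n) * norm x powr (p + 2 * ?n)"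
        proof -
          have "(1 / (norm x)\<^sup>2) ^ ?n = ((norm x powr (-2)) powr ?n)"
            using x by (simp add: powr_realpow powr_minus divide_inverse)
          also have "\<dots> = norm x powr (- 2 * ?n)" by (simp add: powr_powr)
          finally have 1: "(1 / (norm x)\<^sup>2) ^ ?n = norm x powr (- 2 * ?n)" .
          have 2: "1 / norm x = norm x powr (-1)" using x by (simp add: powr_minus divide_inverse)
          have "(1 / norm x) powr (- p - 2 * ?n) = norm x powr (p + 2 * ?n)" unfolding 2 powr_powr by (simp add: add.commute)
          with 1 show ?thesis by simp
        qed
        also have "\<dots> = norm x powr p" by (simp flip: powr_add)
        finally show ?thesis using nx inb False by (simp only: indicator_simps) simp
      qed simp
    qed
  qed measurable
qed

section \<open>Holomorphic parameter integrals and central differences\<close>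

text \<open>
  On a disc of half the radius, Cauchy's estimate bounds the difference quotients in \<open>s\<close> by a multiple of
  the dominating function, so they converge under the integral sign.
\<close>
lemma
  fixes f :: "complex \<Rightarrow> 'a \<Rightarrow> complex"
  assumes S: "open S" 
    and hol: "\<And>y. (\<lambda>s. f s y) holomorphic_on S"
    and meas[measurable]: "\<And>s. s \<in> S \<Longrightarrow> f s \<in> borel_measurable M"
    and dom: "\<And>s. s \<in> S \<Longrightarrow> \<exists>r>0. \<exists>g. integrable M g \<and> ball s r \<subseteq> S \<and> (\<forall>z\<in>ball s r. \<forall>y. norm (f z y) \<le> g y)"
  shows holomorphic_lebesgue_integral: "(\<lambda>s. \<integral>y. f s y \<partial>M) holomorphic_on S"
    and integrable_dominated_family: "\<And>s. s \<in> S \<Longrightarrow> integrable M (f s)"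
proof -
  show int: "integrable M (f s)" if s: "s \<in> S" for s
  proof -
    obtain r g where r: "r > 0" and g: "integrable M g" and b: "\<forall>z\<in>ball s r. \<forall>y. norm (f z y) \<le> g y"
      using dom[OF s] by blast
    have "norm (f s y) \<le> norm (g y)" for y
    proof -
      have "norm (f s y) \<le> g y" using b r by simp
      then show ?thesis by simp
    qed
    then show ?thesis by (intro Bochner_Integration.integrable_bound[OF g meas[OF s]] AE_I2)
  qed
  have "(\<lambda>s. \<integral>y. f s y \<partial>M) field_differentiable (at s)" if s: "s \<in> S" for s
  proof -
    obtain r g where r: "r > 0" and g: "integrable M g" and rS: "ball s r \<subseteq> S"
      and fg: "\<And>z y. z \<in> ball s r \<Longrightarrow> norm (f z y) \<le> g y" using dom[OF s] by blast
    define d where "d y = deriv (\<lambda>z. f z y) s" for y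
    have der: "((\<lambda>z. f z y) has_field_derivative deriv (\<lambda>z. f z y) z) (at z)" if "z \<in> ball s r" for z y
      by (rule holomorphic_derivI[OF hol[of y] S]) (use rS that in blast)
    have quot: "norm ((f z y - f s y) / (z - s)) \<le> 2 / r * g y" if z: "z \<in> ball s (r/2)" for z y
    proof -
      have bd: "norm (deriv (\<lambda>z. f z y) w) \<le> 2 / r * g y" if w: "w \<in> ball s (r/2)" for w
      proof -
        have sub: "cball w (r/2) \<subseteq> ball s r"
        proof
          fix u assume "u \<in> cball w (r/2)"
          then show "u \<in> ball s r" using w dist_triangle[of s u w] by (simp add: dist_commute)
        qed
        have "norm ((deriv ^^ 1) (\<lambda>z. f z y) w) \<le> fact 1 * g y / (r/2) ^ 1"
        proof (rule Cauchy_inequality)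
          have "(\<lambda>z. f z y) holomorphic_on cball w (r/2)"
            by (rule holomorphic_on_subset[OF hol[of y]]) (use sub rS in blast)
          then show "(\<lambda>z. f z y) holomorphic_on ball w (r/2)" "continuous_on (cball w (r/2)) (\<lambda>z. f z y)"
            by (auto intro: holomorphic_on_subset holomorphic_on_imp_continuous_on)
          fix u assume "norm (w - u) = r / 2"
          then have "u \<in> cball w (r/2)" by (simp add: dist_norm)
          then show "norm (f u y) \<le> g y" using sub fg by blast
        qed (use r in auto)
        then show ?thesis by (simp add: field_simps)
      qed
      have "norm (f z y - f s y) \<le> 2 / r * g y * norm (z - s)"
      proof (rule field_differentiable_bound[of "ball s (r/2)" "\<lambda>z. f z y" "deriv (\<lambda>z. f z y)"])
        show "((\<lambda>z. f z y) has_field_derivative deriv (\<lambda>z. f z y) w) (at w within ball s (r/2))" if "w \<in> ball s (r/2)" for w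
          by (rule DERIV_subset[OF der]) (use that r in auto)
      qed (use z r bd in auto)
      moreover have "0 \<le> 2 / r * g y" using order_trans[OF norm_ge_zero bd[of s]] r by simp
      ultimately show ?thesis by (cases "z = s") (auto simp: norm_divide divide_le_eq)
    qed
    have lim: "((\<lambda>z. (f z y - f s y) / (z - s)) \<longlongrightarrow> d y) (at s)" for y
      using der[of s y] r by (simp add: has_field_derivative_iff d_def)
    have "((\<lambda>z. ((\<integral>y. f z y \<partial>M) - (\<integral>y. f s y \<partial>M)) / (z - s)) \<longlongrightarrow> (\<integral>y. d y \<partial>M)) (at s)"
      unfolding tendsto_at_iff_sequentially comp_def
    proof (intro allI impI)
      fix X :: "nat \<Rightarrow> complex" assume X: "\<forall>i. X i \<in> UNIV - {s}" "X \<longlonglongrightarrow> s"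
      have "eventually (\<lambda>n. X n \<in> ball s (r/2)) sequentially"
        using topological_tendstoD[OF X(2) open_ball, of s "r/2"] r by simp
      then obtain N where N: "\<And>n. n \<ge> N \<Longrightarrow> X n \<in> ball s (r/2)"
        unfolding eventually_sequentially by blast
      define Y where "Y n = X (n + N)" for n
      have Y: "Y n \<in> ball s (r/2)" "Y n \<noteq> s" "Y n \<in> S" for n
      proof -
        show "Y n \<in> ball s (r/2)" using N by (simp add: Y_def)
        then have "Y n \<in> ball s r" using r by auto
        then show "Y n \<in> S" using rS by auto
      qed (use X in \<open>auto simp: Y_def\<close>)
      have Ylim: "Y \<longlonglongrightarrow> s" unfolding Y_def by (rule LIMSEQ_ignore_initial_segment[OF X(2)])
      have pw: "(\<lambda>n. (f (Y n) y - f s y) / (Y n - s)) \<longlonglongrightarrow> d y" for y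
        using lim[of y] Y(2) Ylim unfolding tendsto_at_iff_sequentially comp_def by auto
      have m: "(\<lambda>y. (f (Y n) y - f s y) / (Y n - s)) \<in> borel_measurable M" for n
        using meas[OF Y(3)[of n]] meas[OF s] by measurable
      have dm: "d \<in> borel_measurable M"
        by (rule borel_measurable_LIMSEQ_metric[where f="\<lambda>n y. (f (Y n) y - f s y) / (Y n - s)", OF m pw])
      have "(\<lambda>n. \<integral>y. (f (Y n) y - f s y) / (Y n - s) \<partial>M) \<longlonglongrightarrow> (\<integral>y. d y \<partial>M)"
      proof (rule integral_dominated_convergence[where w="\<lambda>y. 2 / r * g y"])
        show "AE y in M. norm ((f (Y n) y - f s y) / (Y n - s)) \<le> 2 / r * g y" for n
          using quot[OF Y(1)] by auto
      qed (use g m dm pw in auto)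
      moreover have "(\<integral>y. (f (Y n) y - f s y) / (Y n - s) \<partial>M) = ((\<integral>y. f (Y n) y \<partial>M) - (\<integral>y. f s y \<partial>M)) / (Y n - s)" for n
        using int[OF Y(3)] int[OF s] by simp
      ultimately have *: "(\<lambda>n. ((\<integral>y. f (Y n) y \<partial>M) - (\<integral>y. f s y \<partial>M)) / (Y n - s)) \<longlonglongrightarrow> (\<integral>y. d y \<partial>M)"
        by (simp only:)
      show "(\<lambda>n. ((\<integral>y. f (X n) y \<partial>M) - (\<integral>y. f s y \<partial>M)) / (X n - s)) \<longlonglongrightarrow> (\<integral>y. d y \<partial>M)"
        by (rule LIMSEQ_offset[OF *[unfolded Y_def]])
    qed
    then show ?thesis unfolding field_differentiable_def has_field_derivative_iff by blast
  qed
  then show "(\<lambda>s. \<integral>y. f s y \<partial>M) holomorphic_on S"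
    by (simp add: holomorphic_on_def field_differentiable_at_within)
qed

lemma holomorphic_power_series_remainder:
  assumes hol: "G holomorphic_on ball 0 R" and R: "R > 0" and bd: "\<And>z. z \<in> ball 0 R \<Longrightarrow> norm (G z) \<le> B"
    and w: "norm w \<le> R / 4"
  shows "norm (G w - (\<Sum>j<N. (deriv ^^ j) G 0 / fact j * w ^ j)) \<le> 2 * B * (2 * norm w / R) ^ N"
proof -
  define q where "q = 2 * norm w / R"
  define a where "a j = (deriv ^^ j) G 0 / fact j" for j
  have q: "0 \<le> q" "q \<le> 1/2" using R w by (auto simp: q_def field_simps)
  have B0: "B \<ge> 0" using order_trans[OF norm_ge_zero bd[of 0]] R by simp
  have coeff_bd: "norm (a j * w ^ j) \<le> B * q ^ j" for j
  proof -
    have "norm ((deriv ^^ j) G 0) \<le> fact j * B / (R/2) ^ j"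
    proof (rule Cauchy_inequality)
      have sub: "cball 0 (R/2) \<subseteq> ball 0 R" using R by auto
      have "G holomorphic_on cball 0 (R/2)" by (rule holomorphic_on_subset[OF hol sub])
      then show "G holomorphic_on ball 0 (R/2)" "continuous_on (cball 0 (R/2)) G"
        by (auto intro: holomorphic_on_subset holomorphic_on_imp_continuous_on)
      show "norm (G u) \<le> B" if "norm (0 - u) = R / 2" for u using bd[of u] that R by auto
    qed (use R in auto)
    then have "norm (a j) \<le> B / (R/2) ^ j" by (simp add: a_def norm_divide field_simps)
    then have "norm (a j * w ^ j) \<le> B / (R/2) ^ j * norm w ^ j"
      unfolding norm_mult norm_power by (intro mult_right_mono) auto
    also have "\<dots> = B * q ^ j" using R by (simp add: q_def power_divide power_mult_distrib field_simps)
    finally show ?thesis .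
  qed
  have "w \<in> ball 0 R" using w R by auto
  then have "(\<lambda>j. a j * w ^ j) sums G w" using holomorphic_power_series[OF hol, of w] by (simp add: a_def)
  then have 1: "(\<lambda>j. a (j + N) * w ^ (j + N)) sums (G w - (\<Sum>j<N. a j * w ^ j))"
    by (subst sums_iff_shift) simp
  have geo: "(\<lambda>j. B * q ^ N * q ^ j) sums (B * q ^ N * (1 / (1 - q)))"
    by (intro sums_mult geometric_sums) (use q in auto)
  have "norm (G w - (\<Sum>j<N. a j * w ^ j)) \<le> B * q ^ N * (1 / (1 - q))"
  proof (rule norm_sums_le[OF 1 geo])
    show "norm (a (j + N) * w ^ (j + N)) \<le> B * q ^ N * q ^ j" for j
      using coeff_bd[of "j + N"] by (simp add: power_add mult_ac)
  qed
  also have "\<dots> \<le> B * q ^ N * 2"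
    using q B0 by (intro mult_left_mono) (auto simp: field_simps)
  finally show ?thesis by (simp add: a_def q_def mult_ac)
qed

text \<open>
  The moments remove the Taylor polynomial of degree below \<open>2m\<close>. Along a complex line the remainder is
  controlled by a bound on the function alone, which spares all estimates of higher partial derivatives and
  makes the constant uniform in any further parameters of \<open>G\<close>.
\<close>
lemma central_difference_bound:
  assumes hol: "G holomorphic_on ball 0 R" and R: "R > 0" and bd: "\<And>z. z \<in> ball 0 R \<Longrightarrow> norm (G z) \<le> B"
    and h: "0 \<le> h" "real m * h \<le> R / 4"
  shows "norm (\<Sum>k\<in>{- int m..int m}. of_real (diff_coeff m k) * G (of_real (real_of_int k * h)))
    \<le> 2 * 4 ^ m * B * (2 * real m / R) ^ (2 * m) * h ^ (2 * m)"
proof -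
  let ?I = "{- int m..int m}"
  define T where "T w = (\<Sum>j<2*m. (deriv ^^ j) G 0 / fact j * w ^ j)" for w
  have B0: "B \<ge> 0" using order_trans[OF norm_ge_zero bd[of 0]] R by simp
  have T0: "(\<Sum>k\<in>?I. of_real (diff_coeff m k) * T (of_real (real_of_int k * h))) = 0"
  proof -
    have "(\<Sum>k\<in>?I. of_real (diff_coeff m k) * T (of_real (real_of_int k * h)))
       = (\<Sum>j<2*m. \<Sum>k\<in>?I. (deriv ^^ j) G 0 / fact j * of_real h ^ j * of_real (diff_coeff m k * real_of_int k ^ j))"
      unfolding T_def sum_distrib_left by (subst sum.swap) (simp add: power_mult_distrib mult_ac)
    also have "\<dots> = (\<Sum>j<2*m. (deriv ^^ j) G 0 / fact j * of_real h ^ j * of_real (\<Sum>k\<in>?I. diff_coeff m k * real_of_int k ^ j))"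
      by (simp only: sum_distrib_left of_real_sum)
    also have "\<dots> = 0" by (intro sum.neutral ballI) (simp add: diff_coeff_moments)
    finally show ?thesis .
  qed
  have "(\<Sum>k\<in>?I. of_real (diff_coeff m k) * G (of_real (real_of_int k * h)))
     = (\<Sum>k\<in>?I. of_real (diff_coeff m k) * (G (of_real (real_of_int k * h)) - T (of_real (real_of_int k * h))))"
    using T0 by (simp add: right_diff_distrib sum_subtractf)
  also have "norm \<dots> \<le> (\<Sum>k\<in>?I. \<bar>diff_coeff m k\<bar> * (2 * B * (2 * (real m * h) / R) ^ (2 * m)))"
  proof (rule sum_norm_le)
    fix k assume k: "k \<in> ?I"
    then have "\<bar>real_of_int k\<bar> \<le> real m" by auto
    then have kh: "norm (complex_of_real (real_of_int k * h)) \<le> real m * h"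
      using h by (simp add: abs_mult mult_right_mono del: of_real_mult)
    have "norm (G (of_real (real_of_int k * h)) - T (of_real (real_of_int k * h))) \<le> 2 * B * (2 * norm (complex_of_real (real_of_int k * h)) / R) ^ (2 * m)"
      unfolding T_def by (rule holomorphic_power_series_remainder[OF hol R bd]) (use kh h in linarith)+
    also have "\<dots> \<le> 2 * B * (2 * (real m * h) / R) ^ (2 * m)"
      using kh R B0 by (intro mult_left_mono power_mono divide_right_mono) auto
    finally show "norm (of_real (diff_coeff m k) * (G (of_real (real_of_int k * h)) - T (of_real (real_of_int k * h))))
       \<le> \<bar>diff_coeff m k\<bar> * (2 * B * (2 * (real m * h) / R) ^ (2 * m))"
      unfolding norm_mult by (intro mult_mono) auto
  qed
  also have "\<dots> = 4 ^ m * (2 * B * (2 * (real m * h) / R) ^ (2 * m))"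
    by (simp only: sum_distrib_right[symmetric] sum_abs_diff_coeff)
  also have "\<dots> = 2 * 4 ^ m * B * (2 * real m / R) ^ (2 * m) * h ^ (2 * m)"
    by (simp add: power_mult_distrib power_divide)
  finally show ?thesis .
qed

section \<open>Difference integrals as functions of the order\<close>

definition central_diff :: "nat \<Rightarrow> ('a::real_vector \<Rightarrow> complex) \<Rightarrow> 'a \<Rightarrow> 'a \<Rightarrow> complex" where
  "central_diff m u x y = (\<Sum>k\<in>{- int m..int m}. of_real (diff_coeff m k) * u (x + real_of_int k *\<^sub>R y))"

text \<open>The kernel \<open>|y|^(-n-2s)\<close> at complex order.\<close>
abbreviation riesz_kernel :: "nat \<Rightarrow> complex \<Rightarrow> 'a::real_normed_vector \<Rightarrow> complex" where
  "riesz_kernel n s y \<equiv> exp (- (of_nat n + 2 * s) * of_real (ln (norm y)))"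

text \<open>
  Here \<open>X\<close> stands for the norm of a translated point \<open>x + k y\<close>, and \<open>y\<close> for the norm of the increment. If
  the growth exponent \<open>2\<sigma> - n\<close> is not positive, the distance \<open>r0\<close> from the pole bounds the first factor and the
  kernel decays on its own. Otherwise the first factor is at most a multiple of \<open>y^(2\<sigma> - n)\<close> and the product
  decays like \<open>y^(-2n)\<close>.
\<close>
lemma growth_bound_far:
  fixes n m :: nat and \<rho> y \<sigma> lo \<delta> r0 K X :: real
  assumes \<rho>: "0 < \<rho>" "\<rho> \<le> 1" "\<rho> \<le> y" and \<sigma>: "lo \<le> \<sigma>" "\<sigma> \<le> real m" and r0: "r0 > 0"
    and K: "K \<ge> 1" and X: "r0 \<le> X" "X \<le> K * y"
    and \<delta>: "\<delta> \<le> 2 * lo" "\<delta> \<le> real n" "0 < \<delta>"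
  shows "X powr (2 * \<sigma> - real n) * y powr (- (real n + 2 * \<sigma>))
    \<le> ((1 + r0 powr (- real n)) * \<rho> powr (- 2 * real m) + K powr (2 * real m) * \<rho> powr (- real n)) * y powr (- real n - \<delta>)"
proof (cases "2 * \<sigma> - real n \<le> 0")
  case True
  have y: "y > 0" using \<rho> by linarith
  have "X powr (2 * \<sigma> - real n) \<le> r0 powr (2 * \<sigma> - real n)" using X r0 True by (intro powr_mono2') auto
  also have "\<dots> \<le> 1 + r0 powr (- real n)"
  proof (cases "r0 \<ge> 1")
    case True
    have "r0 powr (2 * \<sigma> - real n) \<le> r0 powr 0" using True \<open>2 * \<sigma> - real n \<le> 0\<close> by (intro powr_mono) auto
    then show ?thesis using r0 by (simp add: add_increasing2)
  next
    case False
    have "r0 powr (2 * \<sigma> - real n) \<le> r0 powr (- real n)" using False r0 \<delta> \<sigma> by (intro powr_mono') auto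
    then show ?thesis by simp
  qed
  finally have 1: "X powr (2 * \<sigma> - real n) \<le> 1 + r0 powr (- real n)" .
  have "y powr (- (real n + 2 * \<sigma>)) = y powr (\<delta> - 2 * \<sigma>) * y powr (- real n - \<delta>)"
    unfolding powr_add[symmetric] by (simp add: algebra_simps)
  also have "y powr (\<delta> - 2 * \<sigma>) \<le> \<rho> powr (\<delta> - 2 * \<sigma>)" using \<rho> \<delta> \<sigma> by (intro powr_mono2') auto
  also have "\<rho> powr (\<delta> - 2 * \<sigma>) \<le> \<rho> powr (- 2 * real m)" using \<rho> \<delta> \<sigma> by (intro powr_mono') auto
  finally have 2: "y powr (- (real n + 2 * \<sigma>)) \<le> \<rho> powr (- 2 * real m) * y powr (- real n - \<delta>)" by (simp add: mult_right_mono)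
  have "X powr (2 * \<sigma> - real n) * y powr (- (real n + 2 * \<sigma>)) \<le> (1 + r0 powr (- real n)) * (\<rho> powr (- 2 * real m) * y powr (- real n - \<delta>))"
    using 1 2 by (intro mult_mono) auto
  also have "\<dots> \<le> ((1 + r0 powr (- real n)) * \<rho> powr (- 2 * real m) + K powr (2 * real m) * \<rho> powr (- real n)) * y powr (- real n - \<delta>)"
    by (simp add: distrib_right)
  finally show ?thesis .
next
  case False
  have y: "y > 0" using \<rho> by linarith
  have "X powr (2 * \<sigma> - real n) \<le> (K * y) powr (2 * \<sigma> - real n)" using X r0 False by (intro powr_mono2) auto
  also have "\<dots> = K powr (2 * \<sigma> - real n) * y powr (2 * \<sigma> - real n)" using K y by (simp add: powr_mult)
  also have "\<dots> \<le> K powr (2 * real m) * y powr (2 * \<sigma> - real n)" using K False \<sigma> by (intro mult_right_mono powr_mono) auto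
  finally have 1: "X powr (2 * \<sigma> - real n) \<le> K powr (2 * real m) * y powr (2 * \<sigma> - real n)" .
  have "y powr (2 * \<sigma> - real n) * y powr (- (real n + 2 * \<sigma>)) = y powr (\<delta> - real n) * y powr (- real n - \<delta>)"
    unfolding powr_add[symmetric] by (simp add: algebra_simps)
  also have "y powr (\<delta> - real n) \<le> \<rho> powr (\<delta> - real n)" using \<rho> \<delta> by (intro powr_mono2') auto
  also have "\<rho> powr (\<delta> - real n) \<le> \<rho> powr (- real n)" using \<rho> \<delta> by (intro powr_mono') auto
  finally have 2: "y powr (2 * \<sigma> - real n) * y powr (- (real n + 2 * \<sigma>)) \<le> \<rho> powr (- real n) * y powr (- real n - \<delta>)" by (simp add: mult_right_mono)
  have "X powr (2 * \<sigma> - real n) * y powr (- (real n + 2 * \<sigma>)) \<le> K powr (2 * real m) * (y powr (2 * \<sigma> - real n) * y powr (- (real n + 2 * \<sigma>)))"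
    using 1 by (simp add: mult.assoc[symmetric] mult_right_mono)
  also have "\<dots> \<le> K powr (2 * real m) * (\<rho> powr (- real n) * y powr (- real n - \<delta>))" using 2 by (intro mult_left_mono) auto
  also have "\<dots> \<le> ((1 + r0 powr (- real n)) * \<rho> powr (- 2 * real m) + K powr (2 * real m) * \<rho> powr (- real n)) * y powr (- real n - \<delta>)"
    by (simp add: distrib_right)
  finally show ?thesis .
qed

text \<open>
  Close to \<open>y = 0\<close> the order \<open>2m\<close> of the difference exceeds the order \<open>2 Re s\<close> of the singularity. Far out the
  growth of \<open>u\<close> leaves an integrand of size \<open>|y|^(-n-\<delta>)\<close>, with \<open>\<delta>\<close> positive and constant near a given
  \<open>s\<close>. Both bounds are locally uniform, so the integral depends holomorphically on the order.
\<close>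
lemma
  fixes u :: "complex \<Rightarrow> 'a::euclidean_space \<Rightarrow> complex"
  assumes meas[measurable]: "\<And>s. u s \<in> borel_measurable borel"
    and hol: "\<And>X. (\<lambda>s. u s X) holomorphic_on UNIV"
    and r0: "r0 > 0" and vanish: "\<And>s X. norm X < r0 \<Longrightarrow> u s X = 0"
    and growth: "\<And>s X. 0 < Re s \<Longrightarrow> norm (u s X) \<le> norm X powr (2 * Re s - real DIM('a))"
    and near: "\<And>s0. \<exists>r>0. \<exists>C. \<exists>\<rho>>0. \<forall>s\<in>ball s0 r. \<forall>y. norm y < \<rho> \<longrightarrow> norm (central_diff m (u s) x y) \<le> C * norm y ^ (2 * m)"
  shows holomorphic_diff_integral: "(\<lambda>s. \<integral>y. central_diff m (u s) x y * riesz_kernel DIM('a) s y \<partial>lborel) holomorphic_on {s. 0 < Re s \<and> Re s < real m}"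
    and integrable_diff: "\<And>s. 0 < Re s \<Longrightarrow> Re s < real m \<Longrightarrow> integrable lborel (\<lambda>y. central_diff m (u s) x y * riesz_kernel DIM('a) s y)"
proof -
  let ?n = "DIM('a)"
  let ?S = "{s. 0 < Re s \<and> Re s < real m}"
  let ?f = "\<lambda>s y. central_diff m (u s) x y * riesz_kernel DIM('a) s y"
  have S: "open ?S"
    by (intro open_Collect_conj open_Collect_less continuous_intros)
  have hol': "(\<lambda>s. ?f s y) holomorphic_on ?S" for y
    unfolding central_diff_def using hol by (intro holomorphic_intros holomorphic_on_subset[OF hol]) auto
  have meas': "?f s \<in> borel_measurable lborel" for s
    unfolding central_diff_def by measurable
  have dom: "\<exists>r>0. \<exists>g. integrable lborel g \<and> ball s0 r \<subseteq> ?S \<and> (\<forall>z\<in>ball s0 r. \<forall>y. norm (?f z y) \<le> g y)"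
    if s0: "s0 \<in> ?S" for s0
  proof -
    obtain r' C \<rho>' where r': "r' > 0" "\<rho>' > 0"
      and nb: "\<And>s y. s \<in> ball s0 r' \<Longrightarrow> norm y < \<rho>' \<Longrightarrow> norm (central_diff m (u s) x y) \<le> C * norm y ^ (2 * m)"
      using near[of s0] by blast
    define \<sigma>1 \<sigma>2 where "\<sigma>1 = Re s0 / 2" and "\<sigma>2 = (Re s0 + real m) / 2"
    define r where "r = min r' (min \<sigma>1 (\<sigma>2 - Re s0))"
    define \<rho> where "\<rho> = min 1 \<rho>'"
    define \<delta> where "\<delta> = min (2 * \<sigma>1) (real ?n)"
    \<comment> \<open>Then \<open>norm (x + k y) \<le> K norm y\<close> for \<open>|k| \<le> m\<close> and \<open>norm y \<ge> \<rho>\<close>.\<close>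
    define K where "K = (norm x + r0) / \<rho> + real m"
    define D where "D = (1 + r0 powr (- real ?n)) * \<rho> powr (- 2 * real m) + K powr (2 * real m) * \<rho> powr (- real ?n)"
    have m1: "m \<ge> 1" using s0 by (cases m) auto
    have \<sigma>: "0 < \<sigma>1" "\<sigma>2 < real m" "Re s0 < \<sigma>2" using s0 by (auto simp: \<sigma>1_def \<sigma>2_def)
    have r: "r > 0" using \<sigma> r' by (auto simp: r_def)
    have \<rho>: "0 < \<rho>" "\<rho> \<le> 1" using r' by (auto simp: \<rho>_def)
    have \<delta>: "0 < \<delta>" "\<delta> \<le> 2 * \<sigma>1" "\<delta> \<le> real ?n" using \<sigma> by (auto simp: \<delta>_def)
    have K: "K \<ge> 1" using m1 \<rho> r0 by (simp add: K_def add_increasing)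
    have D: "D \<ge> 0" by (simp add: D_def)
    have ball: "\<sigma>1 \<le> Re s \<and> Re s \<le> \<sigma>2 \<and> s \<in> ball s0 r'" if "s \<in> ball s0 r" for s
    proof -
      have "norm (s0 - s) < r" using that by (simp add: dist_norm)
      then have "\<bar>Re s0 - Re s\<bar> < r" using abs_Re_le_cmod[of "s0 - s"] by simp
      then have "\<bar>Re s0 - Re s\<bar> < \<sigma>1" "\<bar>Re s0 - Re s\<bar> < \<sigma>2 - Re s0" by (auto simp: r_def)
      then have "\<sigma>1 \<le> Re s" "Re s \<le> \<sigma>2" unfolding \<sigma>1_def abs_less_iff by linarith+
      then show ?thesis using that by (simp add: r_def)
    qed
    define g where "g y = \<bar>C\<bar> * (indicator (ball 0 \<rho>) y * norm y powr (2 * real m - real ?n - 2 * \<sigma>2))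
       + 4 ^ m * D * (indicator (- ball 0 \<rho>) y * norm y powr (- real ?n - \<delta>))" for y :: 'a
    have "integrable lborel g"
      unfolding g_def using \<sigma> \<delta> \<rho>
      by (intro Bochner_Integration.integrable_add integrable_mult_right integrable_norm_powr_ball integrable_norm_powr_outside) auto
    moreover have "ball s0 r \<subseteq> ?S" using ball \<sigma> by force
    moreover have "norm (?f s y) \<le> g y" if s: "s \<in> ball s0 r" for s y
    proof (cases "y = 0")
      case True
      have "norm (central_diff m (u s) x y) \<le> 0"
        using nb[of s y] ball[OF s] True r' m1 by (simp add: power_0_left)
      then have "central_diff m (u s) x y = 0" by simp
      then show ?thesis using D by (simp add: g_def)
    next
      case False
      define \<sigma> where "\<sigma> = Re s"
      have \<sigma>b: "\<sigma>1 \<le> \<sigma>" "\<sigma> \<le> \<sigma>2" using ball[OF s] by (auto simp: \<sigma>_def)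
      have ny: "norm y > 0" using False by simp
      have ex: "norm (riesz_kernel ?n s y) = norm y powr (- (?n + 2 * \<sigma>))"
        using False by (simp add: powr_def \<sigma>_def)
      show ?thesis
      proof (cases "norm y < \<rho>")
        case True
        have "norm (?f s y) \<le> (\<bar>C\<bar> * norm y ^ (2 * m)) * norm y powr (- (?n + 2 * \<sigma>))"
          unfolding norm_mult ex
        proof (intro mult_right_mono)
          have "norm (central_diff m (u s) x y) \<le> C * norm y ^ (2 * m)" 
            by (rule nb) (use ball[OF s] True in \<open>auto simp: \<rho>_def\<close>)
          also have "\<dots> \<le> \<bar>C\<bar> * norm y ^ (2 * m)" by (intro mult_right_mono) auto
          finally show "norm (central_diff m (u s) x y) \<le> \<bar>C\<bar> * norm y ^ (2 * m)" .
        qed simp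
        also have "\<dots> = \<bar>C\<bar> * norm y powr (2 * real m - real ?n - 2 * \<sigma>)"
          using ny by (simp add: powr_realpow[symmetric] mult.assoc flip: powr_add) (simp add: algebra_simps)
        also have "\<dots> \<le> \<bar>C\<bar> * norm y powr (2 * real m - real ?n - 2 * \<sigma>2)"
          using ny True \<rho> \<sigma>b by (intro mult_left_mono powr_mono') auto
        also have "\<dots> = g y" using True by (simp add: g_def)
        finally show ?thesis .
      next
        case far: False
        have ub: "norm (u s X) * norm y powr (- (?n + 2 * \<sigma>)) \<le> D * norm y powr (- real ?n - \<delta>)" if "norm X \<le> K * norm y" for X
        proof (cases "norm X < r0")
          case True
          then show ?thesis using vanish D by simp
        next
          case False
          have "norm (u s X) * norm y powr (- (?n + 2 * \<sigma>)) \<le> norm X powr (2 * \<sigma> - ?n) * norm y powr (- (?n + 2 * \<sigma>))"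
            using growth[of s X] \<sigma>b \<open>0 < \<sigma>1\<close> by (intro mult_right_mono) (auto simp: \<sigma>_def)
          also have "\<dots> \<le> D * norm y powr (- real ?n - \<delta>)"
            unfolding D_def by (rule growth_bound_far[where lo=\<sigma>1]) (use \<rho> far \<sigma>b \<sigma> r0 K False that \<delta> in auto)
          finally show ?thesis .
        qed
        have "norm (?f s y) \<le> (\<Sum>k\<in>{- int m..int m}. \<bar>diff_coeff m k\<bar> * norm (u s (x + real_of_int k *\<^sub>R y))) * norm y powr (- (?n + 2 * \<sigma>))"
          unfolding norm_mult ex central_diff_def
          by (intro mult_right_mono sum_norm_le) (auto simp: norm_mult)
        also have "\<dots> = (\<Sum>k\<in>{- int m..int m}. \<bar>diff_coeff m k\<bar> * (norm (u s (x + real_of_int k *\<^sub>R y)) * norm y powr (- (?n + 2 * \<sigma>))))"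
          by (simp add: sum_distrib_right mult.assoc)
        also have "\<dots> \<le> (\<Sum>k\<in>{- int m..int m}. \<bar>diff_coeff m k\<bar> * (D * norm y powr (- real ?n - \<delta>)))"
        proof (intro sum_mono mult_left_mono ub)
          fix k assume k: "k \<in> {- int m..int m}"
          have "norm (x + real_of_int k *\<^sub>R y) \<le> norm x + \<bar>real_of_int k\<bar> * norm y" by (metis norm_scaleR norm_triangle_ineq)
          also have "\<dots> \<le> norm x + real m * norm y" using k by (intro add_left_mono mult_right_mono) auto
          also have "norm x \<le> (norm x + r0) / \<rho> * norm y"
          proof -
            have "norm x \<le> (norm x + r0) * 1" using r0 by simp
            also have "\<dots> \<le> (norm x + r0) * (norm y / \<rho>)" using far \<rho> r0 by (intro mult_left_mono) (auto simp: field_simps)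
            finally show ?thesis by simp
          qed
          finally show "norm (x + real_of_int k *\<^sub>R y) \<le> K * norm y" by (simp add: K_def distrib_right)
        qed simp
        also have "\<dots> = 4 ^ m * (D * norm y powr (- real ?n - \<delta>))"
          by (simp only: sum_distrib_right[symmetric] sum_abs_diff_coeff)
        also have "\<dots> = g y" using far by (simp add: g_def)
        finally show ?thesis .
      qed
    qed
    ultimately show ?thesis using r by blast
  qed
  show "(\<lambda>s. \<integral>y. ?f s y \<partial>lborel) holomorphic_on ?S"
    by (rule holomorphic_lebesgue_integral[OF S hol' meas' dom])
  show "integrable lborel (?f s)" if "0 < Re s" "Re s < real m" for s
    by (rule integrable_dominated_family[OF S hol' meas' dom]) (use that in auto)
qed

lemma
  fixes f :: "'a::euclidean_space \<Rightarrow> real"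
  assumes c: "c \<noteq> 0" and f[measurable]: "f \<in> borel_measurable borel"
  shows integrable_lborel_affine: "integrable lborel (\<lambda>x. f (t + c *\<^sub>R x)) \<longleftrightarrow> integrable lborel f"
    and integral_lborel_affine: "(\<integral>x. f (t + c *\<^sub>R x) \<partial>lborel) = (\<integral>x. f x \<partial>lborel) / \<bar>c\<bar> ^ DIM('a)"
proof -
  have m: "(\<lambda>x. t + c *\<^sub>R x) \<in> lborel \<rightarrow>\<^sub>M borel" by simp
  have pos: "\<bar>c\<bar> ^ DIM('a) > 0" using c by simp
  have "integrable lborel f \<longleftrightarrow> integrable (density (distr lborel borel (\<lambda>x. t + c *\<^sub>R x)) (\<lambda>_. ennreal (\<bar>c\<bar> ^ DIM('a)))) f"
    by (simp only: lborel_affine[OF c, of t, symmetric])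
  also have "\<dots> \<longleftrightarrow> integrable (distr lborel borel (\<lambda>x. t + c *\<^sub>R x)) (\<lambda>x. \<bar>c\<bar> ^ DIM('a) *\<^sub>R f x)"
    by (rule integrable_density) auto
  also have "\<dots> \<longleftrightarrow> integrable (distr lborel borel (\<lambda>x. t + c *\<^sub>R x)) f" using c by simp
  also have "\<dots> \<longleftrightarrow> integrable lborel (\<lambda>x. f (t + c *\<^sub>R x))" by (rule integrable_distr_eq[OF m f])
  finally show "integrable lborel (\<lambda>x. f (t + c *\<^sub>R x)) \<longleftrightarrow> integrable lborel f" by simp
  have "integral\<^sup>L lborel f = integral\<^sup>L (density (distr lborel borel (\<lambda>x. t + c *\<^sub>R x)) (\<lambda>_. ennreal (\<bar>c\<bar> ^ DIM('a)))) f"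
    by (simp only: lborel_affine[OF c, of t, symmetric])
  also have "\<dots> = integral\<^sup>L (distr lborel borel (\<lambda>x. t + c *\<^sub>R x)) (\<lambda>x. \<bar>c\<bar> ^ DIM('a) *\<^sub>R f x)"
    by (rule integral_density) auto
  also have "\<dots> = \<bar>c\<bar> ^ DIM('a) * integral\<^sup>L (distr lborel borel (\<lambda>x. t + c *\<^sub>R x)) f" by simp
  also have "integral\<^sup>L (distr lborel borel (\<lambda>x. t + c *\<^sub>R x)) f = (\<integral>x. f (t + c *\<^sub>R x) \<partial>lborel)"
    by (rule integral_distr[OF m f])
  finally show "(\<integral>x. f (t + c *\<^sub>R x) \<partial>lborel) = (\<integral>x. f x \<partial>lborel) / \<bar>c\<bar> ^ DIM('a)" using pos by (simp add: field_simps)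
qed

text \<open>
  The weights sum to zero, so \<open>u x\<close> may be subtracted from every term. Then each term is integrable by itself,
  and scaling reduces it to the one for \<open>k = 1\<close>.
\<close>
lemma integral_diff_split:
  fixes u :: "'a::euclidean_space \<Rightarrow> real"
  assumes u[measurable]: "u \<in> borel_measurable borel" and m: "m \<ge> 1"
    and I: "integrable lborel (\<lambda>z. (u z - u x) * norm (z - x) powr (- (real DIM('a) + 2 * q)))"
  shows "(\<integral>y. (\<Sum>k\<in>{- int m..int m}. diff_coeff m k * u (x + real_of_int k *\<^sub>R y)) * norm y powr (- (real DIM('a) + 2 * q)) \<partial>lborel)
    = 2 * kernel_factor m q
      * (\<integral>z. (u z - u x) * norm (z - x) powr (- (real DIM('a) + 2 * q)) \<partial>lborel)"
proof -
  let ?n = "real DIM('a)"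
  let ?p = "?n + 2 * q"
  define f where "f z = (u z - u x) * norm (z - x) powr (- ?p)" for z
  have fm[measurable]: "f \<in> borel_measurable borel" unfolding f_def by measurable
  have fI: "integrable lborel f" using I by (simp add: f_def[abs_def])
  define F where "F = integral\<^sup>L lborel f"
  define h where "h k y = (u (x + real_of_int k *\<^sub>R y) - u x) * norm y powr (- ?p)" for k y
  have h: "h k y = \<bar>real_of_int k\<bar> powr ?p * f (x + real_of_int k *\<^sub>R y)" if "k \<noteq> 0" for k y
  proof -
    have "\<bar>real_of_int k\<bar> powr ?p * \<bar>real_of_int k\<bar> powr (- ?p) = 1" using that by (simp flip: powr_add)
    then have "\<bar>real_of_int k\<bar> powr ?p * (\<bar>real_of_int k\<bar> powr (- ?p) * norm y powr (- ?p)) = norm y powr (- ?p)" by (simp only: mult.assoc[symmetric])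
    then show ?thesis using that by (simp add: h_def f_def powr_mult mult_ac)
  qed
  have hI: "integrable lborel (h k)" and hF: "integral\<^sup>L lborel (h k) = (if k = 0 then 0 else \<bar>real_of_int k\<bar> powr (2 * q) * F)" for k
  proof -
    show "integrable lborel (h k)"
    proof (cases "k = 0")
      case False
      then have "integrable lborel (\<lambda>y. f (x + real_of_int k *\<^sub>R y))" by (subst integrable_lborel_affine) (use fI in auto)
      then show ?thesis using h[OF False] by (simp cong: Bochner_Integration.integrable_cong)
    qed (simp add: h_def[abs_def])
    show "integral\<^sup>L lborel (h k) = (if k = 0 then 0 else \<bar>real_of_int k\<bar> powr (2 * q) * F)"
    proof (cases "k = 0")
      case False
      have "integral\<^sup>L lborel (h k) = \<bar>real_of_int k\<bar> powr ?p * (\<integral>y. f (x + real_of_int k *\<^sub>R y) \<partial>lborel)"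
        using h[OF False] by (simp cong: Bochner_Integration.integral_cong)
      also have "\<dots> = \<bar>real_of_int k\<bar> powr ?p / \<bar>real_of_int k\<bar> ^ DIM('a) * F"
        using False by (subst integral_lborel_affine) (auto simp: F_def)
      also have "\<bar>real_of_int k\<bar> powr ?p / \<bar>real_of_int k\<bar> ^ DIM('a) = \<bar>real_of_int k\<bar> powr (2 * q)"
        using False by (simp add: powr_realpow[symmetric] flip: powr_diff)
      finally show ?thesis using False by simp
    qed (simp add: h_def[abs_def])
  qed
  \<comment> \<open>Subtracting \<open>u x\<close> changes nothing: the weights have vanishing moment of order \<open>0\<close>.\<close>
  have c0: "(\<Sum>k\<in>{- int m..int m}. diff_coeff m k) = 0" using diff_coeff_moments[of 0 m] m by simp
  have "(\<Sum>k\<in>{- int m..int m}. diff_coeff m k * u (x + real_of_int k *\<^sub>R y)) * norm y powr (- ?p)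
      = (\<Sum>k\<in>{- int m..int m}. diff_coeff m k * h k y)" for y
  proof -
    have "(\<Sum>k\<in>{- int m..int m}. diff_coeff m k * h k y)
       = (\<Sum>k\<in>{- int m..int m}. diff_coeff m k * u (x + real_of_int k *\<^sub>R y)) * norm y powr (- ?p)
       - (\<Sum>k\<in>{- int m..int m}. diff_coeff m k) * (u x * norm y powr (- ?p))"
      by (simp only: h_def left_diff_distrib right_diff_distrib sum_subtractf sum_distrib_right mult.assoc)
    then show ?thesis using c0 by simp
  qed
  then have "(\<integral>y. (\<Sum>k\<in>{- int m..int m}. diff_coeff m k * u (x + real_of_int k *\<^sub>R y)) * norm y powr (- ?p) \<partial>lborel)
     = (\<Sum>k\<in>{- int m..int m}. diff_coeff m k * integral\<^sup>L lborel (h k))"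
    using hI by simp
  also have "\<dots> = (\<Sum>k=1..m. 2 * ((-1) ^ k * real ((2*m) choose (m - k)) * real k powr (2 * q)) * F)"
    unfolding sum_symmetric_int_interval
    by (auto simp: hF diff_coeff_minus diff_coeff_of_nat intro!: sum.cong)
  finally show "(\<integral>y. (\<Sum>k\<in>{- int m..int m}. diff_coeff m k * u (x + real_of_int k *\<^sub>R y)) * norm y powr (- ?p) \<partial>lborel)
    = 2 * kernel_factor m q
      * (\<integral>z. (u z - u x) * norm (z - x) powr (- ?p) \<partial>lborel)"
    by (simp add: F_def f_def[abs_def] sum_distrib_left sum_distrib_right)
qed

section \<open>Kelvin transform of the first difference integral\<close>

definition inversion :: "real \<Rightarrow> 'a::real_normed_vector \<Rightarrow> 'a" where
  "inversion c z = (c / (norm z)\<^sup>2) *\<^sub>R z"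

lemma inversion_measurable [measurable]: "inversion c \<in> borel_measurable (borel :: 'a::euclidean_space measure)"
  unfolding inversion_def[abs_def] by measurable

lemma norm_inversion: "c > 0 \<Longrightarrow> norm (inversion c z) = c / norm z"
  by (cases "z = 0") (auto simp: inversion_def power2_eq_square)

lemma norm_inversion_diff:
  fixes x z :: "'a::real_inner"
  assumes "c > 0" "x \<noteq> 0" "z \<noteq> 0"
  shows "norm (inversion c z - inversion c x) = c * norm (z - x) / (norm z * norm x)"
proof (rule power2_eq_imp_eq)
  have sq: "(norm (a - b))\<^sup>2 = (norm a)\<^sup>2 + (norm b)\<^sup>2 - 2 * (a \<bullet> b)" for a b :: 'a
    by (simp add: power2_norm_eq_inner inner_diff_left inner_diff_right inner_commute)
  have "(norm (inversion c z - inversion c x))\<^sup>2 = (c / norm z)\<^sup>2 + (c / norm x)\<^sup>2 - 2 * (c / (norm z)\<^sup>2 * (c / (norm x)\<^sup>2) * (z \<bullet> x))"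
    unfolding sq norm_inversion[OF assms(1)] by (simp add: inversion_def mult_ac)
  also have "\<dots> = c\<^sup>2 / ((norm z)\<^sup>2 * (norm x)\<^sup>2) * (norm (z - x))\<^sup>2"
  proof -
    have "(c / Z)\<^sup>2 + (c / X)\<^sup>2 - 2 * (c / Z\<^sup>2 * (c / X\<^sup>2) * d) = c\<^sup>2 / (Z\<^sup>2 * X\<^sup>2) * (Z\<^sup>2 + X\<^sup>2 - 2 * d)"
      if "Z \<noteq> 0" "X \<noteq> 0" for Z X d :: real
      using that by (simp add: divide_simps) (simp add: algebra_simps power2_eq_square)
    then show ?thesis unfolding sq using assms by simp
  qed
  also have "\<dots> = (c * norm (z - x) / (norm z * norm x))\<^sup>2"
    by (simp add: power_mult_distrib power_divide)
  finally show "(norm (inversion c z - inversion c x))\<^sup>2 = (c * norm (z - x) / (norm z * norm x))\<^sup>2" .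
qed (use assms in auto)

text \<open>
  Under inversion the kernel and the Jacobian produce powers of \<open>|z|\<close> which combine to the weight
  \<open>|z|^(2s-n)\<close>; what is left over depends on \<open>x\<close> only.
\<close>
lemma
  fixes f :: "'a::euclidean_space \<Rightarrow> real" and s :: real
  assumes c: "c > 0" and x: "x \<noteq> 0" and f[measurable]: "f \<in> borel_measurable borel"
  defines "p \<equiv> real DIM('a) + 2 * s"
  shows integrable_kelvin: "integrable lborel (\<lambda>z. norm z powr (2 * s - real DIM('a)) * f (inversion c z) * norm (z - x) powr (- p))
      \<longleftrightarrow> integrable lborel (\<lambda>y. f y * norm (y - inversion c x) powr (- p))"
    and integral_kelvin: "(\<integral>z. norm z powr (2 * s - real DIM('a)) * f (inversion c z) * norm (z - x) powr (- p) \<partial>lborel)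
      = c powr (2 * s) * norm x powr (- p) * (\<integral>y. f y * norm (y - inversion c x) powr (- p) \<partial>lborel)"
proof -
  let ?n = "DIM('a)"
  define g where "g z = norm z powr (2 * s - real ?n) * f (inversion c z) * norm (z - x) powr (- p)" for z
  define h where "h y = f y * norm (y - inversion c x) powr (- p)" for y
  have hm[measurable]: "h \<in> borel_measurable borel" and gm[measurable]: "g \<in> borel_measurable borel"
    unfolding h_def g_def by measurable
  define H where "H z = (c / (norm z)\<^sup>2) ^ ?n * h ((c / (norm z)\<^sup>2) *\<^sub>R z)" for z
  have Hm[measurable]: "H \<in> borel_measurable borel" unfolding H_def by measurable
  define C where "C = c powr (2 * s) * norm x powr (- p)"
  have C: "C > 0" using c x by (simp add: C_def)
  have eq: "g z = C * H z" if z: "z \<noteq> 0" for z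
  proof -
    have nz: "norm z > 0" "norm x > 0" using z x by auto
    have "H z = (c / (norm z)\<^sup>2) ^ ?n * (f (inversion c z) * (c * norm (z - x) / (norm z * norm x)) powr (- p))"
      by (simp add: H_def h_def norm_inversion_diff[OF c x z] flip: inversion_def)
    also have "(c / (norm z)\<^sup>2) ^ ?n = c powr real ?n * norm z powr (- 2 * real ?n)"
    proof -
      have pos: "c / (norm z)\<^sup>2 > 0" using c nz by simp
      have "c / (norm z)\<^sup>2 = c * norm z powr (- 2)" using nz by (simp add: powr_minus divide_inverse)
      then have "(c / (norm z)\<^sup>2) powr real ?n = c powr real ?n * (norm z powr (- 2)) powr real ?n"
        using c by (simp only: powr_mult powr_ge_zero less_imp_le)
      then show ?thesis using powr_realpow[OF pos, of ?n] by (simp only: powr_powr)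
    qed
    also have "(c * norm (z - x) / (norm z * norm x)) powr (- p) = c powr (- p) * norm (z - x) powr (- p) * (norm z powr p * norm x powr p)"
      using c nz by (simp add: powr_mult powr_divide powr_minus) (simp add: field_simps)
    finally have "C * H z = (c powr (2 * s) * c powr real ?n * c powr (- p)) * (norm x powr (- p) * norm x powr p) * (norm z powr (- 2 * real ?n) * norm z powr p) * (f (inversion c z) * norm (z - x) powr (- p))"
      by (simp only: C_def mult_ac)
    also have "c powr (2 * s) * c powr real ?n * c powr (- p) = 1" using c by (simp add: p_def flip: powr_add)
    also have "norm x powr (- p) * norm x powr p = 1" using nz by (simp flip: powr_add)
    also have "norm z powr (- 2 * real ?n) * norm z powr p = norm z powr (2 * s - real ?n)" using nz by (simp add: p_def flip: powr_add)
    finally show ?thesis by (simp add: g_def)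
  qed
  have ae: "AE z in lborel. g z = C * H z"
    using AE_lborel_singleton[of 0] by eventually_elim (rule eq)
  have "integrable lborel g \<longleftrightarrow> integrable lborel (\<lambda>z. C * H z)"
    by (rule integrable_cong_AE) (use ae in auto)
  also have "\<dots> \<longleftrightarrow> integrable lborel H" using C by simp
  also have "\<dots> \<longleftrightarrow> integrable lborel h" unfolding H_def by (rule integrable_inversion[OF c hm])
  finally show "integrable lborel (\<lambda>z. norm z powr (2 * s - real ?n) * f (inversion c z) * norm (z - x) powr (- p))
      \<longleftrightarrow> integrable lborel (\<lambda>y. f y * norm (y - inversion c x) powr (- p))"
    by (simp only: g_def[abs_def] h_def[abs_def])
  have "integral\<^sup>L lborel g = (\<integral>z. C * H z \<partial>lborel)"
    by (rule integral_cong_AE) (use ae in auto)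
  also have "\<dots> = C * integral\<^sup>L lborel h" using integral_inversion[OF c hm] by (simp add: H_def[abs_def])
  finally show "(\<integral>z. norm z powr (2 * s - real ?n) * f (inversion c z) * norm (z - x) powr (- p) \<partial>lborel)
      = c powr (2 * s) * norm x powr (- p) * (\<integral>y. f y * norm (y - inversion c x) powr (- p) \<partial>lborel)"
    by (simp only: g_def[abs_def] h_def[abs_def] C_def)
qed

lemma powr_lipschitz:
  fixes a e u v :: real
  assumes "a > 0" "e < 0" "a \<le> u" "a \<le> v"
  shows "\<bar>u powr e - v powr e\<bar> \<le> \<bar>e\<bar> * a powr (e - 1) * \<bar>u - v\<bar>"
proof -
  have "norm (u powr e - v powr e) \<le> \<bar>e\<bar> * a powr (e - 1) * norm (u - v)"
  proof (rule field_differentiable_bound[of "{a..}" "\<lambda>t. t powr e" "\<lambda>t. e * t powr (e - 1)"])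
    fix z assume z: "z \<in> {a..}"
    then have "z > 0" using assms by auto
    then show "((\<lambda>t. t powr e) has_field_derivative e * z powr (e - 1)) (at z within {a..})"
      by (auto intro!: derivative_eq_intros simp: powr_diff)
    have "z powr (e - 1) \<le> a powr (e - 1)" using z assms by (intro powr_mono2') auto
    then show "norm (e * z powr (e - 1)) \<le> \<bar>e\<bar> * a powr (e - 1)"
      by (simp add: abs_mult mult_left_mono)
  qed (use assms in auto)
  then show ?thesis by simp
qed

text \<open>
  Near the pole \<open>0\<close> the weight itself is integrable. Near \<open>x\<close> the Lipschitz bound gains one power of \<open>|z - x|\<close>,
  which suffices since \<open>2s < 1\<close>. Elsewhere the difference is bounded and the kernel decays.
\<close>
lemma integrable_fundamental_difference:
  fixes x :: "'a::euclidean_space"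
  assumes x: "x \<noteq> 0" and s: "0 < s" "s < 1/2"
  shows "integrable lborel (\<lambda>z. (norm z powr (2 * s - real DIM('a)) - norm x powr (2 * s - real DIM('a))) * norm (z - x) powr (- (real DIM('a) + 2 * s)))"
proof -
  let ?n = "real DIM('a)"
  let ?e = "2 * s - ?n" and ?p = "?n + 2 * s"
  have n1: "?n \<ge> 1" using DIM_positive[where 'a='a] by linarith
  have e: "?e < 0" using n1 s by linarith
  define a where "a = norm x / 2"
  have a: "a > 0" "norm x = 2 * a" using x by (auto simp: a_def)
  define g where "g z = a powr (- ?p) * (indicator (ball 0 a) z * norm z powr ?e)
      + \<bar>?e\<bar> * a powr (?e - 1) * (indicator (ball 0 a) (z - x) * norm (z - x) powr (1 - ?p))
      + a powr ?e * (indicator (- ball 0 a) (z - x) * norm (z - x) powr (- ?p))" for z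
  have tr: "integrable lborel (\<lambda>z. f (z - x))" if "integrable lborel f" for f :: "'a \<Rightarrow> real"
  proof -
    have "integrable lborel (\<lambda>z. f (- x + 1 *\<^sub>R z))" using that by (subst integrable_lborel_affine) auto
    then show ?thesis by simp
  qed
  have "integrable lborel g"
    unfolding g_def
    by (intro Bochner_Integration.integrable_add integrable_mult_right integrable_norm_powr_ball
        tr[where f="\<lambda>y. indicator (ball 0 a) y * norm y powr (1 - ?p)"]
        tr[where f="\<lambda>y. indicator (- ball 0 a) y * norm y powr (- ?p)"] integrable_norm_powr_outside)
       (use s a in auto)
  then show ?thesis
  proof (rule integrable_dominated)
    fix z :: 'a
    have g0: "a powr (- ?p) * (indicator (ball 0 a) z * norm z powr ?e) \<ge> 0"
       "\<bar>?e\<bar> * a powr (?e - 1) * (indicator (ball 0 a) (z - x) * norm (z - x) powr (1 - ?p)) \<ge> 0"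
       "a powr ?e * (indicator (- ball 0 a) (z - x) * norm (z - x) powr (- ?p)) \<ge> 0"
      by auto
    have tri: "norm x \<le> norm z + norm (z - x)" using norm_triangle_ineq4[of z "z - x"] by simp
    show "norm ((norm z powr ?e - norm x powr ?e) * norm (z - x) powr (- ?p)) \<le> g z"
    proof (cases "z = 0 \<or> z = x")
      case True
      then show ?thesis 
      proof
        assume z: "z = 0"
        have "norm x powr ?e \<le> a powr ?e" using a e by (intro powr_mono2') auto
        moreover have "a powr ?e * norm x powr (- ?p) \<ge> norm x powr ?e * norm x powr (- ?p)"
          using calculation by (intro mult_right_mono) auto
        ultimately have "norm ((norm z powr ?e - norm x powr ?e) * norm (z - x) powr (- ?p)) \<le> a powr ?e * (indicator (- ball 0 a) (z - x) * norm (z - x) powr (- ?p))"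
          using z a by (simp add: abs_mult)
        then show ?thesis using g0 by (simp only: g_def)
      next
        assume "z = x" then show ?thesis using g0 by (simp add: g_def)
      qed
    next
      case False
      then have z0: "norm z > 0" "norm (z - x) > 0" by auto
      show ?thesis
      proof (cases "norm z < a")
        case True
        have d: "norm (z - x) \<ge> a" using tri True a by linarith
        have "norm x powr ?e \<le> norm z powr ?e" using z0 True a e by (intro powr_mono2') auto
        then have "\<bar>norm z powr ?e - norm x powr ?e\<bar> \<le> norm z powr ?e" by simp
        moreover have "norm (z - x) powr (- ?p) \<le> a powr (- ?p)" using d a s by (intro powr_mono2') auto
        ultimately have "\<bar>norm z powr ?e - norm x powr ?e\<bar> * norm (z - x) powr (- ?p) \<le> norm z powr ?e * a powr (- ?p)"
          by (intro mult_mono) auto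
        then have "norm ((norm z powr ?e - norm x powr ?e) * norm (z - x) powr (- ?p)) \<le> a powr (- ?p) * (indicator (ball 0 a) z * norm z powr ?e)"
          using True by (simp add: abs_mult mult.commute)
        then show ?thesis using g0 by (simp only: g_def)
      next
        case nz: False
        show ?thesis
        proof (cases "norm (z - x) < a")
          case True
          have "\<bar>norm z powr ?e - norm x powr ?e\<bar> \<le> \<bar>?e\<bar> * a powr (?e - 1) * \<bar>norm z - norm x\<bar>"
            by (rule powr_lipschitz) (use a e nz in auto)
          also have "\<dots> \<le> \<bar>?e\<bar> * a powr (?e - 1) * norm (z - x)"
            by (intro mult_left_mono norm_triangle_ineq3) auto
          finally have "\<bar>norm z powr ?e - norm x powr ?e\<bar> * norm (z - x) powr (- ?p) \<le> \<bar>?e\<bar> * a powr (?e - 1) * norm (z - x) * norm (z - x) powr (- ?p)"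
            by (intro mult_right_mono) auto
          also have "\<dots> = \<bar>?e\<bar> * a powr (?e - 1) * norm (z - x) powr (1 - ?p)"
          proof -
            have "1 - ?p = 1 + (- ?p)" by simp
            then have "norm (z - x) powr (1 - ?p) = norm (z - x) * norm (z - x) powr (- ?p)" using z0 by (simp only: powr_add powr_one)
            then show ?thesis by (simp only: mult.assoc)
          qed
          finally have "norm ((norm z powr ?e - norm x powr ?e) * norm (z - x) powr (- ?p)) \<le> \<bar>?e\<bar> * a powr (?e - 1) * (indicator (ball 0 a) (z - x) * norm (z - x) powr (1 - ?p))"
            using True by (simp add: abs_mult)
          then show ?thesis using g0 by (simp only: g_def)
        next
          case False
          have "norm z powr ?e \<le> a powr ?e" "norm x powr ?e \<le> a powr ?e"
            using nz a e by (auto intro!: powr_mono2')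
          then have "\<bar>norm z powr ?e - norm x powr ?e\<bar> \<le> a powr ?e" using powr_ge_zero[of "norm z" ?e] powr_ge_zero[of "norm x" ?e] by linarith
          then have "\<bar>norm z powr ?e - norm x powr ?e\<bar> * norm (z - x) powr (- ?p) \<le> a powr ?e * norm (z - x) powr (- ?p)"
            by (intro mult_right_mono) auto
          then have "norm ((norm z powr ?e - norm x powr ?e) * norm (z - x) powr (- ?p)) \<le> a powr ?e * (indicator (- ball 0 a) (z - x) * norm (z - x) powr (- ?p))"
            using False by (simp add: abs_mult)
          then show ?thesis using g0 by (simp only: g_def)
        qed
      qed
    qed
  qed measurable
qed

text \<open>
  The inversion with \<open>c = |x|\<^sup>2\<close> fixes \<open>x\<close>, and the weighted pullback under it maps \<open>|z|^(2s-n) - |x|^(2s-n)\<close>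
  to a negative multiple of itself, whereas covariance shows that the integral is multiplied by a positive
  number.
\<close>
lemma integral_fundamental_difference:
  fixes x :: "'a::euclidean_space"
  assumes x: "x \<noteq> 0" and s: "0 < s" "s < 1/2"
  shows "(\<integral>z. (norm z powr (2 * s - real DIM('a)) - norm x powr (2 * s - real DIM('a))) * norm (z - x) powr (- (real DIM('a) + 2 * s)) \<partial>lborel) = 0"
    (is "?I = 0")
proof -
  let ?n = "real DIM('a)"
  let ?e = "2 * s - ?n" and ?p = "?n + 2 * s"
  define c where "c = (norm x)\<^sup>2"
  have c: "c > 0" using x by (simp add: c_def)
  have fix_x: "inversion c x = x" using x by (simp add: inversion_def c_def)
  define f where "f z = norm z powr ?e - norm x powr ?e" for z :: 'a
  have [measurable]: "f \<in> borel_measurable borel" unfolding f_def by measurable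
  have K: "norm z powr ?e * f (inversion c z) = - (norm x powr ?e) * f z" if "z \<noteq> 0" for z
  proof -
    have "norm z powr ?e * (c / norm z) powr ?e = c powr ?e" using that c by (simp add: powr_divide)
    also have "\<dots> = norm x powr ?e * norm x powr ?e" by (simp add: c_def power2_eq_square powr_mult)
    finally show ?thesis by (simp add: f_def norm_inversion[OF c] algebra_simps)
  qed
  have "c powr (2 * s) * norm x powr (- ?p) * ?I = (\<integral>z. norm z powr ?e * f (inversion c z) * norm (z - x) powr (- ?p) \<partial>lborel)"
    using integral_kelvin[OF c x, of f s] by (simp add: fix_x f_def)
  also have "\<dots> = (\<integral>z. - (norm x powr ?e) * (f z * norm (z - x) powr (- ?p)) \<partial>lborel)"
  proof (rule integral_cong_AE)
    show "AE z in lborel. norm z powr ?e * f (inversion c z) * norm (z - x) powr (- ?p) = - (norm x powr ?e) * (f z * norm (z - x) powr (- ?p))"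
      using AE_lborel_singleton[of 0]
    proof eventually_elim
      case (elim z)
      show ?case using K[OF elim] by (simp only: mult.assoc[symmetric])
    qed
  qed measurable
  also have "\<dots> = - (norm x powr ?e) * ?I" by (simp only: integral_mult_right_zero f_def)
  finally have "(c powr (2 * s) * norm x powr (- ?p) + norm x powr ?e) * ?I = 0"
    unfolding distrib_right by linarith
  then have "c powr (2 * s) * norm x powr (- ?p) + norm x powr ?e = 0 \<or> ?I = 0" by (rule mult_eq_0_iff[THEN iffD1])
  moreover have "c powr (2 * s) * norm x powr (- ?p) + norm x powr ?e > 0" using c x by (intro add_pos_pos mult_pos_pos) auto
  ultimately show ?thesis by (elim disjE) (simp_all only: less_irrefl)
qed

text \<open>
  The difference \<open>w z - w x\<close> is the transform of \<open>u - u (inversion c x)\<close> plus a multiple of the difference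
  whose integral vanishes.
\<close>
lemma
  fixes u :: "'a::euclidean_space \<Rightarrow> real"
  assumes c: "c > 0" and x: "x \<noteq> 0" and s: "0 < s" "s < 1/2" and u[measurable]: "u \<in> borel_measurable borel"
    and I: "integrable lborel (\<lambda>y. (u y - u (inversion c x)) * norm (y - inversion c x) powr (- (real DIM('a) + 2 * s)))"
    and w: "\<And>z. w z = norm z powr (2 * s - real DIM('a)) * u (inversion c z)"
  shows integrable_kelvin_difference: "integrable lborel (\<lambda>z. (w z - w x) * norm (z - x) powr (- (real DIM('a) + 2 * s)))"
    and integral_kelvin_difference: "(\<integral>z. (w z - w x) * norm (z - x) powr (- (real DIM('a) + 2 * s)) \<partial>lborel)
      = c powr (2 * s) * norm x powr (- (real DIM('a) + 2 * s)) * (\<integral>y. (u y - u (inversion c x)) * norm (y - inversion c x) powr (- (real DIM('a) + 2 * s)) \<partial>lborel)"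
proof -
  let ?n = "real DIM('a)"
  let ?e = "2 * s - ?n" and ?p = "?n + 2 * s"
  define f where "f y = u y - u (inversion c x)" for y
  have fm[measurable]: "f \<in> borel_measurable borel" unfolding f_def by measurable
  have eq: "(w z - w x) * norm (z - x) powr (- ?p) = norm z powr ?e * f (inversion c z) * norm (z - x) powr (- ?p)
    + u (inversion c x) * ((norm z powr ?e - norm x powr ?e) * norm (z - x) powr (- ?p))" for z
    by (simp add: w f_def algebra_simps)
  have 1: "integrable lborel (\<lambda>z. norm z powr ?e * f (inversion c z) * norm (z - x) powr (- ?p))"
    by (rule integrable_kelvin[OF c x fm, THEN iffD2]) (use I in \<open>simp add: f_def\<close>)
  have 2: "integrable lborel (\<lambda>z. u (inversion c x) * ((norm z powr ?e - norm x powr ?e) * norm (z - x) powr (- ?p)))"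
    by (rule integrable_mult_right[OF integrable_fundamental_difference[OF x s]])
  show "integrable lborel (\<lambda>z. (w z - w x) * norm (z - x) powr (- ?p))"
    unfolding eq by (rule Bochner_Integration.integrable_add[OF 1 2])
  show "(\<integral>z. (w z - w x) * norm (z - x) powr (- ?p) \<partial>lborel)
      = c powr (2 * s) * norm x powr (- ?p) * (\<integral>y. (u y - u (inversion c x)) * norm (y - inversion c x) powr (- ?p) \<partial>lborel)"
    unfolding eq Bochner_Integration.integral_add[OF 1 2] integral_mult_right_zero
      integral_fundamental_difference[OF x s] integral_kelvin[OF c x fm]
    by (simp add: f_def)
qed

section \<open>Gamma integrals and layers of a power\<close>

lemma nn_integral_Gamma_scaled:
  fixes a \<tau> :: real
  assumes a: "a > 0" and \<tau>: "\<tau> > 0"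
  shows "(\<integral>\<^sup>+l. ennreal (indicator {0<..} l * (l powr (a - 1) * exp (- (l * \<tau>)))) \<partial>lborel) = ennreal (Gamma a * \<tau> powr (- a))"
    (is "?I = _")
proof -
  let ?f = "\<lambda>t. ennreal (indicator {0..} t * (t powr (a - 1) / exp t))"
  have "ennreal (Gamma a) = (\<integral>\<^sup>+t. ?f t \<partial>lborel)"
    using nn_integral_has_integral_lebesgue[OF _ Gamma_integral_real[OF a]] by simp
  also have "\<dots> = ennreal \<tau> * (\<integral>\<^sup>+l. ?f (0 + \<tau> * l) \<partial>lborel)"
    using \<tau> by (subst nn_integral_real_affine[of _ \<tau> 0]) auto
  also have "(\<integral>\<^sup>+l. ?f (0 + \<tau> * l) \<partial>lborel) = (\<integral>\<^sup>+l. ennreal (\<tau> powr (a - 1)) * ennreal (indicator {0<..} l * (l powr (a - 1) * exp (- (l * \<tau>)))) \<partial>lborel)"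
  proof (rule nn_integral_cong_AE)
    have "AE l in lborel. l \<noteq> (0::real)" by (rule AE_lborel_singleton)
    then show "AE l in lborel. ?f (0 + \<tau> * l) = ennreal (\<tau> powr (a - 1)) * ennreal (indicator {0<..} l * (l powr (a - 1) * exp (- (l * \<tau>))))"
    proof eventually_elim
      fix l :: real assume "l \<noteq> 0"
      then have "indicator {0..} (0 + \<tau> * l) = (indicator {0<..} l :: real)"
        using \<tau> by (auto simp: indicator_def zero_le_mult_iff)
      then show "?f (0 + \<tau> * l) = ennreal (\<tau> powr (a - 1)) * ennreal (indicator {0<..} l * (l powr (a - 1) * exp (- (l * \<tau>))))"
        using \<tau> by (cases "l > 0") (auto simp: powr_mult exp_minus field_simps simp flip: ennreal_mult)
    qed
  qed
  also have "\<dots> = ennreal (\<tau> powr (a - 1)) * ?I" by (rule nn_integral_cmult) measurable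
  finally have eq: "ennreal (Gamma a) = ennreal (\<tau> powr a) * ?I"
    using \<tau> powr_add[of \<tau> 1 "a - 1"] by (simp add: mult.assoc[symmetric] flip: ennreal_mult)
  have "ennreal (\<tau> powr (- a)) * ennreal (\<tau> powr a) = 1"
    using \<tau> by (simp flip: ennreal_mult powr_add)
  then have "?I = ennreal (\<tau> powr (- a)) * (ennreal (\<tau> powr a) * ?I)" by (simp add: mult.assoc[symmetric])
  also have "\<dots> = ennreal (Gamma a * \<tau> powr (- a))" unfolding eq[symmetric] using a
    by (simp add: ennreal_mult mult.commute Gamma_real_nonneg)
  finally show ?thesis .
qed

text \<open>
  Writing \<open>1 / (l + x)\<close> as the integral of \<open>exp (- \<tau> (l + x))\<close> over \<open>\<tau> > 0\<close> separates the variables, and two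
  Gamma integrals remain.
\<close>
lemma nn_integral_powr_over_linear:
  fixes s x :: real
  assumes s: "0 < s" "s < 1" and x: "x > 0"
  shows "(\<integral>\<^sup>+l. ennreal (indicator {0<..} l * (l powr (s - 1) / (l + x))) \<partial>lborel) = ennreal (Gamma s * Gamma (1 - s) * x powr (s - 1))"
proof -
  have "(\<integral>\<^sup>+l. ennreal (indicator {0<..} l * (l powr (s - 1) / (l + x))) \<partial>lborel)
     = (\<integral>\<^sup>+l. (\<integral>\<^sup>+\<tau>. ennreal (indicator {0<..} l * l powr (s - 1) * (indicator {0<..} \<tau> * exp (- (\<tau> * (l + x))))) \<partial>(lborel::real measure)) \<partial>(lborel::real measure))"
  proof (rule nn_integral_cong)
    fix l :: real
    show "ennreal (indicator {0<..} l * (l powr (s - 1) / (l + x)))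
      = (\<integral>\<^sup>+\<tau>. ennreal (indicator {0<..} l * l powr (s - 1) * (indicator {0<..} \<tau> * exp (- (\<tau> * (l + x))))) \<partial>lborel)"
    proof (cases "l > 0")
      case True
      have "(\<integral>\<^sup>+\<tau>. ennreal (indicator {0<..} l * l powr (s - 1) * (indicator {0<..} \<tau> * exp (- (\<tau> * (l + x))))) \<partial>lborel)
         = (\<integral>\<^sup>+\<tau>. ennreal (l powr (s - 1)) * ennreal (indicator {0<..} \<tau> * (\<tau> powr (1 - 1) * exp (- (\<tau> * (l + x))))) \<partial>lborel)"
        using True by (intro nn_integral_cong) (auto simp: ennreal_mult indicator_def)
      also have "\<dots> = ennreal (l powr (s - 1)) * (\<integral>\<^sup>+\<tau>. ennreal (indicator {0<..} \<tau> * (\<tau> powr (1 - 1) * exp (- (\<tau> * (l + x))))) \<partial>lborel)"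
        by (rule nn_integral_cmult) measurable
      also have "(\<integral>\<^sup>+\<tau>. ennreal (indicator {0<..} \<tau> * (\<tau> powr (1 - 1) * exp (- (\<tau> * (l + x))))) \<partial>lborel) = ennreal (Gamma 1 * (l + x) powr (- 1))"
        by (rule nn_integral_Gamma_scaled) (use True x in auto)
      also have "ennreal (l powr (s - 1)) * ennreal (Gamma 1 * (l + x) powr (- 1)) = ennreal (indicator {0<..} l * (l powr (s - 1) / (l + x)))"
      proof -
        have "l powr (s - 1) * (Gamma 1 * (l + x) powr (- 1)) = indicator {0<..} l * (l powr (s - 1) / (l + x))"
          using True x by (simp add: powr_minus divide_inverse)
        then show ?thesis by (subst ennreal_mult[symmetric]) (use True x in auto)
      qed
      finally show ?thesis by simp
    qed simp
  qed
  also have "\<dots> = (\<integral>\<^sup>+\<tau>. (\<integral>\<^sup>+l. ennreal (indicator {0<..} l * l powr (s - 1) * (indicator {0<..} \<tau> * exp (- (\<tau> * (l + x))))) \<partial>(lborel::real measure)) \<partial>(lborel::real measure))"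
    by (rule nn_integral_lborel_swap) measurable
  also have "\<dots> = (\<integral>\<^sup>+\<tau>. ennreal (Gamma s) * ennreal (indicator {0<..} \<tau> * (\<tau> powr ((1 - s) - 1) * exp (- (\<tau> * x)))) \<partial>(lborel::real measure))"
  proof (rule nn_integral_cong)
    fix \<tau> :: real
    show "(\<integral>\<^sup>+l. ennreal (indicator {0<..} l * l powr (s - 1) * (indicator {0<..} \<tau> * exp (- (\<tau> * (l + x))))) \<partial>lborel)
      = ennreal (Gamma s) * ennreal (indicator {0<..} \<tau> * (\<tau> powr ((1 - s) - 1) * exp (- (\<tau> * x))))"
    proof (cases "\<tau> > 0")
      case True
      have "(\<integral>\<^sup>+l. ennreal (indicator {0<..} l * l powr (s - 1) * (indicator {0<..} \<tau> * exp (- (\<tau> * (l + x))))) \<partial>lborel)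
         = (\<integral>\<^sup>+l. ennreal (exp (- (\<tau> * x))) * ennreal (indicator {0<..} l * (l powr (s - 1) * exp (- (l * \<tau>)))) \<partial>lborel)"
      proof (intro nn_integral_cong)
        fix l :: real
        have "exp (- (\<tau> * (l + x))) = exp (- (\<tau> * x)) * exp (- (l * \<tau>))" by (simp add: algebra_simps flip: exp_add)
        then show "ennreal (indicator {0<..} l * l powr (s - 1) * (indicator {0<..} \<tau> * exp (- (\<tau> * (l + x)))))
          = ennreal (exp (- (\<tau> * x))) * ennreal (indicator {0<..} l * (l powr (s - 1) * exp (- (l * \<tau>))))"
          using True by (simp flip: ennreal_mult)
      qed
      also have "\<dots> = ennreal (exp (- (\<tau> * x))) * ennreal (Gamma s * \<tau> powr (- s))"
        using True s by (subst nn_integral_cmult) (auto simp: nn_integral_Gamma_scaled)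
      also have "\<dots> = ennreal (Gamma s) * ennreal (indicator {0<..} \<tau> * (\<tau> powr ((1 - s) - 1) * exp (- (\<tau> * x))))"
        using True s by (simp flip: ennreal_mult)
      finally show ?thesis .
    qed simp
  qed
  also have "\<dots> = ennreal (Gamma s) * ennreal (Gamma (1 - s) * x powr (- (1 - s)))"
    by (subst nn_integral_cmult, measurable, subst nn_integral_Gamma_scaled) (use s x in auto)
  also have "\<dots> = ennreal (Gamma s * Gamma (1 - s) * x powr (s - 1))"
    using s by (simp add: mult.assoc flip: ennreal_mult)
  finally show ?thesis .
qed

text \<open>The logarithm is the integral of \<open>1 / (l + x)\<close> over \<open>0 \<le> x \<le> g\<close>.\<close>
lemma nn_integral_powr_log:
  fixes s g :: real
  assumes s: "0 < s" "s < 1" and g: "g > 0"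
  shows "(\<integral>\<^sup>+l. ennreal (indicator {0<..} l * (s * l powr (s - 1) * ln ((l + g) / l))) \<partial>lborel) = ennreal (Gamma s * Gamma (1 - s) * g powr s)"
proof -
  have "(\<integral>\<^sup>+l. ennreal (indicator {0<..} l * (s * l powr (s - 1) * ln ((l + g) / l))) \<partial>lborel)
     = (\<integral>\<^sup>+l. (\<integral>\<^sup>+x. ennreal (indicator {0<..} l * (s * l powr (s - 1) / (l + x)) * indicator {0..g} x) \<partial>(lborel::real measure)) \<partial>(lborel::real measure))"
  proof (rule nn_integral_cong)
    fix l :: real
    show "ennreal (indicator {0<..} l * (s * l powr (s - 1) * ln ((l + g) / l)))
       = (\<integral>\<^sup>+x. ennreal (indicator {0<..} l * (s * l powr (s - 1) / (l + x)) * indicator {0..g} x) \<partial>lborel)"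
    proof (cases "l > 0")
      case True
      have "(\<integral>\<^sup>+x. ennreal (indicator {0<..} l * (s * l powr (s - 1) / (l + x)) * indicator {0..g} x) \<partial>lborel)
        = (\<integral>\<^sup>+x. ennreal (s * l powr (s - 1)) * (ennreal (1 / (l + x)) * indicator {0..g} x) \<partial>lborel)"
        using True s by (intro nn_integral_cong) (auto simp: indicator_def simp flip: ennreal_mult)
      also have "\<dots> = ennreal (s * l powr (s - 1)) * (\<integral>\<^sup>+x. ennreal (1 / (l + x)) * indicator {0..g} x \<partial>lborel)"
        by (rule nn_integral_cmult) measurable
      also have "(\<integral>\<^sup>+x. ennreal (1 / (l + x)) * indicator {0..g} x \<partial>lborel) = ennreal (ln (l + g) - ln (l + 0))"
        by (rule nn_integral_FTC_Icc) (use True g in \<open>auto intro!: derivative_eq_intros\<close>)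
      also have "ln (l + g) - ln (l + 0) = ln ((l + g) / l)" using True g by (simp add: ln_div)
      finally show ?thesis using True s g by (simp add: ennreal_mult[symmetric])
    qed simp
  qed
  also have "\<dots> = (\<integral>\<^sup>+x. (\<integral>\<^sup>+l. ennreal (indicator {0<..} l * (s * l powr (s - 1) / (l + x)) * indicator {0..g} x) \<partial>(lborel::real measure)) \<partial>(lborel::real measure))"
    by (rule nn_integral_lborel_swap) measurable
  also have "\<dots> = (\<integral>\<^sup>+x. ennreal (s * Gamma s * Gamma (1 - s)) * ennreal (indicator {0..g} x * x powr (s - 1)) \<partial>(lborel::real measure))"
  proof (rule nn_integral_cong_AE)
    have "AE x in lborel. x \<noteq> (0::real)" by (rule AE_lborel_singleton)
    then show "AE x in lborel. (\<integral>\<^sup>+l. ennreal (indicator {0<..} l * (s * l powr (s - 1) / (l + x)) * indicator {0..g} x) \<partial>lborel)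
      = ennreal (s * Gamma s * Gamma (1 - s)) * ennreal (indicator {0..g} x * x powr (s - 1))"
    proof eventually_elim
      fix x :: real assume x0: "x \<noteq> 0"
      show "(\<integral>\<^sup>+l. ennreal (indicator {0<..} l * (s * l powr (s - 1) / (l + x)) * indicator {0..g} x) \<partial>lborel)
        = ennreal (s * Gamma s * Gamma (1 - s)) * ennreal (indicator {0..g} x * x powr (s - 1))"
      proof (cases "x \<in> {0..g}")
        case True
        then have x: "x > 0" using x0 by auto
        have "(\<integral>\<^sup>+l. ennreal (indicator {0<..} l * (s * l powr (s - 1) / (l + x)) * indicator {0..g} x) \<partial>lborel)
           = (\<integral>\<^sup>+l. ennreal s * ennreal (indicator {0<..} l * (l powr (s - 1) / (l + x))) \<partial>lborel)"
          using True s x by (intro nn_integral_cong) (auto simp: indicator_def simp flip: ennreal_mult)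
        also have "\<dots> = ennreal s * ennreal (Gamma s * Gamma (1 - s) * x powr (s - 1))"
          by (subst nn_integral_cmult, measurable, subst nn_integral_powr_over_linear) (use s x in auto)
        also have "\<dots> = ennreal (s * Gamma s * Gamma (1 - s)) * ennreal (indicator {0..g} x * x powr (s - 1))"
          using True s by (simp add: mult.assoc flip: ennreal_mult)
        finally show ?thesis .
      qed simp
    qed
  qed
  also have "\<dots> = ennreal (s * Gamma s * Gamma (1 - s)) * (\<integral>\<^sup>+x. ennreal (indicator {0..g} x * x powr (s - 1)) \<partial>lborel)"
    by (rule nn_integral_cmult) measurable
  also have "(\<integral>\<^sup>+x. ennreal (indicator {0..g} x * x powr (s - 1)) \<partial>lborel) = ennreal (g powr (s - 1 + 1) / (s - 1 + 1))"
    by (rule nn_integral_has_integral_lebesgue[OF _ has_integral_powr_from_0]) (use s g in auto)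
  also have "ennreal (s * Gamma s * Gamma (1 - s)) * ennreal (g powr (s - 1 + 1) / (s - 1 + 1)) = ennreal (Gamma s * Gamma (1 - s) * g powr s)"
    using s by (simp flip: ennreal_mult)
  finally show ?thesis .
qed

lemma has_bochner_integral_powr_log:
  fixes s g :: real
  assumes s: "0 < s" "s < 1" and g: "g > 0"
  shows "has_bochner_integral lborel (\<lambda>l. indicator {0<..} l * (s * l powr (s - 1) * ln ((l + g) / l))) (Gamma s * Gamma (1 - s) * g powr s)"
proof (rule has_bochner_integral_nn_integral)
  show "AE l in lborel. 0 \<le> indicator {0<..} l * (s * l powr (s - 1) * ln ((l + g) / l))"
    using s g by (intro AE_I2) (auto simp: indicator_def)
  show "0 \<le> Gamma s * Gamma (1 - s) * g powr s" using s by simp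
qed (use nn_integral_powr_log[OF assms] in auto)

lemma has_bochner_integral_powr_layer:
  fixes s X :: real
  assumes s: "0 < s"
  shows "has_bochner_integral lborel (\<lambda>l. indicator {0<..} l * (s * l powr (s - 1)) * of_bool (l < X)) (max 0 X powr s)"
proof (cases "X > 0")
  case True
  have "has_bochner_integral lborel (\<lambda>l. s * (indicator {0..X} l * l powr (s - 1))) (s * (X powr (s - 1 + 1) / (s - 1 + 1)))"
  proof (intro has_bochner_integral_mult_right has_bochner_integral_nn_integral)
    show "(\<integral>\<^sup>+x. ennreal (indicator {0..X} x * x powr (s - 1)) \<partial>lborel) = ennreal (X powr (s - 1 + 1) / (s - 1 + 1))"
      by (rule nn_integral_has_integral_lebesgue[OF _ has_integral_powr_from_0]) (use s True in auto)
  qed (use s in auto)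
  moreover have "AE l in lborel. s * (indicator {0..X} l * l powr (s - 1)) = indicator {0<..} l * (s * l powr (s - 1)) * of_bool (l < X)"
    using AE_lborel_singleton[of 0] AE_lborel_singleton[of X]
    by eventually_elim (auto simp: indicator_def)
  ultimately show ?thesis using s True
    by (subst has_bochner_integral_cong_AE[symmetric, of "\<lambda>l. s * (indicator {0..X} l * l powr (s - 1))"]) auto
next
  case False
  then have "(\<lambda>l. indicator {0<..} l * (s * l powr (s - 1)) * of_bool (l < X)) = (\<lambda>l. 0)"
    by (auto simp: indicator_def fun_eq_iff)
  then show ?thesis using False s by (simp add: has_bochner_integral_zero)
qed

lemma has_bochner_integral_log_layer:
  fixes A B :: real
  assumes A: "A > 0" and B: "B > 0"
  shows "has_bochner_integral lborel (\<lambda>t. indicator {0<..} t * (1 / t) * (of_bool (t < A) - of_bool (t < B))) (ln (A / B))"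
proof -
  have *: "has_bochner_integral lborel (\<lambda>t. indicator {0<..} t * (1 / t) * (of_bool (t < A) - of_bool (t < B))) (ln (A / B))"
    if A: "A > 0" and B: "B > 0" and le: "B \<le> A" for A B :: real
  proof (rule has_bochner_integral_nn_integral)
    show "AE t in lborel. 0 \<le> indicator {0<..} t * (1 / t) * (of_bool (t < A) - of_bool (t < B) :: real)"
      using le by (intro AE_I2) (auto simp: indicator_def)
    have "(\<integral>\<^sup>+t. ennreal (indicator {0<..} t * (1 / t) * (of_bool (t < A) - of_bool (t < B))) \<partial>lborel)
       = (\<integral>\<^sup>+t. ennreal (1 / t) * indicator {B..A} t \<partial>lborel)"
    proof (rule nn_integral_cong_AE)
      show "AE t in lborel. ennreal (indicator {0<..} t * (1 / t) * (of_bool (t < A) - of_bool (t < B))) = ennreal (1 / t) * indicator {B..A} t"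
        using AE_lborel_singleton[of A]
        by eventually_elim (use le B in \<open>auto simp: indicator_def\<close>)
    qed
    also have "\<dots> = ennreal (ln A - ln B)"
      by (rule nn_integral_FTC_Icc) (use A B le in \<open>auto intro!: derivative_eq_intros\<close>)
    finally show "(\<integral>\<^sup>+t. ennreal (indicator {0<..} t * (1 / t) * (of_bool (t < A) - of_bool (t < B))) \<partial>lborel) = ennreal (ln (A / B))"
      using A B by (simp add: ln_div)
  qed (use that in auto)
  show ?thesis
  proof (cases "B \<le> A")
    case True then show ?thesis by (rule *[OF A B])
  next
    case False
    then have "has_bochner_integral lborel (\<lambda>t. - (indicator {0<..} t * (1 / t) * (of_bool (t < B) - of_bool (t < A)))) (- ln (B / A))"
      by (intro has_bochner_integral_minus *[OF B A]) simp
    then show ?thesis using A B by (simp add: ln_div algebra_simps)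
  qed
qed

text \<open>
  By concavity, among the chords of \<open>t \<mapsto> t\<^sup>s\<close> that start at \<open>\<alpha>\<close> the one to \<open>0\<close>, with slope \<open>\<alpha>^(s-1)\<close>, is the
  steepest.
\<close>
lemma powr_difference_bound:
  fixes \<alpha> s X :: real
  assumes \<alpha>: "\<alpha> > 0" and s: "0 < s" "s < 1"
  shows "\<bar>max 0 X powr s - \<alpha> powr s\<bar> \<le> \<alpha> powr (s - 1) * \<bar>X - \<alpha>\<bar>"
proof -
  define x where "x = max 0 X / \<alpha>"
  have x: "x \<ge> 0" "max 0 X = \<alpha> * x" using \<alpha> by (auto simp: x_def)
  have "\<bar>x powr s - 1\<bar> \<le> \<bar>x - 1\<bar>"
  proof (cases "x \<ge> 1")
    case True
    have "x powr s \<le> x powr 1" using True s by (intro powr_mono) auto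
    moreover have "1 \<le> x powr s" using True s by (intro ge_one_powr_ge_zero) auto
    ultimately show ?thesis using True by simp
  next
    case False
    have "x powr 1 \<le> x powr s" using False s x by (intro powr_mono') auto
    moreover have "x powr s \<le> 1" using False s x by (intro powr_le1) auto
    ultimately show ?thesis using False x by simp
  qed
  then have "\<alpha> powr s * \<bar>x powr s - 1\<bar> \<le> \<alpha> powr s * \<bar>x - 1\<bar>" by (intro mult_left_mono) auto
  also have "\<alpha> powr s * \<bar>x - 1\<bar> = \<alpha> powr (s - 1) * \<bar>\<alpha> * x - \<alpha>\<bar>"
  proof -
    have "\<alpha> powr s = \<alpha> powr (s - 1) * \<alpha>" using \<alpha> by (simp add: powr_diff)
    moreover have "\<alpha> * \<bar>x - 1\<bar> = \<bar>\<alpha> * x - \<alpha>\<bar>"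
    proof -
      have "\<alpha> * x - \<alpha> = \<alpha> * (x - 1)" by (simp add: right_diff_distrib)
      then show ?thesis using \<alpha> by (simp add: abs_mult)
    qed
    ultimately show ?thesis by (simp add: mult.assoc)
  qed
  also have "\<alpha> powr s * \<bar>x powr s - 1\<bar> = \<bar>max 0 X powr s - \<alpha> powr s\<bar>"
  proof -
    have "max 0 X powr s = \<alpha> powr s * x powr s" unfolding x(2) using \<alpha> x(1) by (simp add: powr_mult)
    then have "max 0 X powr s - \<alpha> powr s = \<alpha> powr s * (x powr s - 1)" by (simp add: algebra_simps)
    then show ?thesis by (simp add: abs_mult)
  qed
  also have "\<alpha> powr (s - 1) * \<bar>\<alpha> * x - \<alpha>\<bar> \<le> \<alpha> powr (s - 1) * \<bar>X - \<alpha>\<bar>"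
    unfolding x(2)[symmetric] using \<alpha> by (intro mult_left_mono) auto
  finally show ?thesis .
qed

section \<open>The difference integral of a truncated quadratic on a line\<close>

text \<open>The positive root of \<open>q t\<^sup>2 = \<alpha> + \<beta> t\<close>.\<close>
definition pos_root :: "real \<Rightarrow> real \<Rightarrow> real \<Rightarrow> real" where
  "pos_root \<alpha> \<beta> q = (\<beta> + sqrt (\<beta>\<^sup>2 + 4 * \<alpha> * q)) / (2 * q)"

text \<open>
  The root for \<open>- \<beta>\<close> is the negative of the other root of the same quadratic, hence Vieta's formula for the
  product. It does not involve \<open>\<beta>\<close>, and this is why the fractional Laplacian of the profile is constant
  inside the ellipsoid.
\<close>
lemma
  assumes \<alpha>: "\<alpha> > 0" and q: "q > 0"
  shows pos_root_pos: "pos_root \<alpha> \<beta> q > 0"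
    and pos_root_product: "pos_root \<alpha> \<beta> q * pos_root \<alpha> (- \<beta>) q = \<alpha> / q"
    and less_pos_root: "t > 0 \<Longrightarrow> q * t\<^sup>2 < \<alpha> + \<beta> * t \<longleftrightarrow> t < pos_root \<alpha> \<beta> q"
proof -
  define S where "S = sqrt (\<beta>\<^sup>2 + 4 * \<alpha> * q)"
  have S2: "S\<^sup>2 = \<beta>\<^sup>2 + 4 * \<alpha> * q" using \<alpha> q by (simp add: S_def)
  have "\<beta>\<^sup>2 < S\<^sup>2" unfolding S2 using \<alpha> q by simp
  then have "\<bar>\<beta>\<bar> < S" using \<alpha> q by (intro power2_less_imp_less[of "\<bar>\<beta>\<bar>" S]) (auto simp: S_def)
  then have S: "\<beta> + S > 0" "S - \<beta> > 0" by linarith+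
  show "pos_root \<alpha> \<beta> q > 0" using S q by (simp add: pos_root_def S_def)
  have "(\<beta> + S) * (- \<beta> + S) = 4 * \<alpha> * q" using S2 by (simp add: algebra_simps power2_eq_square)
  then have "(\<beta> + S) / (2 * q) * ((- \<beta> + S) / (2 * q)) = \<alpha> / q" using q by (simp add: field_simps)
  then show "pos_root \<alpha> \<beta> q * pos_root \<alpha> (- \<beta>) q = \<alpha> / q" by (simp add: pos_root_def S_def)
  assume t: "t > 0"
  define T where "T = pos_root \<alpha> \<beta> q"
  define U where "U = (S - \<beta>) / (2 * q)"
  have T: "T = (\<beta> + S) / (2 * q)" by (simp add: T_def pos_root_def S_def)
  have "T - U = \<beta> / q" using q by (simp add: T U_def field_simps)
  moreover have "T * U = \<alpha> / q" using S2 q by (simp add: T U_def field_simps power2_eq_square)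
  ultimately have e: "q * (T - U) = \<beta>" "q * (T * U) = \<alpha>" using q by auto
  have "q * t\<^sup>2 - \<alpha> - \<beta> * t = q * ((t - T) * (t + U))"
    unfolding e[symmetric] by (simp add: algebra_simps power2_eq_square)
  moreover have "t + U > 0" using t S q by (simp add: U_def add_pos_pos)
  ultimately have "q * t\<^sup>2 - \<alpha> - \<beta> * t < 0 \<longleftrightarrow> t - T < 0"
    using q by (simp add: mult_less_0_iff)
  then show "q * t\<^sup>2 < \<alpha> + \<beta> * t \<longleftrightarrow> t < pos_root \<alpha> \<beta> q" by (auto simp: T_def)
qed

abbreviation ray_diff :: "real \<Rightarrow> real \<Rightarrow> real \<Rightarrow> real \<Rightarrow> real \<Rightarrow> real" where
  "ray_diff s \<alpha> \<beta> \<gamma> t \<equiv> indicator {0<..} t * ((max 0 (\<alpha> + \<beta> * t - \<gamma> * t\<^sup>2) powr s - \<alpha> powr s) * t powr (- 1 - 2 * s))"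

text \<open>
  At level \<open>l\<close> the layers of the two powers in \<open>ray_diff\<close> end at \<open>pos_root \<alpha> \<beta> (\<gamma> + l)\<close> and at \<open>sqrt (\<alpha> / l)\<close>.
\<close>
abbreviation ray_layer :: "real \<Rightarrow> real \<Rightarrow> real \<Rightarrow> real \<Rightarrow> real \<Rightarrow> real" where
  "ray_layer s \<alpha> \<beta> \<gamma> l \<equiv> indicator {0<..} l * (s * l powr (s - 1)) * ln (pos_root \<alpha> \<beta> (\<gamma> + l) / sqrt (\<alpha> / l))"

lemma integrable_ray_difference:
  fixes \<alpha> \<beta> \<gamma> s :: real
  assumes \<alpha>: "\<alpha> > 0" and \<gamma>: "\<gamma> > 0" and s: "0 < s" "s < 1/2"
  shows "integrable lborel (\<lambda>t. ray_diff s \<alpha> \<beta> \<gamma> t)"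
proof -
  \<comment> \<open>\<open>\<alpha> + \<beta>\<^sup>2 / (4 \<gamma>)\<close> is the maximum of the quadratic.\<close>
  define M where "M = (\<alpha> + \<beta>\<^sup>2 / (4 * \<gamma>)) powr s"
  define C where "C = \<alpha> powr (s - 1) * (\<bar>\<beta>\<bar> + \<gamma>)"
  define g where "g t = C * (indicator (ball 0 1) t * norm t powr (- 2 * s)) + M * (indicator (- ball 0 1) t * norm t powr (- 1 - 2 * s))" for t :: real
  have "integrable lborel g" unfolding g_def
    by (intro Bochner_Integration.integrable_add integrable_mult_right integrable_norm_powr_ball integrable_norm_powr_outside) (use s in auto)
  then show ?thesis
  proof (rule integrable_dominated)
    fix t :: real
    let ?h = "\<alpha> + \<beta> * t - \<gamma> * t\<^sup>2"
    have C0: "C \<ge> 0" and M0: "M \<ge> 0" using \<gamma> by (auto simp: C_def M_def)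
    then have g0: "g t \<ge> 0" by (simp add: g_def)
    show "norm (ray_diff s \<alpha> \<beta> \<gamma> t) \<le> g t"
    proof (cases "t > 0")
      case True
      show ?thesis
      proof (cases "t < 1")
        case t1: True
        have "\<bar>max 0 ?h powr s - \<alpha> powr s\<bar> \<le> \<alpha> powr (s - 1) * \<bar>?h - \<alpha>\<bar>"
          by (rule powr_difference_bound) (use \<alpha> s in auto)
        also have "\<bar>?h - \<alpha>\<bar> \<le> (\<bar>\<beta>\<bar> + \<gamma>) * t"
        proof -
          have "\<bar>?h - \<alpha>\<bar> \<le> \<bar>\<beta> * t\<bar> + \<bar>\<gamma> * t\<^sup>2\<bar>" by linarith
          also have "\<dots> = \<bar>\<beta>\<bar> * t + \<gamma> * t * t" using True \<gamma> by (simp add: abs_mult power2_eq_square)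
          also have "\<gamma> * t * t \<le> \<gamma> * t * 1" using True t1 \<gamma> by (intro mult_left_mono) auto
          finally show ?thesis by (simp add: algebra_simps)
        qed
        finally have "\<bar>max 0 ?h powr s - \<alpha> powr s\<bar> \<le> C * t" using \<alpha> by (simp add: C_def mult.assoc mult_left_mono)
        then have "\<bar>max 0 ?h powr s - \<alpha> powr s\<bar> * t powr (- 1 - 2 * s) \<le> C * t * t powr (- 1 - 2 * s)"
          by (intro mult_right_mono) auto
        also have "t * t powr (- 1 - 2 * s) = t powr (- 2 * s)"
        proof -
          have "t powr (1 + (- 1 - 2 * s)) = t * t powr (- 1 - 2 * s)" using True by (simp only: powr_add powr_one less_imp_le)
          then show ?thesis by simp
        qed
        then have "C * t * t powr (- 1 - 2 * s) = C * t powr (- 2 * s)" by (simp only: mult.assoc)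
        finally show ?thesis using True t1 by (simp add: g_def abs_mult)
      next
        case t1: False
        have "?h \<le> \<alpha> + \<beta>\<^sup>2 / (4 * \<gamma>)"
        proof -
          have "0 \<le> (2 * \<gamma> * t - \<beta>)\<^sup>2 / (4 * \<gamma>)" using \<gamma> by simp
          also have "\<dots> = \<beta>\<^sup>2 / (4 * \<gamma>) - \<beta> * t + \<gamma> * t\<^sup>2" using \<gamma> by (simp add: field_simps power2_eq_square)
          finally show ?thesis by linarith
        qed
        moreover have "\<beta>\<^sup>2 / (4 * \<gamma>) \<ge> 0" using \<gamma> by simp
        ultimately have "max 0 ?h powr s \<le> M" "\<alpha> powr s \<le> M"
          unfolding M_def using \<alpha> s by (auto intro!: powr_mono2)
        then have "\<bar>max 0 ?h powr s - \<alpha> powr s\<bar> \<le> M" using powr_ge_zero[of "max 0 ?h" s] powr_ge_zero[of \<alpha> s] by linarith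
        then have "\<bar>max 0 ?h powr s - \<alpha> powr s\<bar> * t powr (- 1 - 2 * s) \<le> M * t powr (- 1 - 2 * s)"
          by (intro mult_right_mono) auto
        then show ?thesis using True t1 by (simp add: g_def abs_mult)
      qed
    qed (use g0 in simp)
  qed measurable
qed

text \<open>
  After division by \<open>t^(2s)\<close> the two powers are integrals of \<open>s l^(s-1)\<close> over the levels \<open>l\<close> with
  \<open>l t\<^sup>2 < \<alpha> + \<beta> t - \<gamma> t\<^sup>2\<close> and with \<open>l t\<^sup>2 < \<alpha>\<close>. For fixed \<open>l\<close> the positive solutions \<open>t\<close> form two intervals
  from \<open>0\<close> to a root, and \<open>dt / t\<close> measures their difference by a logarithm.
\<close>
lemma
  fixes \<alpha> \<beta> \<gamma> s :: real
  assumes \<alpha>: "\<alpha> > 0" and \<gamma>: "\<gamma> > 0" and s: "0 < s" "s < 1/2"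
  shows integrable_ray_layers: "integrable lborel (\<lambda>l. ray_layer s \<alpha> \<beta> \<gamma> l)"
    and integral_ray_layers: "(\<integral>t. ray_diff s \<alpha> \<beta> \<gamma> t \<partial>lborel)
      = (\<integral>l. ray_layer s \<alpha> \<beta> \<gamma> l \<partial>lborel)"
proof -
  define I where "I t = ray_diff s \<alpha> \<beta> \<gamma> t" for t
  define X where "X t = (\<alpha> + \<beta> * t - \<gamma> * t\<^sup>2) / t\<^sup>2" for t
  define Y where "Y t = \<alpha> / t\<^sup>2" for t
  define w where "w l = indicator {0<..} l * (s * l powr (s - 1))" for l :: real
  define D where "D t l = indicator {0<..} t * (1 / t) * (w l * of_bool (l < X t) - w l * of_bool (l < Y t))" for t l :: real
  have w0: "w l \<ge> 0" for l using s by (simp add: w_def)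
  have layer: "has_bochner_integral lborel (\<lambda>l. w l * of_bool (l < Z)) (max 0 Z powr s)" for Z
    unfolding w_def by (rule has_bochner_integral_powr_layer[OF s(1)])
  have DI: "has_bochner_integral lborel (D t) (I t)" for t
  proof -
    have "has_bochner_integral lborel (D t) (indicator {0<..} t * (1 / t) * (max 0 (X t) powr s - max 0 (Y t) powr s))"
      unfolding D_def by (intro has_bochner_integral_mult_right has_bochner_integral_diff layer)
    also have "indicator {0<..} t * (1 / t) * (max 0 (X t) powr s - max 0 (Y t) powr s) = I t"
    proof (cases "t > 0")
      case True
      have sc: "max 0 (Z / t\<^sup>2) powr s * (1 / t) = max 0 Z powr s * t powr (- 1 - 2 * s)" for Z
      proof -
        have "max 0 (Z / t\<^sup>2) = max 0 Z * t powr (- 2)" using True by (simp add: max_def powr_minus divide_inverse zero_le_mult_iff)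
        then have "max 0 (Z / t\<^sup>2) powr s = max 0 Z powr s * t powr (- 2 * s)"
          by (simp only: powr_mult powr_powr)
        moreover have "1 / t = t powr (- 1)" using True by (simp add: powr_minus divide_inverse)
        ultimately have "max 0 (Z / t\<^sup>2) powr s * (1 / t) = max 0 Z powr s * (t powr (- 2 * s) * t powr (- 1))"
          by (simp only: mult.assoc)
        also have "t powr (- 2 * s) * t powr (- 1) = t powr (- 1 - 2 * s)" unfolding powr_add[symmetric] by (simp add: algebra_simps)
        finally show ?thesis .
      qed
      have "max 0 \<alpha> = \<alpha>" using \<alpha> by simp
      then show ?thesis using True sc[of "\<alpha> + \<beta> * t - \<gamma> * t\<^sup>2"] sc[of \<alpha>]
        by (simp add: I_def X_def Y_def left_diff_distrib right_diff_distrib mult.commute)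
    qed (simp add: I_def)
    finally show ?thesis .
  qed
  have Dabs: "(\<integral>l. norm (D t l) \<partial>lborel) = norm (I t)" for t
  proof (cases "X t \<le> Y t")
    case True
    have neg: "norm (D t l) = - D t l" for l
    proof -
      have "w l * of_bool (l < X t) \<le> w l * of_bool (l < Y t)" using True w0[of l] by (intro mult_left_mono) auto
      then have "D t l \<le> 0" by (auto simp: D_def indicator_def intro!: mult_nonneg_nonpos divide_nonpos_nonneg)
      then show ?thesis by simp
    qed
    have "(\<integral>l. norm (D t l) \<partial>lborel) = - I t"
      using has_bochner_integral_integral_eq[OF DI[of t]] by (simp only: neg) simp
    moreover have "(\<integral>l. norm (D t l) \<partial>lborel) \<ge> 0" by simp
    ultimately show ?thesis by simp
  next
    case False
    have pos: "norm (D t l) = D t l" for l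
    proof -
      have "w l * of_bool (l < X t) \<ge> w l * of_bool (l < Y t)" using False w0[of l] by (intro mult_left_mono) auto
      then have "D t l \<ge> 0" by (auto simp: D_def indicator_def)
      then show ?thesis by simp
    qed
    have "(\<integral>l. norm (D t l) \<partial>lborel) = I t"
      using has_bochner_integral_integral_eq[OF DI[of t]] by (simp only: pos)
    moreover have "(\<integral>l. norm (D t l) \<partial>lborel) \<ge> 0" by simp
    ultimately show ?thesis by simp
  qed
  have II: "integrable lborel I" unfolding I_def by (rule integrable_ray_difference[OF assms])
  have Dm: "case_prod D \<in> borel_measurable (lborel \<Otimes>\<^sub>M lborel)"
    unfolding D_def w_def X_def Y_def by measurable
  have DD: "integrable (lborel \<Otimes>\<^sub>M lborel) (case_prod D)"
  proof (rule lborel_pair.Fubini_integrable[OF Dm])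
    show "integrable lborel (\<lambda>t. \<integral>l. norm (case_prod D (t, l)) \<partial>lborel)" using II by (simp add: Dabs[unfolded real_norm_def])
    show "AE t in lborel. integrable lborel (\<lambda>l. case_prod D (t, l))"
      using DI by (auto simp: has_bochner_integral_iff)
  qed
  have inner: "(\<integral>t. D t l \<partial>lborel) = ray_layer s \<alpha> \<beta> \<gamma> l" for l
  proof (cases "l > 0")
    case True
    define T where "T = pos_root \<alpha> \<beta> (\<gamma> + l)"
    define B where "B = sqrt (\<alpha> / l)"
    have T: "T > 0" unfolding T_def by (rule pos_root_pos) (use \<alpha> \<gamma> True in auto)
    have B: "B > 0" using \<alpha> True by (simp add: B_def)
    have "D t l = w l * (indicator {0<..} t * (1 / t) * (of_bool (t < T) - of_bool (t < B)))" for t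
    proof (cases "t > 0")
      case t: True
      have "l < X t \<longleftrightarrow> (\<gamma> + l) * t\<^sup>2 < \<alpha> + \<beta> * t" using t by (simp add: X_def pos_less_divide_eq algebra_simps)
      also have "\<dots> \<longleftrightarrow> t < T" unfolding T_def by (rule less_pos_root) (use \<alpha> \<gamma> True t in auto)
      finally have 1: "l < X t \<longleftrightarrow> t < T" .
      have "l < Y t \<longleftrightarrow> t\<^sup>2 < \<alpha> / l" using t True by (simp add: Y_def field_simps)
      also have "\<dots> \<longleftrightarrow> t < B" unfolding B_def using t real_sqrt_less_iff[of "t\<^sup>2" "\<alpha> / l"] by simp
      finally show ?thesis using 1 by (simp add: D_def algebra_simps)
    qed (simp add: D_def)
    then have "(\<integral>t. D t l \<partial>lborel) = w l * (\<integral>t. indicator {0<..} t * (1 / t) * (of_bool (t < T) - of_bool (t < B)) \<partial>lborel)"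
      by (simp only: integral_mult_right_zero)
    also have "\<dots> = w l * ln (T / B)"
      using has_bochner_integral_integral_eq[OF has_bochner_integral_log_layer[OF T B]] by simp
    finally show ?thesis by (simp add: w_def T_def B_def)
  qed (simp add: D_def w_def)
  show "integrable lborel (\<lambda>l. ray_layer s \<alpha> \<beta> \<gamma> l)"
    using lborel_pair.integrable_snd[OF DD] by (simp only: inner)
  have "(\<integral>l. (\<integral>t. D t l \<partial>lborel) \<partial>lborel) = (\<integral>t. (\<integral>l. D t l \<partial>lborel) \<partial>lborel)"
    by (rule lborel_pair.Fubini_integral[OF DD])
  also have "\<dots> = (\<integral>t. I t \<partial>lborel)" using has_bochner_integral_integral_eq[OF DI] by simp
  finally show "(\<integral>t. ray_diff s \<alpha> \<beta> \<gamma> t \<partial>lborel)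
      = (\<integral>l. ray_layer s \<alpha> \<beta> \<gamma> l \<partial>lborel)"
    by (simp only: inner I_def)
qed

text \<open>
  The opposite half-line has \<open>- \<beta>\<close> for \<open>\<beta>\<close>. Adding the two logarithms multiplies the roots, which leaves
  \<open>ln (l / (l + \<gamma>))\<close> at level \<open>l\<close>.
\<close>
lemma integral_line_difference:
  fixes \<alpha> \<beta> \<gamma> s :: real
  assumes \<alpha>: "\<alpha> > 0" and \<gamma>: "\<gamma> > 0" and s: "0 < s" "s < 1/2"
  shows "(\<integral>t. ray_diff s \<alpha> \<beta> \<gamma> t \<partial>lborel)
     + (\<integral>t. ray_diff s \<alpha> (- \<beta>) \<gamma> t \<partial>lborel)
    = - (Gamma s * Gamma (1 - s) * \<gamma> powr s)"
proof -
  let ?L = "\<lambda>\<beta>. ray_layer s \<alpha> \<beta> \<gamma>"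
  have eq: "?L \<beta> l + ?L (- \<beta>) l = - (indicator {0<..} l * (s * l powr (s - 1) * ln ((l + \<gamma>) / l)))" for l
  proof (cases "l > 0")
    case True
    let ?T = "pos_root \<alpha> \<beta> (\<gamma> + l)" and ?T' = "pos_root \<alpha> (- \<beta>) (\<gamma> + l)" and ?B = "sqrt (\<alpha> / l)"
    have pos: "?T > 0" "?T' > 0" "?B > 0" using \<alpha> \<gamma> True by (auto intro!: pos_root_pos)
    have prod: "?T * ?T' = \<alpha> / (\<gamma> + l)" by (rule pos_root_product) (use \<alpha> \<gamma> True in auto)
    have BB: "?B * ?B = \<alpha> / l" using \<alpha> True by simp
    have "ln (?T / ?B) + ln (?T' / ?B) = ln ((?T / ?B) * (?T' / ?B))" by (rule ln_mult_pos[symmetric]) (use pos in \<open>auto intro!: divide_pos_pos simp del: real_sqrt_gt_0_iff\<close>)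
    also have "(?T / ?B) * (?T' / ?B) = (\<alpha> / (\<gamma> + l)) / (\<alpha> / l)"
      by (simp only: times_divide_times_eq prod BB)
    also have "\<dots> = inverse ((l + \<gamma>) / l)" using \<alpha> True by (simp add: add.commute)
    also have "ln \<dots> = - ln ((l + \<gamma>) / l)" using \<gamma> True by (simp add: ln_div)
    finally have ln: "ln (?T / ?B) + ln (?T' / ?B) = - ln ((l + \<gamma>) / l)" .
    have "?L \<beta> l + ?L (- \<beta>) l = s * l powr (s - 1) * (ln (?T / ?B) + ln (?T' / ?B))"
      using True by (simp add: distrib_left)
    then show ?thesis unfolding ln using True by simp
  qed simp
  have "(\<integral>l. ?L \<beta> l \<partial>lborel) + (\<integral>l. ?L (- \<beta>) l \<partial>lborel) = (\<integral>l. ?L \<beta> l + ?L (- \<beta>) l \<partial>lborel)"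
    by (rule Bochner_Integration.integral_add[symmetric]) (rule integrable_ray_layers[OF assms])+
  also have "\<dots> = - (Gamma s * Gamma (1 - s) * \<gamma> powr s)"
    unfolding eq using has_bochner_integral_integral_eq[OF has_bochner_integral_powr_log[of s \<gamma>]] s \<gamma> by simp
  finally show ?thesis by (simp only: integral_ray_layers[OF assms])
qed

section \<open>The difference integral of the ellipsoid profile\<close>

abbreviation quad_form :: "real ^ 'n \<Rightarrow> real ^ 'n \<Rightarrow> real" where
  "quad_form a v \<equiv> (\<Sum>i\<in>UNIV. a $ i * (v $ i)\<^sup>2)"

definition ellipsoid_profile :: "real ^ 'n \<Rightarrow> real \<Rightarrow> real ^ 'n \<Rightarrow> real" where
  "ellipsoid_profile a s y = max 0 (1 - quad_form a y) powr s"

text \<open>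
  Half the integral of \<open>(\<Sum> a\<^sub>i \<theta>\<^sub>i\<^sup>2)\<^sup>s\<close> over the unit sphere: the exponent of the norm makes the radial part
  of the integrand equal to \<open>dr / r\<close>.
\<close>
definition ellipsoid_constant :: "real ^ 'n \<Rightarrow> real \<Rightarrow> real" where
  "ellipsoid_constant a s = (\<integral>v. indicator annulus v * norm v powr (- (real CARD('n) + 2 * s)) * quad_form a v powr s \<partial>lborel) / (2 * ln 2)"

lemma ellipsoid_profile_measurable [measurable]: "ellipsoid_profile a s \<in> borel_measurable borel"
  unfolding ellipsoid_profile_def[abs_def] by measurable

lemma quadratic_form_pos:
  fixes a v :: "real ^ 'n"
  assumes a: "\<And>i. a $ i > 0" and v: "v \<noteq> 0"
  shows "quad_form a v > 0"
proof -
  obtain i where "v $ i \<noteq> 0" using v by (auto simp: vec_eq_iff)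
  then have "a $ i * (v $ i)\<^sup>2 > 0" using a[of i] by simp
  then show ?thesis using a by (intro sum_pos2[of UNIV i]) (auto simp: less_imp_le)
qed

lemma integrable_ellipsoid_difference:
  fixes a \<xi> :: "real ^ 'n"
  assumes a: "\<And>i. a $ i > 0" and \<xi>: "quad_form a \<xi> < 1" and s: "0 < s" "s < 1/2"
  shows "integrable lborel (\<lambda>y. (ellipsoid_profile a s (\<xi> + y) - ellipsoid_profile a s \<xi>) * norm y powr (- (real CARD('n) + 2 * s)))"
proof -
  let ?p = "real CARD('n) + 2 * s"
  define \<alpha> where "\<alpha> = 1 - quad_form a \<xi>"
  define C where "C = \<alpha> powr (s - 1) * (\<Sum>i\<in>UNIV. a $ i * (2 * \<bar>\<xi> $ i\<bar> + 1))"
  have \<alpha>: "\<alpha> > 0" using \<xi> by (simp add: \<alpha>_def)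
  have C0: "C \<ge> 0" unfolding C_def using a by (intro mult_nonneg_nonneg sum_nonneg) (auto simp: less_imp_le)
  have u\<xi>: "ellipsoid_profile a s \<xi> = \<alpha> powr s" using \<alpha> by (simp add: ellipsoid_profile_def \<alpha>_def)
  have u01: "0 \<le> ellipsoid_profile a s y \<and> ellipsoid_profile a s y \<le> 1" for y
  proof -
    have "quad_form a y \<ge> 0" using a by (intro sum_nonneg) (auto simp: less_imp_le)
    then have "max 0 (1 - quad_form a y) powr s \<le> 1" using s by (intro powr_le1) auto
    then show ?thesis by (simp add: ellipsoid_profile_def)
  qed
  define g where "g y = C * (indicator (ball 0 1) y * norm y powr (1 - ?p)) + indicator (- ball 0 1) y * norm y powr (- ?p)" for y :: "real ^ 'n"
  have "integrable lborel g" unfolding g_def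
    by (intro Bochner_Integration.integrable_add integrable_mult_right integrable_norm_powr_ball integrable_norm_powr_outside) (use s in auto)
  then show ?thesis
  proof (rule integrable_dominated)
    fix y :: "real ^ 'n"
    let ?d = "\<bar>ellipsoid_profile a s (\<xi> + y) - ellipsoid_profile a s \<xi>\<bar>"
    have g0: "g y \<ge> 0" using C0 by (simp add: g_def)
    have "?d * norm y powr (- ?p) \<le> g y"
    proof (cases "norm y < 1")
      case True
      show ?thesis
      proof (cases "y = 0")
        case False
        have "?d \<le> \<alpha> powr (s - 1) * \<bar>(1 - quad_form a (\<xi> + y)) - \<alpha>\<bar>"
          unfolding u\<xi> unfolding ellipsoid_profile_def by (rule powr_difference_bound) (use \<alpha> s in auto)
        also have "(1 - quad_form a (\<xi> + y)) - \<alpha> = - (\<Sum>i\<in>UNIV. a $ i * (2 * \<xi> $ i * y $ i + (y $ i)\<^sup>2))"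
          by (simp add: \<alpha>_def power2_sum algebra_simps sum.distrib)
        also have "\<bar>\<dots>\<bar> \<le> (\<Sum>i\<in>UNIV. a $ i * (2 * \<bar>\<xi> $ i\<bar> + 1)) * norm y"
          unfolding abs_minus sum_distrib_right
        proof (rule order_trans[OF sum_abs], rule sum_mono)
          fix i
          have yi: "\<bar>y $ i\<bar> \<le> norm y" by (rule component_le_norm_cart)
          have "(y $ i)\<^sup>2 = \<bar>y $ i\<bar> * \<bar>y $ i\<bar>" by (simp add: power2_eq_square)
          also have "\<dots> \<le> 1 * norm y" using yi True by (intro mult_mono) auto
          finally have y2: "(y $ i)\<^sup>2 \<le> norm y" by simp
          have "\<bar>2 * \<xi> $ i * y $ i + (y $ i)\<^sup>2\<bar> \<le> 2 * \<bar>\<xi> $ i\<bar> * \<bar>y $ i\<bar> + (y $ i)\<^sup>2"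
            by (rule order_trans[OF abs_triangle_ineq]) (simp add: abs_mult)
          also have "\<dots> \<le> 2 * \<bar>\<xi> $ i\<bar> * norm y + norm y" using yi y2 by (intro add_mono mult_left_mono) auto
          finally have "\<bar>2 * \<xi> $ i * y $ i + (y $ i)\<^sup>2\<bar> \<le> (2 * \<bar>\<xi> $ i\<bar> + 1) * norm y" by (simp add: distrib_right)
          then show "\<bar>a $ i * (2 * \<xi> $ i * y $ i + (y $ i)\<^sup>2)\<bar> \<le> a $ i * (2 * \<bar>\<xi> $ i\<bar> + 1) * norm y"
            using a[of i] by (simp add: abs_mult mult.assoc mult_left_mono)
        qed
        finally have "?d \<le> C * norm y" by (simp add: C_def mult.assoc mult_left_mono)
        then have "?d * norm y powr (- ?p) \<le> C * norm y * norm y powr (- ?p)" by (intro mult_right_mono) auto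
        also have "\<dots> = C * norm y powr (1 - ?p)"
        proof -
          have "1 - ?p = 1 + (- ?p)" by simp
          then have "norm y powr (1 - ?p) = norm y * norm y powr (- ?p)" using False by (simp only: powr_add powr_one norm_ge_zero)
          then show ?thesis by (simp only: mult.assoc)
        qed
        finally show ?thesis using True by (simp add: g_def)
      qed (use g0 in simp)
    next
      case False
      have "?d \<le> 1" using u01[of "\<xi> + y"] u01[of \<xi>] by linarith
      then have "?d * norm y powr (- ?p) \<le> 1 * norm y powr (- ?p)" by (intro mult_right_mono) auto
      then show ?thesis using False by (simp add: g_def)
    qed
    then show "norm ((ellipsoid_profile a s (\<xi> + y) - ellipsoid_profile a s \<xi>) * norm y powr (- ?p)) \<le> g y" by (simp add: abs_mult)
  qed measurable
qed

lemma integral_reflect_lborel: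
  fixes f :: "'a::euclidean_space \<Rightarrow> real"
  assumes "f \<in> borel_measurable borel"
  shows "integrable lborel (\<lambda>x. f (- x)) \<longleftrightarrow> integrable lborel f" "(\<integral>x. f (- x) \<partial>lborel) = (\<integral>x. f x \<partial>lborel)"
  using integrable_lborel_affine[OF _ assms, of "-1" 0] integral_lborel_affine[OF _ assms, of "-1" 0] by simp_all

text \<open>
  Along rays from \<open>\<xi>\<close> the integrand is the truncated quadratic of the previous section; the directions \<open>v\<close>
  and \<open>- v\<close> together make up a full line. Since \<open>\<xi>\<close> enters only through \<open>\<alpha>\<close> and \<open>\<beta>\<close>, it drops out.
\<close>
lemma integral_ellipsoid_difference:
  fixes a \<xi> :: "real ^ 'n"
  assumes a: "\<And>i. a $ i > 0" and \<xi>: "quad_form a \<xi> < 1" and s: "0 < s" "s < 1/2"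
  shows "(\<integral>y. (ellipsoid_profile a s (\<xi> + y) - ellipsoid_profile a s \<xi>) * norm y powr (- (real CARD('n) + 2 * s)) \<partial>lborel)
     = - (Gamma s * Gamma (1 - s) * ellipsoid_constant a s)"
proof -
  let ?n = "CARD('n)"
  let ?p = "real ?n + 2 * s"
  define \<alpha> where "\<alpha> = 1 - quad_form a \<xi>"
  define \<beta> where "\<beta> v = - 2 * (\<Sum>i\<in>UNIV. a $ i * \<xi> $ i * v $ i)" for v
  define \<gamma> where "\<gamma> v = quad_form a v" for v
  have \<alpha>: "\<alpha> > 0" using \<xi> by (simp add: \<alpha>_def)
  have u\<xi>: "ellipsoid_profile a s \<xi> = \<alpha> powr s" using \<alpha> by (simp add: ellipsoid_profile_def \<alpha>_def)
  define f where "f y = (ellipsoid_profile a s (\<xi> + y) - ellipsoid_profile a s \<xi>) * norm y powr (- ?p)" for y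
  have fI: "integrable lborel f" unfolding f_def by (rule integrable_ellipsoid_difference[OF assms])
  define J where "J v = (\<integral>t. ray_diff s \<alpha> (\<beta> v) (\<gamma> v) t \<partial>lborel)" for v
  define \<Psi> where "\<Psi> v = indicator annulus v * (\<integral>t. indicator {0<..} t * t ^ (?n - 1) * f (t *\<^sub>R v) \<partial>lborel)" for v
  have \<Psi>: "\<Psi> v = indicator annulus v * norm v powr (- ?p) * J v" for v
  proof -
    have "indicator {0<..} t * t ^ (?n - 1) * f (t *\<^sub>R v) = norm v powr (- ?p) * ray_diff s \<alpha> (\<beta> v) (\<gamma> v) t" for t
    proof (cases "t > 0")
      case True
      have "1 - quad_form a (\<xi> + t *\<^sub>R v) = \<alpha> + \<beta> v * t - \<gamma> v * t\<^sup>2"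
        by (simp add: \<alpha>_def \<beta>_def \<gamma>_def power2_sum algebra_simps sum.distrib sum_distrib_left sum_distrib_right power_mult_distrib sum_negf)
      then have u: "ellipsoid_profile a s (\<xi> + t *\<^sub>R v) = max 0 (\<alpha> + \<beta> v * t - \<gamma> v * t\<^sup>2) powr s" by (simp only: ellipsoid_profile_def)
      have "t ^ (?n - 1) = t powr (real ?n - 1)" using True by (simp add: powr_realpow[symmetric] of_nat_diff Suc_leI)
      then have "t ^ (?n - 1) * norm (t *\<^sub>R v) powr (- ?p) = norm v powr (- ?p) * (t powr (real ?n - 1) * t powr (- ?p))"
        using True by (simp add: powr_mult mult_ac)
      also have "t powr (real ?n - 1) * t powr (- ?p) = t powr (- 1 - 2 * s)" unfolding powr_add[symmetric] by (simp add: algebra_simps)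
      finally show ?thesis using True unfolding f_def u u\<xi> by (simp add: mult_ac) 
    qed simp
    then show ?thesis by (simp only: \<Psi>_def J_def integral_mult_right_zero mult.assoc)
  qed
  have "integrable lborel (\<lambda>v. \<integral>t. indicator annulus v * (indicator {0<..} t * t ^ (?n - 1) * f (t *\<^sub>R v)) \<partial>lborel)"
    using lborel_pair.integrable_fst'[OF integrable_rays[OF fI]] by simp
  then have \<Psi>I: "integrable lborel \<Psi>" by (simp add: \<Psi>_def[abs_def])
  have \<Psi>m: "\<Psi> \<in> borel_measurable borel" using \<Psi>I by auto
  have rays: "(\<integral>v. \<Psi> v \<partial>lborel) = ln 2 * (\<integral>y. f y \<partial>lborel)"
    using integral_rays[OF fI] by (simp add: \<Psi>_def)
  have sym: "\<Psi> v + \<Psi> (- v) = - (Gamma s * Gamma (1 - s)) * (indicator annulus v * norm v powr (- ?p) * \<gamma> v powr s)" for v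
  proof (cases "v \<in> annulus")
    case True
    then have "v \<noteq> 0" by (auto simp: annulus_def)
    then have \<gamma>: "\<gamma> v > 0" unfolding \<gamma>_def by (rule quadratic_form_pos[OF a])
    have m: "- v \<in> annulus" "\<beta> (- v) = - \<beta> v" "\<gamma> (- v) = \<gamma> v"
      using True by (auto simp: annulus_def \<beta>_def \<gamma>_def sum_negf)
    have "J v + J (- v) = - (Gamma s * Gamma (1 - s) * \<gamma> v powr s)"
      unfolding J_def m by (rule integral_line_difference[OF \<alpha> \<gamma> s])
    moreover have "\<Psi> v + \<Psi> (- v) = norm v powr (- ?p) * (J v + J (- v))"
      using True m by (simp add: \<Psi> distrib_left)
    ultimately show ?thesis using True by simp
  next
    case False
    then have "- v \<notin> annulus" by (auto simp: annulus_def)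
    then show ?thesis using False by (simp add: \<Psi>)
  qed
  have "2 * (\<integral>v. \<Psi> v \<partial>lborel) = (\<integral>v. \<Psi> v \<partial>lborel) + (\<integral>v. \<Psi> (- v) \<partial>lborel)"
    using integral_reflect_lborel(2)[OF \<Psi>m] by simp
  also have "\<dots> = (\<integral>v. \<Psi> v + \<Psi> (- v) \<partial>lborel)"
    using \<Psi>I integral_reflect_lborel(1)[OF \<Psi>m] by simp
  also have "\<dots> = - (Gamma s * Gamma (1 - s)) * (\<integral>v. indicator annulus v * norm v powr (- ?p) * \<gamma> v powr s \<partial>lborel)"
    unfolding sym by (rule integral_mult_right_zero)
  also have "\<dots> = - (Gamma s * Gamma (1 - s)) * (2 * ln 2 * ellipsoid_constant a s)"
    by (simp add: ellipsoid_constant_def \<gamma>_def)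
  finally have "ln 2 * (\<integral>y. f y \<partial>lborel) = ln 2 * (- (Gamma s * Gamma (1 - s) * ellipsoid_constant a s))"
    unfolding rays by (simp add: algebra_simps)
  then have "(\<integral>y. f y \<partial>lborel) = - (Gamma s * Gamma (1 - s) * ellipsoid_constant a s)"
    by (subst (asm) mult_left_cancel) auto
  then show ?thesis by (simp only: f_def)
qed

lemma log_quadratic_form_bounded:
  fixes a :: "real ^ 'n"
  assumes a: "\<And>i. a $ i > 0"
  shows "\<exists>L\<ge>0. \<forall>v\<in>annulus. \<bar>ln (quad_form a v)\<bar> \<le> L"
proof -
  define K where "K = cball (0 :: real ^ 'n) 2 - ball 0 1"
  have "compact K" unfolding K_def by (intro compact_diff) auto
  have "continuous_on K (\<lambda>v. ln (quad_form a v))"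
  proof (intro continuous_intros ballI)
    fix v assume "v \<in> K"
    then have "v \<noteq> 0" by (auto simp: K_def)
    then show "quad_form a v \<noteq> 0" using quadratic_form_pos[OF a] by force
  qed
  then have "bounded ((\<lambda>v. ln (quad_form a v)) ` K)"
    using \<open>compact K\<close> by (intro compact_imp_bounded compact_continuous_image)
  then obtain L where L: "L > 0" "\<And>v. v \<in> K \<Longrightarrow> \<bar>ln (quad_form a v)\<bar> \<le> L"
    unfolding bounded_pos by auto
  have "annulus \<subseteq> K" by (auto simp: annulus_def K_def)
  then show ?thesis using L by (intro exI[of _ L]) auto
qed

definition ellipsoid_constant_complex :: "real ^ 'n \<Rightarrow> complex \<Rightarrow> complex" where
  "ellipsoid_constant_complex a s = (\<integral>v. of_real (indicator annulus v) * exp (- (of_nat CARD('n) + 2 * s) * of_real (ln (norm v)) + s * of_real (ln (quad_form a v))) \<partial>lborel) / of_real (2 * ln 2)"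

lemma
  fixes a :: "real ^ 'n"
  assumes a: "\<And>i. a $ i > 0"
  shows holomorphic_ellipsoid_constant: "ellipsoid_constant_complex a holomorphic_on UNIV"
    and ellipsoid_constant_of_real: "ellipsoid_constant_complex a (of_real q) = of_real (ellipsoid_constant a q)"
    and ellipsoid_constant_pos: "ellipsoid_constant a q > 0"
proof -
  let ?n = "CARD('n)"
  define \<gamma> where "\<gamma> v = quad_form a v" for v
  have \<gamma>m[measurable]: "\<gamma> \<in> borel_measurable borel" unfolding \<gamma>_def[abs_def] by measurable
  have \<gamma>: "\<gamma> v > 0" if "v \<in> annulus" for v
    unfolding \<gamma>_def by (rule quadratic_form_pos[OF a]) (use that in \<open>auto simp: annulus_def\<close>)
  obtain L where L: "L \<ge> 0" "\<And>v. v \<in> annulus \<Longrightarrow> \<bar>ln (\<gamma> v)\<bar> \<le> L"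
    using log_quadratic_form_bounded[OF a] unfolding \<gamma>_def by blast
  define f where "f s v = of_real (indicator annulus v) * exp (- (of_nat ?n + 2 * s) * of_real (ln (norm v)) + s * of_real (ln (\<gamma> v)))" for s :: complex and v
  have hol: "(\<lambda>s. f s v) holomorphic_on UNIV" for v unfolding f_def by (intro holomorphic_intros)
  have meas: "f s \<in> borel_measurable lborel" for s unfolding f_def by measurable
  have finite: "emeasure lborel (annulus :: (real ^ 'n) set) < \<infinity>"
    by (rule emeasure_bounded_finite) (auto simp: annulus_def intro: bounded_subset[of "ball 0 2"])
  have dom: "\<exists>r>0. \<exists>g. integrable lborel g \<and> ball s0 r \<subseteq> UNIV \<and> (\<forall>z\<in>ball s0 r. \<forall>v. norm (f z v) \<le> g v)" for s0
  proof -
    define B where "B = (real ?n + 2 * (norm s0 + 1)) * ln 2 + (norm s0 + 1) * L"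
    have "norm (f z v) \<le> indicator annulus v * exp B" if z: "z \<in> ball s0 1" for z v
    proof (cases "v \<in> annulus")
      case True
      then have nv: "1 < norm v" "norm v < 2" by (auto simp: annulus_def)
      then have "ln (norm v) \<le> ln 2" by (subst ln_le_cancel_iff) auto
      then have v: "0 \<le> ln (norm v)" "ln (norm v) \<le> ln 2" using nv by auto
      have nz: "norm z \<le> norm s0 + 1" using z norm_triangle_ineq2[of z s0] by (simp add: dist_norm norm_minus_commute)
      have "norm (f z v) = exp (Re (- (of_nat ?n + 2 * z) * of_real (ln (norm v)) + z * of_real (ln (\<gamma> v))))"
        using True by (simp add: f_def)
      also have "\<dots> \<le> exp B"
      proof -
        have "Re (- (of_nat ?n + 2 * z) * of_real (ln (norm v)) + z * of_real (ln (\<gamma> v))) \<le> norm (- (of_nat ?n + 2 * z) * of_real (ln (norm v)) + z * of_real (ln (\<gamma> v)))"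
          by (rule complex_Re_le_cmod)
        also have "\<dots> \<le> norm (of_nat ?n + 2 * z) * \<bar>ln (norm v)\<bar> + norm z * \<bar>ln (\<gamma> v)\<bar>"
          by (rule order_trans[OF norm_triangle_ineq]) (simp only: norm_mult norm_minus_cancel norm_of_real order_refl)
        also have "\<dots> \<le> (real ?n + 2 * (norm s0 + 1)) * ln 2 + (norm s0 + 1) * L"
        proof (intro add_mono mult_mono)
          have "norm (of_nat ?n + 2 * z) \<le> norm (of_nat ?n :: complex) + norm (2 * z)" by (rule norm_triangle_ineq)
          also have "\<dots> = real ?n + 2 * norm z" by (simp add: norm_mult)
          also have "\<dots> \<le> real ?n + 2 * (norm s0 + 1)" using nz by (intro add_left_mono mult_left_mono) auto
          finally show "norm (of_nat ?n + 2 * z) \<le> real ?n + 2 * (norm s0 + 1)" .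
        qed (use v nz L True in auto)
        finally show ?thesis by (simp add: B_def)
      qed
      finally show ?thesis using True by simp
    qed (simp add: f_def)
    moreover have "integrable lborel (\<lambda>v :: real ^ 'n. indicator annulus v * exp B)"
      using finite by (intro integrable_mult_left integrable_real_indicator) auto
    ultimately show ?thesis by (intro exI[of _ 1] conjI exI[of _ "\<lambda>v. indicator annulus v * exp B"]) auto
  qed
  have "(\<lambda>s. \<integral>v. f s v \<partial>lborel) holomorphic_on UNIV"
    by (rule holomorphic_lebesgue_integral[OF open_UNIV hol meas dom])
  then have "(\<lambda>s. (\<integral>v. f s v \<partial>lborel) / of_real (2 * ln 2)) holomorphic_on UNIV"
    by (intro holomorphic_intros) auto
  then show "ellipsoid_constant_complex a holomorphic_on UNIV"
    unfolding ellipsoid_constant_complex_def[abs_def] f_def \<gamma>_def .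
  define h where "h v = indicator annulus v * norm v powr (- (real ?n + 2 * q)) * \<gamma> v powr q" for v
  have fq: "f (of_real q) v = of_real (h v)" for v
  proof (cases "v \<in> annulus")
    case True
    then have "norm v \<noteq> 0" "\<gamma> v \<noteq> 0" using \<gamma>[OF True] by (auto simp: annulus_def)
    then have "of_real (h v) = exp (complex_of_real (- (real ?n + 2 * q) * ln (norm v) + q * ln (\<gamma> v)))"
      using True unfolding h_def powr_def exp_of_real exp_add by simp
    then show ?thesis using True by (simp add: f_def)
  qed (simp add: f_def h_def)
  have fI: "integrable lborel (f (of_real q))" by (rule integrable_dominated_family[OF open_UNIV hol meas dom]) simp
  have hI: "integrable lborel h" using integrable_Re[OF fI] by (simp add: fq)
  show "ellipsoid_constant_complex a (of_real q) = of_real (ellipsoid_constant a q)"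
  proof -
    have "(\<integral>v. f (of_real q) v \<partial>lborel) = of_real (\<integral>v. h v \<partial>lborel)" by (simp add: fq)
    then show ?thesis by (simp add: ellipsoid_constant_complex_def ellipsoid_constant_def f_def h_def \<gamma>_def)
  qed
  have h0: "h v \<ge> 0" for v by (simp add: h_def)
  have "integral\<^sup>L lborel h \<noteq> 0"
  proof
    assume "integral\<^sup>L lborel h = 0"
    then have "AE v in lborel. h v = 0"
      using integral_nonneg_eq_0_iff_AE[OF hI] h0 by simp
    then have "AE v in lborel. v \<notin> (annulus :: (real ^ 'n) set)"
    proof eventually_elim
      case (elim v)
      show ?case
      proof
        assume v: "v \<in> annulus"
        then have "norm v > 0" by (auto simp: annulus_def)
        then have "norm v powr (- (real ?n + 2 * q)) * \<gamma> v powr q > 0"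
          using \<gamma>[OF v] less_imp_neq[OF \<gamma>[OF v]] by (intro mult_pos_pos) (auto simp: powr_gt_zero)
        then have "h v > 0" using v by (simp add: h_def)
        with elim show False by simp
      qed
    qed
    then have "(annulus :: (real ^ 'n) set) \<in> null_sets lborel"
      using AE_iff_null_sets[of "annulus :: (real ^ 'n) set" lborel] by simp
    then have "negligible (annulus :: (real ^ 'n) set)"
      by (simp add: negligible_iff_null_sets null_sets_completionI)
    moreover have "open (annulus :: (real ^ 'n) set)" unfolding annulus_def
      by (intro open_Collect_conj open_Collect_less continuous_intros)
    moreover have "(annulus :: (real ^ 'n) set) \<noteq> {}"
    proof -
      obtain v :: "real ^ 'n" where "norm v = 3/2" using vector_choose_size[of "3/2"] by auto
      then have "v \<in> annulus" by (simp add: annulus_def)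
      then show ?thesis by blast
    qed
    ultimately show False using open_not_negligible by blast
  qed
  moreover have "integral\<^sup>L lborel h \<ge> 0" using h0 by simp
  ultimately have "integral\<^sup>L lborel h > 0" by linarith
  moreover have "ellipsoid_constant a q = integral\<^sup>L lborel h / (2 * ln 2)"
    by (simp add: ellipsoid_constant_def h_def[abs_def] \<gamma>_def)
  ultimately show "ellipsoid_constant a q > 0" by simp
qed

section \<open>The transformed profile at complex order\<close>

text \<open>
  The factor \<open>(norm X)\<^sup>2\<close> turns the solution into \<open>|X|\<^sup>-\<^sup>n\<close> times the \<open>s\<close>-th power of a function without \<open>s\<close>.
\<close>
definition kelvin_base :: "real ^ 'n \<Rightarrow> real \<Rightarrow> real ^ 'n \<Rightarrow> real ^ 'n \<Rightarrow> real" where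
  "kelvin_base a c \<nu> X = (norm X)\<^sup>2 * (1 - (\<Sum>i\<in>UNIV. a $ i * (c * (X $ i / (norm X)\<^sup>2) - \<nu> $ i)\<^sup>2))"

definition kelvin_profile :: "real ^ 'n \<Rightarrow> real \<Rightarrow> real ^ 'n \<Rightarrow> complex \<Rightarrow> real ^ 'n \<Rightarrow> complex" where
  "kelvin_profile a c \<nu> s X = of_real (norm X powr (- real CARD('n)))
     * (if kelvin_base a c \<nu> X > 0 then exp (s * of_real (ln (kelvin_base a c \<nu> X))) else 0)"

lemma kelvin_base_measurable [measurable]: "kelvin_base a c \<nu> \<in> borel_measurable borel"
  unfolding kelvin_base_def[abs_def] by measurable

lemma kelvin_profile_measurable [measurable]: "kelvin_profile a c \<nu> s \<in> borel_measurable borel"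
  unfolding kelvin_profile_def[abs_def] by measurable

lemma kelvin_profile_holomorphic: "(\<lambda>s. kelvin_profile a c \<nu> s X) holomorphic_on UNIV"
  unfolding kelvin_profile_def by (cases "kelvin_base a c \<nu> X > 0") (auto intro!: holomorphic_intros)

lemma kelvin_form_base: "kelvin_base a c \<nu> (x + \<nu>) = (norm (x + \<nu>))\<^sup>2 * (1 - kelvin_form a c \<nu> x)"
  by (simp add: kelvin_base_def kelvin_form_def)

lemma Omega_iff: "x \<in> Omega a c \<nu> \<longleftrightarrow> kelvin_base a c \<nu> (x + \<nu>) > 0"
proof (cases "x = - \<nu>")
  case False
  then have "x + \<nu> \<noteq> 0" by (simp add: eq_neg_iff_add_eq_0)
  then show ?thesis using False unfolding kelvin_form_base Omega_def by (simp add: zero_less_mult_iff)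
qed (simp add: Omega_def kelvin_base_def)

lemma w_fun_kelvin_profile:
  fixes a \<nu> :: "real ^ 'n"
  shows "complex_of_real (w_fun a c \<nu> s x) = kelvin_profile a c \<nu> (of_real s) (x + \<nu>)"
proof (cases "x = - \<nu>")
  case True
  then show ?thesis by (simp add: w_fun_def kelvin_profile_def kelvin_base_def)
next
  case False
  let ?X = "x + \<nu>" and ?f = "1 - kelvin_form a c \<nu> x"
  have X: "norm ?X > 0" using False by (simp add: eq_neg_iff_add_eq_0)
  show ?thesis
  proof (cases "?f > 0")
    case True
    have P: "kelvin_base a c \<nu> ?X = (norm ?X)\<^sup>2 * ?f" "(norm ?X)\<^sup>2 * ?f > 0" using X True by (auto simp: kelvin_form_base)
    have "((norm ?X)\<^sup>2 * ?f) powr s = (norm ?X)\<^sup>2 powr s * ?f powr s" by (rule powr_mult)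
    also have "(norm ?X)\<^sup>2 powr s = norm ?X powr (2 * s)" using X by (simp flip: powr_numeral add: powr_powr)
    finally have "norm ?X powr (- real CARD('n)) * ((norm ?X)\<^sup>2 * ?f) powr s = norm ?X powr (- real CARD('n)) * norm ?X powr (2 * s) * ?f powr s"
      by (simp only: mult.assoc)
    also have "norm ?X powr (- real CARD('n)) * norm ?X powr (2 * s) = 1 / norm ?X powr (real CARD('n) - 2 * s)"
    proof -
      have "norm ?X powr (- real CARD('n)) * norm ?X powr (2 * s) = norm ?X powr (- (real CARD('n) - 2 * s))"
        unfolding powr_add[symmetric] by simp
      then show ?thesis by (simp only: powr_minus_divide)
    qed
    finally have "w_fun a c \<nu> s x = norm ?X powr (- real CARD('n)) * ((norm ?X)\<^sup>2 * ?f) powr s"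
      using False True by (simp add: w_fun_def)
    also have "((norm ?X)\<^sup>2 * ?f) powr s = exp (s * ln ((norm ?X)\<^sup>2 * ?f))"
    proof -
      have "(norm ?X)\<^sup>2 * ?f \<noteq> 0" using P(2) by linarith
      then show ?thesis by (simp only: powr_def if_False)
    qed
    finally show ?thesis using P by (simp add: kelvin_profile_def exp_of_real[symmetric])
  next
    case nf: False
    then have "\<not> kelvin_base a c \<nu> ?X > 0" by (simp add: kelvin_form_base zero_less_mult_iff)
    then show ?thesis using False nf by (simp add: w_fun_def kelvin_profile_def)
  qed
qed

text \<open>
  Where the base is positive, the image of \<open>X\<close> under inversion lies in a translate of the ellipsoid. This is a
  bounded set, so \<open>X\<close> keeps a distance from \<open>0\<close>.
\<close>
lemma kelvin_base_vanishes_near_zero: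
  fixes a \<nu> :: "real ^ 'n"
  assumes c: "c > 0" and a: "\<And>i. a $ i > 0"
  shows "\<exists>r0>0. \<forall>X. norm X < r0 \<longrightarrow> \<not> kelvin_base a c \<nu> X > 0"
proof -
  define B where "B = (\<Sum>i\<in>UNIV. \<bar>\<nu> $ i\<bar> + 1 / sqrt (a $ i))"
  have B: "B \<ge> 0" unfolding B_def using a by (intro sum_nonneg) (auto simp: less_imp_le)
  have "\<not> kelvin_base a c \<nu> X > 0" if X: "norm X < c / (B + 1)" for X
  proof
    assume P: "kelvin_base a c \<nu> X > 0"
    then have X0: "X \<noteq> 0" by (auto simp: kelvin_base_def)
    then have S: "(\<Sum>i\<in>UNIV. a $ i * (c * (X $ i / (norm X)\<^sup>2) - \<nu> $ i)\<^sup>2) < 1"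
      using P by (simp add: kelvin_base_def zero_less_mult_iff)
    have comp: "\<bar>inversion c X $ i\<bar> \<le> \<bar>\<nu> $ i\<bar> + 1 / sqrt (a $ i)" for i
    proof -
      let ?z = "c * (X $ i / (norm X)\<^sup>2)"
      have "a $ i * (?z - \<nu> $ i)\<^sup>2 \<le> (\<Sum>i\<in>UNIV. a $ i * (c * (X $ i / (norm X)\<^sup>2) - \<nu> $ i)\<^sup>2)"
        using a by (intro member_le_sum) (auto simp: less_imp_le)
      then have "a $ i * (?z - \<nu> $ i)\<^sup>2 \<le> 1" using S by linarith
      then have "(?z - \<nu> $ i)\<^sup>2 \<le> 1 / a $ i" using a[of i] by (simp add: field_simps)
      then have "sqrt ((?z - \<nu> $ i)\<^sup>2) \<le> sqrt (1 / a $ i)" by (rule real_sqrt_le_mono)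
      then have "\<bar>?z - \<nu> $ i\<bar> \<le> 1 / sqrt (a $ i)" by (simp add: real_sqrt_divide)
      moreover have "inversion c X $ i = ?z" by (simp add: inversion_def)
      ultimately show ?thesis by linarith
    qed
    have "c / norm X = norm (inversion c X)" by (simp only: norm_inversion[OF c])
    also have "\<dots> \<le> (\<Sum>i\<in>UNIV. \<bar>inversion c X $ i\<bar>)" by (rule norm_le_l1_cart)
    also have "\<dots> \<le> B" unfolding B_def by (intro sum_mono comp)
    finally have "c \<le> B * norm X" using X0 by (simp add: field_simps)
    moreover have "(B + 1) * norm X < c" using X B by (simp add: field_simps)
    ultimately show False using X0 by (simp add: distrib_right) (meson norm_ge_zero not_less order_trans add_increasing2 linorder_not_le)
  qed
  then show ?thesis using c B by (intro exI[of _ "c / (B + 1)"]) auto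
qed

lemma kelvin_profile_growth:
  fixes a \<nu> :: "real ^ 'n"
  assumes a: "\<And>i. a $ i > 0" and s: "0 < Re s"
  shows "norm (kelvin_profile a c \<nu> s X) \<le> norm X powr (2 * Re s - real CARD('n))"
proof (cases "kelvin_base a c \<nu> X > 0")
  case True
  then have X0: "norm X > 0" by (auto simp: kelvin_base_def)
  have "(\<Sum>i\<in>UNIV. a $ i * (c * (X $ i / (norm X)\<^sup>2) - \<nu> $ i)\<^sup>2) \<ge> 0"
    using a by (intro sum_nonneg) (auto simp: less_imp_le)
  then have "kelvin_base a c \<nu> X \<le> (norm X)\<^sup>2 * 1" unfolding kelvin_base_def by (intro mult_left_mono) auto
  then have "kelvin_base a c \<nu> X powr Re s \<le> (norm X)\<^sup>2 powr Re s" using True s by (intro powr_mono2) auto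
  also have "\<dots> = norm X powr (2 * Re s)" using X0 by (simp flip: powr_numeral add: powr_powr)
  finally have le: "kelvin_base a c \<nu> X powr Re s \<le> norm X powr (2 * Re s)" .
  have "norm (kelvin_profile a c \<nu> s X) = norm X powr (- real CARD('n)) * kelvin_base a c \<nu> X powr Re s"
    using True by (simp add: kelvin_profile_def norm_mult powr_def)
  also have "\<dots> \<le> norm X powr (- real CARD('n)) * norm X powr (2 * Re s)" using le by (intro mult_left_mono) auto
  also have "\<dots> = norm X powr (2 * Re s - real CARD('n))" unfolding powr_add[symmetric] by simp
  finally show ?thesis .
qed (simp add: kelvin_profile_def)

text \<open>
  Along a line \<open>X + t \<theta>\<close> both \<open>|X + t \<theta>|\<^sup>2\<close> and the base are rational functions of \<open>t\<close>. For small complex \<open>t\<close>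
  they have positive real part, uniformly in the direction \<open>\<theta>\<close> by compactness, so the principal logarithm
  defines the powers. Compactness also bounds the extension for \<open>s\<close> in a disc.
\<close>
lemma complexified_kelvin_profile:
  fixes a \<nu> X :: "real ^ 'n"
  assumes P: "kelvin_base a c \<nu> X > 0"
  shows "\<exists>R>0. \<forall>s0. \<exists>B. \<forall>s\<in>ball s0 1. \<forall>\<theta>\<in>sphere 0 1. \<exists>G. G holomorphic_on ball 0 R \<and>
     (\<forall>t\<in>ball 0 R. norm (G t) \<le> B) \<and> (\<forall>\<tau>. \<bar>\<tau>\<bar> < R \<longrightarrow> G (of_real \<tau>) = kelvin_profile a c \<nu> s (X + \<tau> *\<^sub>R \<theta>))"
proof -
  let ?n = "CARD('n)"
  have X0: "norm X > 0" using P by (auto simp: kelvin_base_def)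
  define Q :: "complex \<Rightarrow> real ^ 'n \<Rightarrow> complex" where "Q t \<theta> = of_real ((norm X)\<^sup>2) + 2 * t * of_real (X \<bullet> \<theta>) + t\<^sup>2" for t \<theta>
  define S :: "complex \<Rightarrow> real ^ 'n \<Rightarrow> complex" where
    "S t \<theta> = Q t \<theta> * (1 - (\<Sum>i\<in>UNIV. of_real (a $ i) * (of_real c * ((of_real (X $ i) + t * of_real (\<theta> $ i)) / Q t \<theta>) - of_real (\<nu> $ i))\<^sup>2))" for t \<theta>
  \<comment> \<open>For \<open>|t| \<le> |X| / 5\<close> the change of \<open>Q\<close> is at most \<open>(2/5 + 1/25) |X|\<^sup>2\<close>, less than \<open>Q = |X|\<^sup>2\<close> at \<open>t = 0\<close>.\<close>
  define r1 where "r1 = norm X / 5"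
  have r1: "r1 > 0" using X0 by (simp add: r1_def)
  have ReQ: "Re (Q t \<theta>) > 0" if t: "norm t \<le> r1" and \<theta>: "norm \<theta> = 1" for t \<theta>
  proof -
    have "\<bar>X \<bullet> \<theta>\<bar> \<le> norm X" using Cauchy_Schwarz_ineq2[of X \<theta>] \<theta> by simp
    have "norm (2 * t * of_real (X \<bullet> \<theta>) + t\<^sup>2) \<le> 2 * norm t * \<bar>X \<bullet> \<theta>\<bar> + (norm t)\<^sup>2"
      by (rule order_trans[OF norm_triangle_ineq]) (simp add: norm_mult norm_power)
    also have "\<dots> \<le> 2 * r1 * norm X + r1\<^sup>2"
      using t r1 \<open>\<bar>X \<bullet> \<theta>\<bar> \<le> norm X\<close> by (intro add_mono mult_mono power_mono) auto
    also have "\<dots> < (norm X)\<^sup>2" using X0 by (simp add: r1_def power2_eq_square field_simps)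
    finally have "norm (2 * t * of_real (X \<bullet> \<theta>) + t\<^sup>2) < (norm X)\<^sup>2" .
    moreover have "Re (Q t \<theta>) = (norm X)\<^sup>2 + Re (2 * t * of_real (X \<bullet> \<theta>) + t\<^sup>2)" by (simp add: Q_def)
    moreover have "\<bar>Re (2 * t * of_real (X \<bullet> \<theta>) + t\<^sup>2)\<bar> \<le> norm (2 * t * of_real (X \<bullet> \<theta>) + t\<^sup>2)" by (rule abs_Re_le_cmod)
    ultimately show ?thesis by linarith
  qed
  have Q0: "Q t \<theta> \<noteq> 0" if "norm t \<le> r1" "norm \<theta> = 1" for t \<theta>
    using ReQ[OF that] by auto
  have real: "Q (of_real \<tau>) \<theta> = of_real ((norm (X + \<tau> *\<^sub>R \<theta>))\<^sup>2)" "S (of_real \<tau>) \<theta> = of_real (kelvin_base a c \<nu> (X + \<tau> *\<^sub>R \<theta>))"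
    if "norm \<theta> = 1" for \<tau> \<theta>
  proof -
    have "(norm (X + \<tau> *\<^sub>R \<theta>))\<^sup>2 = (norm X)\<^sup>2 + 2 * \<tau> * (X \<bullet> \<theta>) + \<tau>\<^sup>2"
      using that unfolding power2_norm_eq_inner
      by (simp add: inner_add_left inner_add_right inner_commute[of \<theta> X] power2_eq_square algebra_simps norm_eq_1)
    then show 1: "Q (of_real \<tau>) \<theta> = of_real ((norm (X + \<tau> *\<^sub>R \<theta>))\<^sup>2)" by (simp add: Q_def)
    show "S (of_real \<tau>) \<theta> = of_real (kelvin_base a c \<nu> (X + \<tau> *\<^sub>R \<theta>))"
      unfolding S_def 1 kelvin_base_def by simp
  qed
  define K where "K = cball (0::complex) r1 \<times> sphere (0 :: real ^ 'n) 1"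
  have K: "compact K" unfolding K_def by (intro compact_Times) auto
  have contQ: "continuous_on K (\<lambda>z. Q (fst z) (snd z))" unfolding Q_def by (intro continuous_intros)
  have contS: "continuous_on K (\<lambda>z. S (fst z) (snd z))"
    unfolding S_def using Q0 by (intro continuous_intros contQ) (auto simp: K_def)
  have "uniformly_continuous_on K (\<lambda>z. S (fst z) (snd z))" by (rule compact_uniformly_continuous[OF contS K])
  moreover have "kelvin_base a c \<nu> X / 2 > 0" using P by simp
  ultimately obtain d where d: "d > 0"
    and du: "\<And>z z'. z \<in> K \<Longrightarrow> z' \<in> K \<Longrightarrow> dist z' z < d \<Longrightarrow> dist (S (fst z') (snd z')) (S (fst z) (snd z)) < kelvin_base a c \<nu> X / 2"
    unfolding uniformly_continuous_on_def by metis
  define R where "R = min r1 (d / 2)"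
  have R: "R > 0" "R \<le> r1" "R < d" using r1 d by (auto simp: R_def)
  have ReS: "Re (S t \<theta>) > 0" if t: "norm t \<le> R" and \<theta>: "norm \<theta> = 1" for t \<theta>
  proof -
    have "dist (S t \<theta>) (S 0 \<theta>) < kelvin_base a c \<nu> X / 2"
      using du[of "(0, \<theta>)" "(t, \<theta>)"] t \<theta> R r1 by (auto simp: K_def dist_Pair_Pair)
    moreover have "S 0 \<theta> = of_real (kelvin_base a c \<nu> X)" using real(2)[OF \<theta>, of 0] by simp
    ultimately have "norm (S t \<theta> - of_real (kelvin_base a c \<nu> X)) < kelvin_base a c \<nu> X / 2" by (simp add: dist_norm)
    then have "\<bar>Re (S t \<theta> - of_real (kelvin_base a c \<nu> X))\<bar> < kelvin_base a c \<nu> X / 2"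
      using abs_Re_le_cmod order.strict_trans1 by blast
    then show ?thesis using P unfolding abs_less_iff by simp
  qed
  define G where "G s t \<theta> = exp (- (of_nat ?n / 2) * Ln (Q t \<theta>) + s * Ln (S t \<theta>))" for s t \<theta>
  have nonpos: "Q t \<theta> \<notin> \<real>\<^sub>\<le>\<^sub>0" "S t \<theta> \<notin> \<real>\<^sub>\<le>\<^sub>0" if "norm t \<le> R" "norm \<theta> = 1" for t \<theta>
    using ReQ[of t \<theta>] ReS[of t \<theta>] that R by (auto simp: complex_nonpos_Reals_iff)
  have hol: "(\<lambda>t. G s t \<theta>) holomorphic_on ball 0 R" if \<theta>: "norm \<theta> = 1" for s \<theta>
  proof -
    have hQ: "(\<lambda>t. Q t \<theta>) holomorphic_on ball 0 R" unfolding Q_def by (intro holomorphic_intros)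
    have hS: "(\<lambda>t. S t \<theta>) holomorphic_on ball 0 R"
      unfolding S_def using Q0[OF _ \<theta>] R by (intro holomorphic_intros hQ) auto
    show ?thesis unfolding G_def using nonpos[OF _ \<theta>] by (intro holomorphic_intros hQ hS) auto
  qed
  have bound: "\<exists>B. \<forall>s\<in>cball s0 1. \<forall>t\<in>cball 0 R. \<forall>\<theta>\<in>sphere 0 1. norm (G s t \<theta>) \<le> B" for s0
  proof -
    define K2 where "K2 = cball s0 1 \<times> cball (0::complex) R \<times> sphere (0 :: real ^ 'n) 1"
    have K2: "compact K2" unfolding K2_def by (intro compact_Times) auto
    have sub: "snd ` K2 \<subseteq> K" using R by (auto simp: K2_def K_def)
    have cQ: "continuous_on K2 (\<lambda>z. Q (fst (snd z)) (snd (snd z)))"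
      using continuous_on_compose2[OF contQ continuous_on_snd[OF continuous_on_id] sub] by simp
    have cS: "continuous_on K2 (\<lambda>z. S (fst (snd z)) (snd (snd z)))"
      using continuous_on_compose2[OF contS continuous_on_snd[OF continuous_on_id] sub] by simp
    have "continuous_on K2 (\<lambda>z. G (fst z) (fst (snd z)) (snd (snd z)))"
      unfolding G_def using nonpos by (intro continuous_intros cQ cS) (auto simp: K2_def)
    then have "bounded ((\<lambda>z. G (fst z) (fst (snd z)) (snd (snd z))) ` K2)"
      by (intro compact_imp_bounded compact_continuous_image K2)
    then obtain B where "\<And>z. z \<in> K2 \<Longrightarrow> norm (G (fst z) (fst (snd z)) (snd (snd z))) \<le> B"
      unfolding bounded_iff by auto
    then have "\<forall>s\<in>cball s0 1. \<forall>t\<in>cball 0 R. \<forall>\<theta>\<in>sphere 0 1. norm (G s t \<theta>) \<le> B"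
      by (force simp: K2_def)
    then show ?thesis by blast
  qed
  have val: "G s (of_real \<tau>) \<theta> = kelvin_profile a c \<nu> s (X + \<tau> *\<^sub>R \<theta>)" if \<tau>: "\<bar>\<tau>\<bar> < R" and \<theta>: "norm \<theta> = 1" for s \<tau> \<theta>
  proof -
    let ?Y = "X + \<tau> *\<^sub>R \<theta>"
    have Y: "(norm ?Y)\<^sup>2 > 0" "kelvin_base a c \<nu> ?Y > 0"
      using ReQ[of "of_real \<tau>" \<theta>] ReS[of "of_real \<tau>" \<theta>] real[OF \<theta>, of \<tau>] \<tau> \<theta> R by auto
    then have ny: "norm ?Y > 0" by simp
    have "- (of_nat ?n / 2) * Ln (Q (of_real \<tau>) \<theta>) = complex_of_real (- real ?n * ln (norm ?Y))"
    proof -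
      have "Ln (Q (of_real \<tau>) \<theta>) = of_real (ln ((norm ?Y)\<^sup>2))"
        unfolding real(1)[OF \<theta>] by (rule Ln_of_real[OF Y(1)])
      also have "ln ((norm ?Y)\<^sup>2) = 2 * ln (norm ?Y)" using ny by (simp add: ln_realpow)
      finally show ?thesis by simp
    qed
    moreover have "exp (complex_of_real (- real ?n * ln (norm ?Y))) = of_real (norm ?Y powr (- real ?n))"
      using ny by (simp add: powr_def exp_of_real[symmetric])
    moreover have "Ln (S (of_real \<tau>) \<theta>) = of_real (ln (kelvin_base a c \<nu> ?Y))" unfolding real[OF \<theta>] using Y by (simp add: Ln_of_real)
    ultimately show ?thesis using Y unfolding G_def kelvin_profile_def exp_add by (simp only:) simp
  qed
  show ?thesis
  proof (rule exI[of _ R], intro conjI allI)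
    fix s0
    obtain B where B: "\<forall>s\<in>cball s0 1. \<forall>t\<in>cball 0 R. \<forall>\<theta>\<in>sphere 0 1. norm (G s t \<theta>) \<le> B" using bound by blast
    show "\<exists>B. \<forall>s\<in>ball s0 1. \<forall>\<theta>\<in>sphere 0 1. \<exists>G. G holomorphic_on ball 0 R \<and>
     (\<forall>t\<in>ball 0 R. norm (G t) \<le> B) \<and> (\<forall>\<tau>. \<bar>\<tau>\<bar> < R \<longrightarrow> G (of_real \<tau>) = kelvin_profile a c \<nu> s (X + \<tau> *\<^sub>R \<theta>))"
    proof (rule exI[of _ B], intro ballI)
      fix s \<theta> assume "s \<in> ball s0 1" "\<theta> \<in> sphere (0 :: real ^ 'n) 1"
      then show "\<exists>G. G holomorphic_on ball 0 R \<and>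
         (\<forall>t\<in>ball 0 R. norm (G t) \<le> B) \<and> (\<forall>\<tau>. \<bar>\<tau>\<bar> < R \<longrightarrow> G (of_real \<tau>) = kelvin_profile a c \<nu> s (X + \<tau> *\<^sub>R \<theta>))"
        using B hol[of \<theta> s] val[of _ \<theta> s] by (intro exI[of _ "\<lambda>t. G s t \<theta>"]) auto
    qed
  qed (rule R(1))
qed

lemma central_diff_kelvin_profile_bound:
  fixes a \<nu> X :: "real ^ 'n"
  assumes P: "kelvin_base a c \<nu> X > 0" and m: "m \<ge> 1"
  shows "\<exists>r>0. \<exists>C. \<exists>\<rho>>0. \<forall>s\<in>ball s0 r. \<forall>y. norm y < \<rho> \<longrightarrow> norm (central_diff m (kelvin_profile a c \<nu> s) X y) \<le> C * norm y ^ (2 * m)"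
proof -
  obtain R where R: "R > 0" and RB: "\<forall>s0. \<exists>B. \<forall>s\<in>ball s0 1. \<forall>\<theta>\<in>sphere 0 1. \<exists>G. G holomorphic_on ball 0 R \<and>
     (\<forall>t\<in>ball 0 R. norm (G t) \<le> B) \<and> (\<forall>\<tau>. \<bar>\<tau>\<bar> < R \<longrightarrow> G (of_real \<tau>) = kelvin_profile a c \<nu> s (X + \<tau> *\<^sub>R \<theta>))"
    using complexified_kelvin_profile[OF P] by blast
  obtain B where B: "\<And>s \<theta>. s \<in> ball s0 1 \<Longrightarrow> \<theta> \<in> sphere 0 1 \<Longrightarrow> \<exists>G. G holomorphic_on ball 0 R \<and>
     (\<forall>t\<in>ball 0 R. norm (G t) \<le> B) \<and> (\<forall>\<tau>. \<bar>\<tau>\<bar> < R \<longrightarrow> G (of_real \<tau>) = kelvin_profile a c \<nu> s (X + \<tau> *\<^sub>R \<theta>))"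
    using RB by blast
  define C where "C = 2 * 4 ^ m * B * (2 * real m / R) ^ (2 * m)"
  define \<rho> where "\<rho> = R / (4 * real m)"
  have \<rho>: "\<rho> > 0" using R m by (simp add: \<rho>_def)
  have main: "norm (central_diff m (kelvin_profile a c \<nu> s) X y) \<le> C * norm y ^ (2 * m)" if s: "s \<in> ball s0 1" and y: "norm y < \<rho>" for s y
  proof (cases "y = 0")
    case True
    have "central_diff m (kelvin_profile a c \<nu> s) X y = of_real (\<Sum>k\<in>{- int m..int m}. diff_coeff m k) * kelvin_profile a c \<nu> s X"
      unfolding central_diff_def True by (simp add: sum_distrib_right)
    also have "(\<Sum>k\<in>{- int m..int m}. diff_coeff m k) = 0" using diff_coeff_moments[of 0 m] m by simp
    finally show ?thesis using True m by (simp add: power_0_left)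
  next
    case False
    define \<theta> where "\<theta> = y /\<^sub>R norm y"
    have \<theta>: "\<theta> \<in> sphere 0 1" "y = norm y *\<^sub>R \<theta>" using False by (auto simp: \<theta>_def)
    obtain G where G: "G holomorphic_on ball 0 R" "\<And>t. t \<in> ball 0 R \<Longrightarrow> norm (G t) \<le> B"
      "\<And>\<tau>. \<bar>\<tau>\<bar> < R \<Longrightarrow> G (of_real \<tau>) = kelvin_profile a c \<nu> s (X + \<tau> *\<^sub>R \<theta>)" using B[OF s \<theta>(1)] by blast
    have my: "real m * norm y \<le> R / 4" using y m by (simp add: \<rho>_def field_simps)
    have "central_diff m (kelvin_profile a c \<nu> s) X y = (\<Sum>k\<in>{- int m..int m}. of_real (diff_coeff m k) * G (of_real (real_of_int k * norm y)))"
      unfolding central_diff_def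
    proof (intro sum.cong refl)
      fix k assume k: "k \<in> {- int m..int m}"
      have "\<bar>real_of_int k * norm y\<bar> \<le> real m * norm y" unfolding abs_mult using k by (intro mult_mono) auto
      then have "\<bar>real_of_int k * norm y\<bar> < R" using my R by linarith
      then have "G (of_real (real_of_int k * norm y)) = kelvin_profile a c \<nu> s (X + (real_of_int k * norm y) *\<^sub>R \<theta>)" by (rule G(3))
      also have "(real_of_int k * norm y) *\<^sub>R \<theta> = real_of_int k *\<^sub>R y" by (subst (2) \<theta>(2)) simp
      finally show "of_real (diff_coeff m k) * kelvin_profile a c \<nu> s (X + real_of_int k *\<^sub>R y) = of_real (diff_coeff m k) * G (of_real (real_of_int k * norm y))"
        by simp
    qed
    then show ?thesis unfolding C_def using central_difference_bound[OF G(1) R G(2) norm_ge_zero my] by simp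
  qed
  show ?thesis
    by (rule exI[of _ 1], rule conjI, simp, rule exI[of _ C], rule exI[of _ \<rho>]) (use main \<rho> in auto)
qed

section \<open>Continuation in the order and the normalising constant\<close>

lemma real_Gamma_reflection: "Gamma x * Gamma (1 - x) = pi / sin (pi * x)" for x :: real
proof -
  have "complex_of_real (Gamma x * Gamma (1 - x)) = complex_of_real (pi / sin (pi * x))"
    using Gamma_reflection_complex[of "of_real x"]
    by (simp add: Gamma_complex_of_real[symmetric] sin_of_real[symmetric])
  then show ?thesis by (simp only: of_real_eq_iff)
qed

lemma w_fun_eq_Re: "w_fun a c \<nu> s x = Re (kelvin_profile a c \<nu> (of_real s) (x + \<nu>))"
  using w_fun_kelvin_profile[of a c \<nu> s x] by (metis Re_complex_of_real)

lemma w_fun_measurable [measurable]: "w_fun a c \<nu> s \<in> borel_measurable borel"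
  unfolding w_fun_eq_Re[abs_def] by measurable

lemma w_fun_inversion:
  "w_fun a c \<nu> s (z - \<nu>) = norm z powr (2 * s - real CARD('n)) * ellipsoid_profile a s (inversion c z - \<nu>)"
  for z \<nu> :: "real ^ 'n"
proof (cases "z = 0")
  case False
  then have "1 / norm z powr (real CARD('n) - 2 * s) = norm z powr (2 * s - real CARD('n))"
    by (simp add: powr_minus_divide[symmetric])
  then show ?thesis using False
    by (simp add: w_fun_def ellipsoid_profile_def kelvin_form_def inversion_def)
qed (simp add: w_fun_def)

lemma kelvin_base_pos_iff:
  assumes "X \<noteq> 0"
  shows "kelvin_base a c \<nu> X > 0 \<longleftrightarrow> quad_form a (inversion c X - \<nu>) < 1"
  using assms by (simp add: kelvin_base_def inversion_def zero_less_mult_iff)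

lemma delta_op_diff_coeff: "delta_op m u x y = (\<Sum>k\<in>{- int m..int m}. diff_coeff m k * u (x + real_of_int k *\<^sub>R y))"
  by (simp add: delta_op_def diff_coeff_def)

lemma frac_integrand_complex:
  fixes a \<nu> :: "real ^ 'n"
  assumes "y \<noteq> 0"
  shows "complex_of_real (frac_integrand m s (w_fun a c \<nu> s) x y)
    = central_diff m (kelvin_profile a c \<nu> (of_real s)) (x + \<nu>) y * riesz_kernel CARD('n) (of_real s) y"
proof -
  have e: "riesz_kernel CARD('n) (complex_of_real s) y = of_real (norm y powr (- (real CARD('n) + 2 * s)))"
    using assms by (simp add: powr_def exp_of_real[symmetric])
  have "central_diff m (kelvin_profile a c \<nu> (of_real s)) (x + \<nu>) y = of_real (delta_op m (w_fun a c \<nu> s) x y)"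
    by (simp add: central_diff_def delta_op_diff_coeff w_fun_kelvin_profile add_ac)
  then show ?thesis unfolding e by (simp only: frac_integrand_def powr_minus divide_inverse of_real_mult)
qed

text \<open>
  The chain of reductions for small orders: single terms of the difference, inversion, the integral for the
  ellipsoid, and the reflection formula for \<open>\<Gamma>(q) \<Gamma>(1-q)\<close>.
\<close>
lemma small_order_integral:
  fixes a \<nu> X :: "real ^ 'n"
  assumes c: "c > 0" and a: "\<And>i. a $ i > 0" and P: "kelvin_base a c \<nu> X > 0" and m: "m \<ge> 1" and q: "0 < q" "q < 1/2"
  shows "(\<integral>y. frac_integrand m q (w_fun a c \<nu> q) (X - \<nu>) y \<partial>lborel)
    = - (2 * pi / sin (pi * q)) * kernel_factor m q
      * ellipsoid_constant a q * c powr (2 * q) * norm X powr (- (real CARD('n) + 2 * q))"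
proof -
  let ?p = "real CARD('n) + 2 * q"
  let ?\<sigma> = "kernel_factor m q"
  have X0: "X \<noteq> 0" using P by (auto simp: kelvin_base_def)
  define w where "w z = w_fun a c \<nu> q (z - \<nu>)" for z
  define u where "u y = ellipsoid_profile a q (y - \<nu>)" for y
  have um[measurable]: "u \<in> borel_measurable borel" unfolding u_def by measurable
  have wm: "w \<in> borel_measurable borel" unfolding w_def by measurable
  have wu: "w z = norm z powr (2 * q - real DIM(real ^ 'n)) * u (inversion c z)" for z
    by (simp add: w_def u_def w_fun_inversion)
  let ?\<xi> = "inversion c X"
  have \<xi>: "quad_form a (?\<xi> - \<nu>) < 1" using P kelvin_base_pos_iff[OF X0] by blast
  define f where "f y = (u y - u ?\<xi>) * norm (y - ?\<xi>) powr (- ?p)" for y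
  have fm: "f \<in> borel_measurable borel" unfolding f_def by measurable
  have shift: "f (?\<xi> + 1 *\<^sub>R y) = (ellipsoid_profile a q ((?\<xi> - \<nu>) + y) - ellipsoid_profile a q (?\<xi> - \<nu>)) * norm y powr (- ?p)" for y
    by (simp add: f_def u_def algebra_simps)
  have fI: "integrable lborel f"
    using integrable_lborel_affine[OF _ fm, of 1 ?\<xi>] integrable_ellipsoid_difference[OF a \<xi> q] by (simp only: shift)
  have fV: "integral\<^sup>L lborel f = - (Gamma q * Gamma (1 - q) * ellipsoid_constant a q)"
    using integral_lborel_affine[OF _ fm, of 1 ?\<xi>] unfolding shift integral_ellipsoid_difference[OF a \<xi> q] by simp
  have fI': "integrable lborel (\<lambda>y. (u y - u ?\<xi>) * norm (y - ?\<xi>) powr (- (real DIM(real ^ 'n) + 2 * q)))"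
    using fI by (simp add: f_def[abs_def])
  have wI: "integrable lborel (\<lambda>z. (w z - w X) * norm (z - X) powr (- (real DIM(real ^ 'n) + 2 * q)))"
    by (rule integrable_kelvin_difference[OF c X0 q um fI' wu])
  have wV: "(\<integral>z. (w z - w X) * norm (z - X) powr (- (real DIM(real ^ 'n) + 2 * q)) \<partial>lborel)
      = c powr (2 * q) * norm X powr (- (real DIM(real ^ 'n) + 2 * q)) * integral\<^sup>L lborel f"
    using integral_kelvin_difference[OF c X0 q um fI' wu] by (simp add: f_def[abs_def])
  have "(\<integral>y. frac_integrand m q (w_fun a c \<nu> q) (X - \<nu>) y \<partial>lborel)
     = (\<integral>y. (\<Sum>k\<in>{- int m..int m}. diff_coeff m k * w (X + real_of_int k *\<^sub>R y)) * norm y powr (- (real DIM(real ^ 'n) + 2 * q)) \<partial>lborel)"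
  proof -
    have dim: "real DIM(real ^ 'n) = real CARD('n)" by simp
    show ?thesis
      by (intro Bochner_Integration.integral_cong refl)
         (simp only: frac_integrand_def delta_op_diff_coeff w_def powr_minus divide_inverse diff_add_eq dim)
  qed
  also have "\<dots> = 2 * ?\<sigma> * (c powr (2 * q) * norm X powr (- ?p) * (- (Gamma q * Gamma (1 - q) * ellipsoid_constant a q)))"
    using integral_diff_split[OF wm m wI] unfolding wV fV by simp
  also have "Gamma q * Gamma (1 - q) = pi / sin (pi * q)"
    by (rule real_Gamma_reflection)
  finally show ?thesis by simp
qed

text \<open>
  Both sides of the identity are holomorphic in the strip, once the poles of \<open>\<pi> / sin(\<pi> s)\<close> are multiplied
  away, and they agree on the segment \<open>0 < s < 1/2\<close>.
\<close>
lemma order_continuation: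
  fixes a \<nu> X :: "real ^ 'n"
  assumes c: "c > 0" and a: "\<And>i. a $ i > 0" and P: "kelvin_base a c \<nu> X > 0" and m: "m \<ge> 1"
  defines "F \<equiv> \<lambda>s. \<integral>y. central_diff m (kelvin_profile a c \<nu> s) X y * riesz_kernel CARD('n) s y \<partial>lborel"
  defines "E \<equiv> \<lambda>s. ellipsoid_constant_complex a s * exp (2 * s * of_real (ln c)) * riesz_kernel CARD('n) s X"
  shows "F holomorphic_on {s. 0 < Re s \<and> Re s < real m}"
    and "E holomorphic_on UNIV"
    and "\<And>s. 0 < Re s \<Longrightarrow> Re s < real m \<Longrightarrow> sin (of_real pi * s) * F s = - (2 * of_real pi) * kernel_sum m s * E s"
    and "\<And>s. 0 < Re s \<Longrightarrow> Re s < real m \<Longrightarrow> integrable lborel (\<lambda>y. central_diff m (kelvin_profile a c \<nu> s) X y * riesz_kernel CARD('n) s y)"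
    and "\<And>q. E (of_real q) = of_real (ellipsoid_constant a q * c powr (2 * q) * norm X powr (- (real CARD('n) + 2 * q)))"
proof -
  let ?S = "{s. 0 < Re s \<and> Re s < real m}"
  have X0: "norm X > 0" using P by (auto simp: kelvin_base_def)
  obtain r0 where r0: "r0 > 0" "\<And>X. norm X < r0 \<Longrightarrow> \<not> kelvin_base a c \<nu> X > 0"
    using kelvin_base_vanishes_near_zero[OF c a] by blast
  have vanish: "kelvin_profile a c \<nu> s Y = 0" if "norm Y < r0" for s Y
    using r0(2)[OF that] by (simp add: kelvin_profile_def)
  have growth: "norm (kelvin_profile a c \<nu> s Y) \<le> norm Y powr (2 * Re s - real DIM(real ^ 'n))" if "0 < Re s" for s Y
    using kelvin_profile_growth[OF a that] by simp
  note strip = kelvin_profile_measurable[of a c \<nu>] kelvin_profile_holomorphic[of a c \<nu>] r0(1) vanish growth central_diff_kelvin_profile_bound[OF P m]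
  show hF: "F holomorphic_on ?S"
    using holomorphic_diff_integral[OF strip] by (simp add: F_def)
  show int: "integrable lborel (\<lambda>y. central_diff m (kelvin_profile a c \<nu> s) X y * riesz_kernel CARD('n) s y)"
    if "0 < Re s" "Re s < real m" for s
    using integrable_diff[OF strip that] by simp
  show hE: "E holomorphic_on UNIV"
    unfolding E_def by (intro holomorphic_intros holomorphic_ellipsoid_constant a)
  show Er: "E (of_real q) = of_real (ellipsoid_constant a q * c powr (2 * q) * norm X powr (- (real CARD('n) + 2 * q)))" for q
  proof -
    have "exp (2 * complex_of_real q * of_real (ln c)) = of_real (c powr (2 * q))"
      using c by (simp add: powr_def exp_of_real[symmetric])
    moreover have "riesz_kernel CARD('n) (complex_of_real q) X = of_real (norm X powr (- (real CARD('n) + 2 * q)))"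
      using X0 by (simp add: powr_def exp_of_real[symmetric])
    ultimately show ?thesis unfolding E_def ellipsoid_constant_of_real[OF a] by simp
  qed
  have hK: "kernel_sum m holomorphic_on UNIV" unfolding kernel_sum_def[abs_def] by (intro holomorphic_intros)
  have openS: "open ?S" by (intro open_Collect_conj open_Collect_less continuous_intros)
  have "?S = {s. 0 < Re s} \<inter> {s. Re s < real m}" by auto
  then have "convex ?S" by (simp add: convex_Int convex_halfspace_Re_gt convex_halfspace_Re_lt)
  then have connS: "connected ?S" by (rule convex_connected)
  define D where "D s = sin (of_real pi * s) * F s + (2 * of_real pi) * kernel_sum m s * E s" for s
  have hD: "D holomorphic_on ?S"
    unfolding D_def by (intro holomorphic_intros hF holomorphic_on_subset[OF hE] holomorphic_on_subset[OF hK]) auto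
  have D0: "D (of_real q) = 0" if q: "0 < q" "q < 1/2" for q
  proof -
    let ?I = "\<integral>y. frac_integrand m q (w_fun a c \<nu> q) (X - \<nu>) y \<partial>lborel"
    have "F (of_real q) = (\<integral>y. complex_of_real (frac_integrand m q (w_fun a c \<nu> q) (X - \<nu>) y) \<partial>lborel)"
      unfolding F_def
    proof (rule integral_cong_AE)
      show "AE y in lborel. central_diff m (kelvin_profile a c \<nu> (of_real q)) X y * riesz_kernel CARD('n) (of_real q) y
         = complex_of_real (frac_integrand m q (w_fun a c \<nu> q) (X - \<nu>) y)"
        using AE_lborel_singleton[of 0] by eventually_elim (simp add: frac_integrand_complex)
      show "(\<lambda>y. central_diff m (kelvin_profile a c \<nu> (of_real q)) X y * riesz_kernel CARD('n) (of_real q) y) \<in> borel_measurable lborel"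
        unfolding central_diff_def by measurable
      show "(\<lambda>y. complex_of_real (frac_integrand m q (w_fun a c \<nu> q) (X - \<nu>) y)) \<in> borel_measurable lborel"
        unfolding frac_integrand_def delta_op_def by measurable
    qed
    then have FI: "F (of_real q) = of_real ?I" by simp
    have sin: "sin (pi * q) > 0" using q by (intro sin_gt_zero) auto
    have sin': "sin (complex_of_real pi * of_real q) = of_real (sin (pi * q))" by (simp flip: sin_of_real)
    have "D (of_real q) = of_real (sin (pi * q) * ?I + 2 * pi * kernel_factor m q
       * (ellipsoid_constant a q * c powr (2 * q) * norm X powr (- (real CARD('n) + 2 * q))))"
      unfolding D_def FI kernel_sum_of_real Er sin' by simp
    also have "\<dots> = 0" unfolding small_order_integral[OF c a P m q] using sin by simp
    finally show ?thesis .
  qed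
  have lim: "complex_of_real (1/4) islimpt (of_real ` {0<..<1/2::real})"
    unfolding islimpt_approachable
  proof (intro allI impI)
    fix e :: real assume e: "e > 0"
    define d where "d = min e (1/4) / 2"
    have d: "0 < d" "d < e" "d < 1/4" using e by (auto simp: d_def)
    have "dist (complex_of_real (1/4 + d)) (complex_of_real (1/4)) = d" using d by (simp add: dist_norm)
    then show "\<exists>x'\<in>of_real ` {0<..<1/2::real}. x' \<noteq> complex_of_real (1/4) \<and> dist x' (complex_of_real (1/4)) < e"
      using d by (intro bexI[of _ "complex_of_real (1/4 + d)"] conjI imageI) auto
  qed
  show "sin (of_real pi * s) * F s = - (2 * of_real pi) * kernel_sum m s * E s" if s: "0 < Re s" "Re s < real m" for s
  proof -
    have "D s = 0"
    proof (rule analytic_continuation[OF hD openS connS _ _ lim])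
      show "of_real ` {0<..<1/2::real} \<subseteq> ?S" using m by auto
      show "complex_of_real (1/4) \<in> ?S" using m by auto
      show "D z = 0" if "z \<in> of_real ` {0<..<1/2::real}" for z using that D0 by auto
    qed (use s in auto)
    then have "sin (of_real pi * s) * F s = - ((2 * of_real pi) * kernel_sum m s * E s)"
      unfolding D_def by (rule eq_neg_iff_add_eq_0[THEN iffD2])
    then show ?thesis by (simp only: mult_minus_left)
  qed
qed

definition solution_constant :: "real ^ 'n \<Rightarrow> real \<Rightarrow> real \<Rightarrow> real" where
  "solution_constant a c s = 4 powr s * Gamma (real CARD('n) / 2 + s) * Gamma (1 + s) / pi powr (real CARD('n) / 2)
     * (ellipsoid_constant a s * c powr (2 * s))"

lemma solution_constant_pos:
  fixes a :: "real ^ 'n"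
  assumes "c > 0" "\<And>i. a $ i > 0" "s > 0"
  shows "solution_constant a c s > 0"
proof -
  have "Gamma (real CARD('n) / 2 + s) > 0" "Gamma (1 + s) > 0" using assms(3) by (auto intro!: Gamma_real_pos add_nonneg_pos)
  then show ?thesis unfolding solution_constant_def using assms(1) ellipsoid_constant_pos[OF assms(2), of s]
    by (intro mult_pos_pos divide_pos_pos) auto
qed

text \<open>
  The quotient \<open>- \<pi> / sin(\<pi> s)\<close> equals \<open>\<Gamma>(-s) \<Gamma>(1+s)\<close>, whose first factor cancels the one in the normalising
  constant.
\<close>
lemma frac_const_noninteger:
  fixes I H s :: real
  assumes s: "0 < s" "s < real m" "s \<notin> \<nat>"
    and eq: "sin (pi * s) * I = - (2 * pi) * kernel_factor m s * H"
  shows "frac_const n m s / 2 * I = 4 powr s * Gamma (real n / 2 + s) * Gamma (1 + s) / pi powr (real n / 2) * H"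
proof -
  let ?\<sigma> = "kernel_factor m s"
  have \<sigma>: "?\<sigma> \<noteq> 0" by (rule kernel_sum_nonzero[OF s])
  have sZ: "s \<notin> \<int>" using s by (auto elim!: Ints_cases simp: Nats_altdef1)
  have sin: "sin (pi * s) \<noteq> 0"
    using sZ by (auto simp: sin_zero_iff_int2)
  have reflection: "Gamma (- s) * Gamma (1 + s) = - pi / sin (pi * s)"
    using real_Gamma_reflection[of "- s"] by simp
  have G: "Gamma (- s) \<noteq> 0" using reflection sin by auto
  have "I = - (2 * pi) * ?\<sigma> * H / sin (pi * s)" using eq sin by (simp add: field_simps)
  also have "\<dots> = 2 * ?\<sigma> * H * (- pi / sin (pi * s))" by simp
  also have "\<dots> = 2 * ?\<sigma> * H * (Gamma (- s) * Gamma (1 + s))" by (simp only: reflection)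
  finally have I: "I = 2 * ?\<sigma> * H * (Gamma (- s) * Gamma (1 + s))" .
  have "frac_const n m s = 4 powr s * Gamma (real n / 2 + s) / (pi powr (real n / 2) * Gamma (- s)) * inverse ?\<sigma>"
    using s by (simp add: frac_const_def)
  then show ?thesis unfolding I using \<sigma> G by (simp add: field_simps)
qed

text \<open>
  The sum in the normalising constant is, up to sign and a factor \<open>2\<close>, the derivative of the exponential sum
  at its simple zero \<open>j\<close>; the term \<open>k = 1\<close> is absent there because \<open>ln 1 = 0\<close>.
\<close>
lemma frac_const_integer:
  fixes I H :: real
  assumes j: "1 \<le> j" "j < m"
    and eq: "(-1) ^ j * I = - 4 * kernel_slope m j * H"
  shows "frac_const n m (real j) / 2 * I = 4 powr real j * Gamma (real n / 2 + real j) * Gamma (1 + real j) / pi powr (real n / 2) * H"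
proof -
  let ?\<tau> = "kernel_slope m j"
  have \<tau>: "?\<tau> \<noteq> 0" by (rule kernel_sum_simple_zero[OF j])
  have "(\<Sum>k=2..m. (- 1) powi (int k - \<lfloor>real j\<rfloor> + 1) * real ((2 * m) choose (m - k)) * real k powr (2 * real j) * ln (real k))
     = (\<Sum>k=2..m. (-1) ^ (j + 1) * (diff_coeff m (int k) * ln (real k) * real k powr (2 * real j)))"
  proof (rule sum.cong[OF refl])
    fix k assume k: "k \<in> {2..m}"
    have "(- 1 :: real) powi (int k - \<lfloor>real j\<rfloor> + 1) = (-1) ^ (j + 1) * (-1) ^ k"
    proof -
      have "(- 1 :: real) powi (int k - int j + 1) = (-1) powi (int k - int j) * (-1)" by (simp add: power_int_add)
      also have "(- 1 :: real) powi (int k - int j) = (-1) ^ k / (-1) ^ j" by (simp add: power_int_diff)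
      also have "(- 1 :: real) ^ k / (-1) ^ j = (-1) ^ k * (-1) ^ j" by (cases "even j") auto
      finally show ?thesis by simp
    qed
    then show "(- 1) powi (int k - \<lfloor>real j\<rfloor> + 1) * real ((2 * m) choose (m - k)) * real k powr (2 * real j) * ln (real k)
      = (-1) ^ (j + 1) * (diff_coeff m (int k) * ln (real k) * real k powr (2 * real j))"
      using k by (simp add: diff_coeff_of_nat)
  qed
  also have "\<dots> = (-1) ^ (j + 1) * (\<Sum>k=2..m. diff_coeff m (int k) * ln (real k) * real k powr (2 * real j))"
    by (simp only: sum_distrib_left)
  also have "(\<Sum>k=2..m. diff_coeff m (int k) * ln (real k) * real k powr (2 * real j)) = ?\<tau>"
  proof -
    have "{1..m} = insert 1 {2..m}" using j by auto
    then show ?thesis by simp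
  qed
  finally have "frac_const n m (real j) = 4 powr real j * Gamma (real n / 2 + real j) * fact j / (2 * pi powr (real n / 2)) * inverse ((-1) ^ (j + 1) * ?\<tau>)"
    by (simp add: frac_const_def)
  moreover have "I = (-1) ^ j * ((-1) ^ j * I)" by (cases "even j") auto
  then have "I = (-1) ^ j * (- 4 * ?\<tau> * H)" by (simp only: eq)
  moreover have "fact j = Gamma (1 + real j)" using Gamma_fact[of j, where ?'a=real] by simp
  ultimately show ?thesis using \<tau> by (cases "even j") (auto simp: field_simps)
qed

text \<open>
  The value of the difference integral is read off from \<open>order_continuation\<close>. At an integer order both sides
  of that identity vanish, and their derivatives are compared instead.
\<close>
lemma has_frac_laplacian_w_fun:
  fixes a \<nu> x :: "real ^ 'n"
  assumes c: "c > 0" and a: "\<And>i. a $ i > 0" and x: "x \<in> Omega a c \<nu>" and s: "s > 0"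
  shows "has_frac_laplacian (w_fun a c \<nu> s) (solution_constant a c s / norm (x + \<nu>) powr (real CARD('n) + 2 * s)) s x"
  unfolding has_frac_laplacian_def
proof (intro allI impI)
  fix m :: nat assume sm: "s < real m"
  then have m: "m \<ge> 1" using s by (cases m) auto
  define X where "X = x + \<nu>"
  have P: "kelvin_base a c \<nu> X > 0" using x by (simp add: Omega_iff X_def)
  define F where "F s = (\<integral>y. central_diff m (kelvin_profile a c \<nu> s) X y * riesz_kernel CARD('n) s y \<partial>lborel)" for s
  define E where "E s = ellipsoid_constant_complex a s * exp (2 * s * of_real (ln c)) * riesz_kernel CARD('n) s X" for s
  define H where "H q = ellipsoid_constant a q * c powr (2 * q) * norm X powr (- (real CARD('n) + 2 * q))" for q
  let ?S = "{s. 0 < Re s \<and> Re s < real m}"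
  note oc = order_continuation[OF c a P m, folded F_def E_def]
  have hF: "F holomorphic_on ?S" using oc(1) by (simp add: F_def[abs_def])
  have hE: "E holomorphic_on UNIV" using oc(2) by (simp add: E_def[abs_def])
  have FE: "sin (of_real pi * z) * F z = - (2 * of_real pi) * kernel_sum m z * E z" if "z \<in> ?S" for z
    using oc(3) that by simp
  have Er: "E (of_real q) = of_real (H q)" for q using oc(5) by (simp add: H_def)
  let ?f = "frac_integrand m s (w_fun a c \<nu> s) x"
  let ?I = "integral\<^sup>L lborel ?f"
  have fm[measurable]: "?f \<in> borel_measurable borel"
    unfolding frac_integrand_def[abs_def] delta_op_def by measurable
  let ?g = "\<lambda>y. central_diff m (kelvin_profile a c \<nu> (of_real s)) X y * riesz_kernel CARD('n) (of_real s) y"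
  have gm: "?g \<in> borel_measurable lborel" unfolding central_diff_def by measurable
  have ae: "AE y in lborel. complex_of_real (?f y) = ?g y"
    using AE_lborel_singleton[of 0] by eventually_elim (simp add: frac_integrand_complex X_def)
  have "integrable lborel ?g" using oc(4)[of "of_real s"] s sm by simp
  then have "integrable lborel (\<lambda>y. complex_of_real (?f y))"
    by (subst integrable_cong_AE[OF _ gm ae]) auto
  then have fI: "integrable lborel ?f" using integrable_Re by fastforce
  have "F (of_real s) = (\<integral>y. complex_of_real (?f y) \<partial>lborel)"
    unfolding F_def by (rule integral_cong_AE[OF gm]) (use ae in auto)
  then have FI: "F (of_real s) = of_real ?I" by simp
  have val: "frac_const CARD('n) m s / 2 * ?I = 4 powr s * Gamma (real CARD('n) / 2 + s) * Gamma (1 + s) / pi powr (real CARD('n) / 2) * H s"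
  proof (cases "s \<in> \<nat>")
    case False
    have "complex_of_real (sin (pi * s) * ?I) = of_real (- (2 * pi) * kernel_factor m s * H s)"
      using FE[of "of_real s"] s sm unfolding FI Er kernel_sum_of_real by (simp flip: sin_of_real)
    then show ?thesis by (intro frac_const_noninteger s sm False) (simp only: of_real_eq_iff)
  next
    case True
    then obtain j where sj: "s = real j" by (auto elim: Nats_cases)
    have j: "1 \<le> j" "j < m" using s sm sj by auto
    let ?\<tau> = "kernel_slope m j"
    define z where "z = complex_of_real s"
    have zS: "z \<in> ?S" using s sm by (simp add: z_def)
    have openS: "open ?S" by (intro open_Collect_conj open_Collect_less continuous_intros)
    obtain F' where F': "(F has_field_derivative F') (at z)" using hF openS zS holomorphic_derivI by blast
    obtain E' where E': "(E has_field_derivative E') (at z)" using hE holomorphic_derivI[OF hE open_UNIV] by blast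
    have K': "(kernel_sum m has_field_derivative (\<Sum>k=1..m. of_real (diff_coeff m (int k)) * (2 * of_real (ln (real k)) * exp (2 * z * of_real (ln (real k)))))) (at z)"
      unfolding kernel_sum_def[abs_def] by (auto intro!: derivative_eq_intros sum.cong)
    have Kval: "(\<Sum>k=1..m. of_real (diff_coeff m (int k)) * (2 * of_real (ln (real k)) * exp (2 * z * of_real (ln (real k))))) = complex_of_real (2 * ?\<tau>)"
      unfolding sum_distrib_left of_real_sum
      by (intro sum.cong refl) (auto simp: z_def sj powr_def exp_of_real[symmetric])
    have K0: "kernel_sum m z = 0"
      unfolding z_def kernel_sum_of_real sj kernel_sum_of_nat_zero[OF j] by simp
    have L: "((\<lambda>z. sin (of_real pi * z) * F z) has_field_derivative of_real pi * cos (of_real pi * z) * F z + sin (of_real pi * z) * F') (at z)"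
      by (auto intro!: derivative_eq_intros F')
    have R: "((\<lambda>z. - (2 * of_real pi) * kernel_sum m z * E z) has_field_derivative - (2 * of_real pi) * complex_of_real (2 * ?\<tau>) * E z + E' * (- (2 * of_real pi) * kernel_sum m z)) (at z)"
      by (rule DERIV_mult[OF DERIV_cmult[OF K'[unfolded Kval]] E'])
    have R2: "((\<lambda>z. sin (of_real pi * z) * F z) has_field_derivative - (2 * of_real pi) * complex_of_real (2 * ?\<tau>) * E z + E' * (- (2 * of_real pi) * kernel_sum m z)) (at z)"
      by (rule has_field_derivative_transform_within_open[OF R openS zS]) (simp add: FE)
    have sin0: "sin (of_real pi * z) = 0" "cos (of_real pi * z) = (-1) ^ j"
    proof -
      have e: "of_real pi * z = of_real (pi * real j)" by (simp add: z_def sj)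
      show "sin (of_real pi * z) = 0" "cos (of_real pi * z) = (-1) ^ j"
        unfolding e sin_of_real cos_of_real by (simp_all add: sin_npi2 cos_npi2)
    qed
    have "of_real pi * (-1) ^ j * F z = - (2 * of_real pi) * complex_of_real (2 * ?\<tau>) * E z"
      using DERIV_unique[OF L R2] K0 sin0 by simp
    then have "complex_of_real (pi * ((-1) ^ j * ?I)) = of_real (pi * (- 4 * ?\<tau> * H s))"
      unfolding z_def FI Er by (simp add: mult_ac)
    then have "pi * ((-1) ^ j * ?I) = pi * (- 4 * ?\<tau> * H s)" by (simp only: of_real_eq_iff)
    then have "(-1) ^ j * ?I = - 4 * ?\<tau> * H s" by (subst (asm) mult_left_cancel) auto
    then show ?thesis unfolding sj by (intro frac_const_integer j) (simp only: sj)
  qed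
  have "frac_laplacian m s (w_fun a c \<nu> s) x = frac_const CARD('n) m s / 2 * ?I"
    unfolding frac_laplacian_def by (subst integral_completion) auto
  also have "\<dots> = solution_constant a c s / norm (x + \<nu>) powr (real CARD('n) + 2 * s)"
    unfolding val H_def solution_constant_def by (simp only: X_def powr_minus_divide) simp
  finally show "integrable lebesgue ?f \<and> frac_laplacian m s (w_fun a c \<nu> s) x = solution_constant a c s / norm (x + \<nu>) powr (real CARD('n) + 2 * s)"
    using fI by (subst integrable_completion) auto
qed

lemma not_in_closure_Omega:
  fixes a \<nu> :: "real ^ 'n"
  assumes "c > 0" "\<And>i. a $ i > 0"
  shows "- \<nu> \<notin> closure (Omega a c \<nu>)"
proof -
  obtain r0 where r0: "r0 > 0" "\<And>X. norm X < r0 \<Longrightarrow> \<not> kelvin_base a c \<nu> X > 0"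
    using kelvin_base_vanishes_near_zero[OF assms] by blast
  have "Omega a c \<nu> \<subseteq> {x. r0 \<le> norm (x + \<nu>)}" using r0(2) by (force simp: Omega_iff)
  moreover have "closed {x. r0 \<le> norm (x + \<nu>)}" by (intro closed_Collect_le continuous_intros)
  ultimately have "closure (Omega a c \<nu>) \<subseteq> {x. r0 \<le> norm (x + \<nu>)}" by (rule closure_minimal)
  then show ?thesis using r0(1) by auto
qed

theorem corollary1p6:
  fixes a :: "real ^ 'n" and c :: real
  assumes "c > 0" and "\<And>i. a $ i > 0"
  shows "(\<forall>\<nu>. \<nu> \<notin> frontier (ellipsoid a) \<longrightarrow> - \<nu> \<notin> closure (Omega a c \<nu>)) \<and>
    (\<forall>s>0. \<exists>k>0. \<forall>\<nu>. \<nu> \<notin> frontier (ellipsoid a) \<longrightarrow>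
       pointwise_solution s (Omega a c \<nu>)
         (\<lambda>x. k / norm (x + \<nu>) powr (real CARD('n) + 2 * s)) (w_fun a c \<nu> s))"
proof (intro conjI allI impI)
  show "- \<nu> \<notin> closure (Omega a c \<nu>)" for \<nu> by (rule not_in_closure_Omega[OF assms])
next
  fix s :: real assume s: "s > 0"
  have zero: "w_fun a c \<nu> s x = 0" if "x \<in> - Omega a c \<nu>" for x \<nu>
    using that unfolding w_fun_eq_Re by (simp add: kelvin_profile_def Omega_iff)
  show "\<exists>k>0. \<forall>\<nu>. \<nu> \<notin> frontier (ellipsoid a) \<longrightarrow>
       pointwise_solution s (Omega a c \<nu>)
         (\<lambda>x. k / norm (x + \<nu>) powr (real CARD('n) + 2 * s)) (w_fun a c \<nu> s)"
  proof (intro exI[of _ "solution_constant a c s"] conjI allI impI)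
    show "solution_constant a c s > 0" by (rule solution_constant_pos[OF assms s])
    show "pointwise_solution s (Omega a c \<nu>) (\<lambda>x. solution_constant a c s / norm (x + \<nu>) powr (real CARD('n) + 2 * s)) (w_fun a c \<nu> s)" for \<nu>
      unfolding pointwise_solution_def using has_frac_laplacian_w_fun[OF assms _ s] zero by blast
  qed
qed

end
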